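(* Let $\psi_0\in\mathcal{F}_0$ be any vector such that $\langle\psi_0|A^8|\psi_0\rangle<\infty$. There exists a differentiable function $\psi:\mathbb{R}_{\ge0}\to\mathcal{F}_0$ with $\psi(0)=\psi_0$ such that for every $t\ge0$ one has $\langle\psi(t)|A^3|\psi(t)\rangle<\infty$ and $\psi(t)$ solves the Kolmogorov equation $$\frac{d}{dt}\psi(t)=(-A+B+C)\psi(t),$$ that is, $\|\psi(t+\delta)-\psi(t)-\delta(-A+B+C)\psi(t)\|=O(\delta^2)$ in the limit $\delta\to0$ (one-sided at $t=0$), in the norm of $\mathcal{F}_0$. Furthermore, for every cutoff parameter $k>0$ and all $t\ge0$, $$\|\psi_k(t)-\psi(t)\|^2\le\frac{12\gamma}{k^{1/2}}\left(\langle\psi_0|A|\psi_0\rangle+\kappa_1\langle\psi_0|\psi_0\rangle\right),$$ where $\psi_k$ is the solution of the regularized Kolmogorov equation with cutoff $k$ and $\psi_k(0)=\psi_0$, and $$\gamma=2q^{1/2}sJ\lambda_1^{-2}\left(1+\lambda_1^{1/2}q^{-1/2}\right),\qquad \kappa_1=2J^2s^2\lambda_1^{-1}\left(1+16q\lambda_1^{-1}\right).$$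
   Context: Data. $q>0$; $0<\lambda_1\le\dots\le\lambda_N$; real coefficients $b_{ij}$, $c_{ijk}$ ($1\le i,j,k\le N$) with $c_{ijk}=c_{ikj}$, $|b_{ij}|\le J$, $|c_{ijk}|\le J$; $s$-sparse: every row and column of $b$ has at most $s$ nonzeros and every two-dimensional slice of $c$ (fixing any one index) has at most $s$ nonzeros; divergence-free: $b_{ii}=0$, $c_{ijj}=c_{jij}=c_{jji}=0$, $\lambda_ib_{ij}+\lambda_jb_{ji}=0$ for $i\neq j$, and $\lambda_ic_{ijk}+\lambda_jc_{jki}+\lambda_kc_{kij}=0$ for distinct $i,j,k$. Fock space. $\mathcal{F}$ is the Hilbert space with orthonormal basis $|\mathbf{m}\rangle$, $\mathbf{m}\in\mathbb{Z}_{\ge0}^N$. With $e^i$ the $i$-th unit multi-index, $a_i|\mathbf{m}\rangle=\sqrt{m_i}|\mathbf{m}-e^i\rangle$ ($0$ if $m_i=0$), $a_i^\dagger|\mathbf{m}\rangle=\sqrt{m_i+1}|\mathbf{m}+e^i\rangle$. $\mathcal{J}=\mathbb{Z}_{\ge0}^N\setminus\{\mathbf{0}\}$, and $\mathcal{F}_0=\{\psi\in\mathcal{F}:\langle\mathbf{0}|\psi\rangle=0\}$ is the closed span of $|\mathbf{m}\rangle$, $\mathbf{m}\in\mathcal{J}$. Operators. $A=\sum_i\lambda_ia_i^\dagger a_i$ (diagonal, with eigenvalue $\lambda_{\mathbf{m}}=\sum_i\lambda_im_i$ on $|\mathbf{m}\rangle$), $B=\sum_{i,j}b_{ij}(\lambda_i/\lambda_j)^{1/2}a_j^\dagger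 a_i$, and $C=(q/2)^{1/2}\sum_{i,j,k}(\lambda_i\lambda_j\lambda_k)^{-1/2}\lambda_ic_{ijk}(a_j^\dagger a_k^\dagger a_i-a_i^\dagger a_ka_j)$. These are unbounded and act through their (finite-per-column) matrices in the Fock basis; $\langle\psi|A^p|\psi\rangle=\sum_{\mathbf{m}}\lambda_{\mathbf{m}}^p|\langle\mathbf{m}|\psi\rangle|^2\in[0,\infty]$. Regularization. For real $k>0$, $\mathcal{J}_k=\{\mathbf{m}\in\mathcal{J}:\lambda_{\mathbf{m}}\le k\}$ (a finite set, possibly empty) and $\Pi_k=\sum_{\mathbf{m}\in\mathcal{J}_k}|\mathbf{m}\rangle\langle\mathbf{m}|$. The regularized Kolmogorov equation is $\frac{d}{dt}\psi_k(t)=(-A+\Pi_k(B+C)\Pi_k)\psi_k(t)$ with $\psi_k(0)=\psi_0$; explicitly, $\Pi_k\psi_k(t)=e^{t\,\Pi_k(-A+B+C)\Pi_k}\Pi_k\psi_0$ (finite-dimensional matrix exponential on the range of $\Pi_k$) and $\langle\mathbf{m}|\psi_k(t)\rangle=e^{-\lambda_{\mathbf{m}}t}\langle\mathbf{m}|\psi_0\rangle$ for $\mathbf{m}\notin\mathcal{J}_k$. *)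

theory Defs
  imports "HOL-Analysis.Analysis" "HOL-Library.Landau_Symbols"
begin

section \<open>Square-summable complex families\<close>

definition square_summable :: "('a \<Rightarrow> complex) \<Rightarrow> bool" where
  "square_summable f \<longleftrightarrow> (\<lambda>x. (cmod (f x))\<^sup>2) summable_on UNIV"

typedef 'a ell2 = "{f :: 'a \<Rightarrow> complex. square_summable f}"
  morphisms coef Abs_ell2
  by (rule exI[of _ "\<lambda>_. 0"]) (simp add: square_summable_def)

lemma square_summable_coef [simp]: "square_summable (coef \<psi>)"
  using coef[of \<psi>] by simp

lemma coef_Abs: "square_summable f \<Longrightarrow> coef (Abs_ell2 f) = f"
  by (simp add: Abs_ell2_inverse)

lemma square_summable_add:
  assumes "square_summable f" "square_summable g"
  shows "square_summable (\<lambda>x. f x + g x)"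
  unfolding square_summable_def
proof (rule summable_on_comparison_test)
  show "(\<lambda>x. 2 * (cmod (f x))\<^sup>2 + 2 * (cmod (g x))\<^sup>2) summable_on UNIV"
    using assms unfolding square_summable_def
    by (intro summable_on_add summable_on_cmult_right)
  fix x
  have "(cmod (f x + g x))\<^sup>2 \<le> (cmod (f x) + cmod (g x))\<^sup>2"
    by (intro power_mono norm_triangle_ineq) auto
  also have "\<dots> \<le> 2 * (cmod (f x))\<^sup>2 + 2 * (cmod (g x))\<^sup>2"
    using sum_squares_ge_zero[of "cmod (f x) - cmod (g x)" 0]
    by (simp add: power2_eq_square algebra_simps)
  finally show "(cmod (f x + g x))\<^sup>2 \<le> 2 * (cmod (f x))\<^sup>2 + 2 * (cmod (g x))\<^sup>2" .
qed auto

lemma square_summable_scale: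
  assumes "square_summable f"
  shows "square_summable (\<lambda>x. c * f x)"
  using assms unfolding square_summable_def
  by (simp add: norm_mult power_mult_distrib summable_on_cmult_right)

lemma square_summable_finite_change:
  assumes "square_summable f" "finite S" "\<And>x. x \<notin> S \<Longrightarrow> cmod (g x) \<le> cmod (f x)"
  shows "square_summable g"
  unfolding square_summable_def
proof (rule summable_on_comparison_test)
  show "(\<lambda>x. (cmod (f x))\<^sup>2 + (if x \<in> S then (cmod (g x))\<^sup>2 else 0)) summable_on UNIV"
  proof (rule summable_on_add)
    show "(\<lambda>x. (cmod (f x))\<^sup>2) summable_on UNIV"
      using assms(1) by (simp add: square_summable_def)
    have "(\<lambda>x. if x \<in> S then (cmod (g x))\<^sup>2 else 0) summable_on S"
      using assms(2) by simp
    then show "(\<lambda>x. if x \<in> S then (cmod (g x))\<^sup>2 else 0) summable_on UNIV"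
      by (subst (asm) summable_on_cong_neutral[where T = UNIV]) auto
  qed
  show "(cmod (g x))\<^sup>2 \<le> (cmod (f x))\<^sup>2 + (if x \<in> S then (cmod (g x))\<^sup>2 else 0)" for x
    using assms(3)[of x] by (auto intro: power_mono)
qed auto

lemma summable_Re_cnj:
  assumes "square_summable f" "square_summable g"
  shows "(\<lambda>x. Re (cnj (f x) * g x)) summable_on UNIV"
proof -
  have eq: "Re (cnj (f x) * g x) = (1/2) * (cmod (f x + g x))\<^sup>2
      + ((-1/2) * (cmod (f x))\<^sup>2 + (-1/2) * (cmod (g x))\<^sup>2)" for x
    unfolding cmod_power2 by (simp add: power2_eq_square algebra_simps)
  show ?thesis
    unfolding eq using assms square_summable_add[OF assms] unfolding square_summable_def
    by (intro summable_on_add summable_on_cmult_right)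
qed

text \<open>
  As \<open>'a ell2\<close> is only used as a real normed space below, the inner product recorded
  here is the real part of the usual complex one; both induce the same norm.
\<close>

instantiation ell2 :: (type) real_inner
begin

definition "0 = Abs_ell2 (\<lambda>_. 0)"
definition "\<psi> + \<phi> = Abs_ell2 (\<lambda>x. coef \<psi> x + coef \<phi> x)"
definition "- \<psi> = Abs_ell2 (\<lambda>x. - coef \<psi> x)"
definition "\<psi> - \<phi> = Abs_ell2 (\<lambda>x. coef \<psi> x - coef \<phi> x)"
definition "r *\<^sub>R \<psi> = Abs_ell2 (\<lambda>x. complex_of_real r * coef \<psi> x)"
definition "inner \<psi> \<phi> = (\<Sum>\<^sub>\<infinity>x. Re (cnj (coef \<psi> x) * coef \<phi> x))"
definition "norm \<psi> = sqrt (\<Sum>\<^sub>\<infinity>x. (cmod (coef \<psi> x))\<^sup>2)"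
definition "sgn (\<psi> :: 'a ell2) = inverse (norm \<psi>) *\<^sub>R \<psi>"
definition "dist (\<psi> :: 'a ell2) \<phi> = norm (\<psi> - \<phi>)"
definition
  "(uniformity :: ('a ell2 \<times> 'a ell2) filter) = (INF e\<in>{0<..}. principal {(x, y). dist x y < e})"
definition
  "open (U :: 'a ell2 set) \<longleftrightarrow> (\<forall>x\<in>U. eventually (\<lambda>(x', y). x' = x \<longrightarrow> y \<in> U) uniformity)"

lemma coef_zero: "coef 0 = (\<lambda>_. 0)"
  unfolding zero_ell2_def by (rule coef_Abs) (simp add: square_summable_def)

lemma coef_add: "coef (\<psi> + \<phi>) = (\<lambda>x. coef \<psi> x + coef \<phi> x)"
  unfolding plus_ell2_def by (intro coef_Abs square_summable_add) auto

lemma coef_uminus: "coef (- \<psi>) = (\<lambda>x. - coef \<psi> x)"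
  unfolding uminus_ell2_def
  using square_summable_scale[of "coef \<psi>" "-1"] by (intro coef_Abs) simp

lemma coef_diff: "coef (\<psi> - \<phi>) = (\<lambda>x. coef \<psi> x - coef \<phi> x)"
  unfolding minus_ell2_def
  using square_summable_add[of "coef \<psi>" "\<lambda>x. (-1) * coef \<phi> x"]
    square_summable_scale[of "coef \<phi>" "-1"] by (intro coef_Abs) simp

lemma coef_scaleR: "coef (r *\<^sub>R \<psi>) = (\<lambda>x. complex_of_real r * coef \<psi> x)"
  unfolding scaleR_ell2_def by (intro coef_Abs square_summable_scale) auto

lemmas coef_simps = coef_zero coef_add coef_uminus coef_diff coef_scaleR

lemma inner_self: "inner \<psi> \<psi> = (\<Sum>\<^sub>\<infinity>x. (cmod (coef \<psi> x))\<^sup>2)"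
  unfolding inner_ell2_def
  by (intro infsum_cong) (simp only: cmod_power2, simp add: power2_eq_square)

instance
proof
  fix x y z :: "'a ell2" and r s :: real
  note eqI = coef_inject[THEN iffD1]
  show "x + y + z = x + (y + z)" "x + y = y + x" "0 + x = x" "- x + x = 0" "x - y = x + - y"
    by (rule eqI, simp add: coef_simps add_ac)+
  show "r *\<^sub>R (x + y) = r *\<^sub>R x + r *\<^sub>R y" "(r + s) *\<^sub>R x = r *\<^sub>R x + s *\<^sub>R x"
       "r *\<^sub>R s *\<^sub>R x = (r * s) *\<^sub>R x" "1 *\<^sub>R x = x"
    by (rule eqI, simp add: coef_simps algebra_simps)+
  show "inner x y = inner y x"
    unfolding inner_ell2_def by (intro infsum_cong) simp
  show "inner (x + y) z = inner x z + inner y z"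
  proof -
    have "inner (x + y) z =
        (\<Sum>\<^sub>\<infinity>a. Re (cnj (coef x a) * coef z a) + Re (cnj (coef y a) * coef z a))"
      unfolding inner_ell2_def coef_add complex_cnj_add distrib_right plus_complex.sel ..
    also have "\<dots> = inner x z + inner y z"
      unfolding inner_ell2_def by (intro infsum_add summable_Re_cnj) auto
    finally show ?thesis .
  qed
  have "inner (r *\<^sub>R x) y = (\<Sum>\<^sub>\<infinity>a. r * Re (cnj (coef x a) * coef y a))"
    unfolding inner_ell2_def coef_scaleR by (intro infsum_cong) (simp add: algebra_simps)
  also have "\<dots> = r * inner x y"
    unfolding inner_ell2_def by (intro infsum_cmult_right summable_Re_cnj) auto
  finally show "inner (r *\<^sub>R x) y = r * inner x y" .
  show "0 \<le> inner x x"
    unfolding inner_self by (intro infsum_nonneg) auto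
  show "inner x x = 0 \<longleftrightarrow> x = 0"
  proof
    assume "inner x x = 0"
    then have "(cmod (coef x a))\<^sup>2 = 0" for a
      unfolding inner_self
      by (intro nonneg_infsum_le_0D[where A = UNIV])
         (auto simp: square_summable_coef[unfolded square_summable_def])
    then show "x = 0" by (intro eqI) (auto simp: coef_zero)
  qed (simp add: inner_self coef_zero)
  show "norm x = sqrt (inner x x)"
    by (simp add: inner_self norm_ell2_def)
qed (rule sgn_ell2_def dist_ell2_def uniformity_ell2_def open_ell2_def)+

end


section \<open>Fock space\<close>

text \<open>Mode labels form a finite linearly ordered type \<open>'n\<close>, so \<open>N = CARD('n)\<close>.\<close>

type_synonym 'n fock = "('n \<Rightarrow> nat) ell2"

definition fock0 :: "'n fock set" where
  "fock0 = {\<psi>. coef \<psi> (\<lambda>_. 0) = 0}"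

definition eigval :: "('n::finite \<Rightarrow> real) \<Rightarrow> ('n \<Rightarrow> nat) \<Rightarrow> real" where
  "eigval lam m = (\<Sum>i\<in>UNIV. lam i * real (m i))"

definition moment :: "('n::finite \<Rightarrow> real) \<Rightarrow> nat \<Rightarrow> 'n fock \<Rightarrow> ennreal" where
  "moment lam p \<psi> = (\<Sum>\<^sub>\<infinity>m. ennreal (eigval lam m ^ p * (cmod (coef \<psi> m))\<^sup>2))"


subsection \<open>Operators\<close>

text \<open>
  The operators are unbounded, but every row and every column of their matrices in the Fock
  basis is finite. They are therefore defined on arbitrary coefficient families
  \<open>f :: ('n \<Rightarrow> nat) \<Rightarrow> complex\<close>, the value at \<open>m\<close> being the sum of \<open>\<langle>m|T|m'\<rangle> f m'\<close> over \<open>m'\<close>;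
  whether the result is square-summable is a separate question. The action on the basis
  vectors is given by \<open>annihilate_ket\<close> and \<open>create_ket\<close> below.
\<close>

definition annihilate :: "'n \<Rightarrow> (('n \<Rightarrow> nat) \<Rightarrow> complex) \<Rightarrow> ('n \<Rightarrow> nat) \<Rightarrow> complex" where
  "annihilate i f m = of_real (sqrt (real (m i) + 1)) * f (m(i := m i + 1))"

definition create :: "'n \<Rightarrow> (('n \<Rightarrow> nat) \<Rightarrow> complex) \<Rightarrow> ('n \<Rightarrow> nat) \<Rightarrow> complex" where
  "create i f m = (if m i = 0 then 0 else of_real (sqrt (real (m i))) * f (m(i := m i - 1)))"

definition ket :: "('n \<Rightarrow> nat) \<Rightarrow> ('n \<Rightarrow> nat) \<Rightarrow> complex" where
  "ket m = (\<lambda>m'. if m' = m then 1 else 0)"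

lemma annihilate_ket:
  "annihilate i (ket m) =
     (if m i = 0 then (\<lambda>_. 0) else (\<lambda>m'. of_real (sqrt (real (m i))) * ket (m(i := m i - 1)) m'))"
proof (rule ext)
  fix m'
  have "m'(i := m' i + 1) = m \<longleftrightarrow> m i \<noteq> 0 \<and> m' = m(i := m i - 1)"
    by force
  then show "annihilate i (ket m) m' =
      (if m i = 0 then (\<lambda>_. 0) else (\<lambda>m'. of_real (sqrt (real (m i))) * ket (m(i := m i - 1)) m')) m'"
    by (auto simp: annihilate_def ket_def)
qed

lemma create_ket:
  "create i (ket m) = (\<lambda>m'. of_real (sqrt (real (m i) + 1)) * ket (m(i := m i + 1)) m')"
proof (rule ext)
  fix m'
  have "m' i \<noteq> 0 \<and> m'(i := m' i - 1) = m \<longleftrightarrow> m' = m(i := m i + 1)"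
    by force
  then show "create i (ket m) m' = of_real (sqrt (real (m i) + 1)) * ket (m(i := m i + 1)) m'"
    by (auto simp: create_def ket_def)
qed

definition A_op :: "('n::finite \<Rightarrow> real) \<Rightarrow> (('n \<Rightarrow> nat) \<Rightarrow> complex) \<Rightarrow> ('n \<Rightarrow> nat) \<Rightarrow> complex" where
  "A_op lam f m = (\<Sum>i\<in>UNIV. of_real (lam i) * create i (annihilate i f) m)"

definition B_op :: "('n::finite \<Rightarrow> real) \<Rightarrow> ('n \<Rightarrow> 'n \<Rightarrow> real) \<Rightarrow>
    (('n \<Rightarrow> nat) \<Rightarrow> complex) \<Rightarrow> ('n \<Rightarrow> nat) \<Rightarrow> complex" where
  "B_op lam b f m =
     (\<Sum>i\<in>UNIV. \<Sum>j\<in>UNIV. of_real (b i j * sqrt (lam i / lam j)) * create j (annihilate i f) m)"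

definition C_op :: "real \<Rightarrow> ('n::finite \<Rightarrow> real) \<Rightarrow> ('n \<Rightarrow> 'n \<Rightarrow> 'n \<Rightarrow> real) \<Rightarrow>
    (('n \<Rightarrow> nat) \<Rightarrow> complex) \<Rightarrow> ('n \<Rightarrow> nat) \<Rightarrow> complex" where
  "C_op q lam c f m =
     of_real (sqrt (q / 2)) * (\<Sum>i\<in>UNIV. \<Sum>j\<in>UNIV. \<Sum>k\<in>UNIV.
       of_real (lam i * c i j k / sqrt (lam i * lam j * lam k)) *
         (create j (create k (annihilate i f)) m - create i (annihilate k (annihilate j f)) m))"

lemma A_op_eigval: "A_op lam f m = of_real (eigval lam m) * f m"
proof -
  have "create i (annihilate i f) m = of_real (real (m i)) * f m" for i
    by (simp add: create_def annihilate_def flip: of_real_mult mult.assoc)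
  then show ?thesis by (simp add: A_op_def eigval_def sum_distrib_right mult.assoc)
qed

definition K_op :: "real \<Rightarrow> ('n::finite \<Rightarrow> real) \<Rightarrow> ('n \<Rightarrow> 'n \<Rightarrow> real) \<Rightarrow> ('n \<Rightarrow> 'n \<Rightarrow> 'n \<Rightarrow> real) \<Rightarrow>
    (('n \<Rightarrow> nat) \<Rightarrow> complex) \<Rightarrow> ('n \<Rightarrow> nat) \<Rightarrow> complex" where
  "K_op q lam b c f m = - A_op lam f m + B_op lam b f m + C_op q lam c f m"


subsection \<open>Regularized equation\<close>

definition cutoff_set :: "('n::finite \<Rightarrow> real) \<Rightarrow> real \<Rightarrow> ('n \<Rightarrow> nat) set" where
  "cutoff_set lam k = {m. m \<noteq> (\<lambda>_. 0) \<and> eigval lam m \<le> k}"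

definition cutoff :: "('n::finite \<Rightarrow> real) \<Rightarrow> real \<Rightarrow>
    (('n \<Rightarrow> nat) \<Rightarrow> complex) \<Rightarrow> ('n \<Rightarrow> nat) \<Rightarrow> complex" where
  "cutoff lam k f m = (if m \<in> cutoff_set lam k then f m else 0)"

definition K_cut :: "real \<Rightarrow> ('n::finite \<Rightarrow> real) \<Rightarrow> ('n \<Rightarrow> 'n \<Rightarrow> real) \<Rightarrow> ('n \<Rightarrow> 'n \<Rightarrow> 'n \<Rightarrow> real) \<Rightarrow>
    real \<Rightarrow> (('n \<Rightarrow> nat) \<Rightarrow> complex) \<Rightarrow> ('n \<Rightarrow> nat) \<Rightarrow> complex" where
  "K_cut q lam b c k f = cutoff lam k (K_op q lam b c (cutoff lam k f))"

text \<open>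
  Inside the cutoff, the sum over \<open>n\<close> is the exponential series of the finite matrix of
  \<open>K_cut\<close>, applied to the projected initial vector.
\<close>

definition reg_coef :: "real \<Rightarrow> ('n::finite \<Rightarrow> real) \<Rightarrow> ('n \<Rightarrow> 'n \<Rightarrow> real) \<Rightarrow> ('n \<Rightarrow> 'n \<Rightarrow> 'n \<Rightarrow> real) \<Rightarrow>
    real \<Rightarrow> 'n fock \<Rightarrow> real \<Rightarrow> ('n \<Rightarrow> nat) \<Rightarrow> complex" where
  "reg_coef q lam b c k \<psi>0 t m =
     (if m \<in> cutoff_set lam k
      then (\<Sum>n. of_real (t ^ n / fact n) *
                 (K_cut q lam b c k ^^ n) (cutoff lam k (coef \<psi>0)) m)
      else of_real (exp (- (eigval lam m * t))) * coef \<psi>0 m)"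

definition reg_solution :: "real \<Rightarrow> ('n::finite \<Rightarrow> real) \<Rightarrow> ('n \<Rightarrow> 'n \<Rightarrow> real) \<Rightarrow> ('n \<Rightarrow> 'n \<Rightarrow> 'n \<Rightarrow> real) \<Rightarrow>
    real \<Rightarrow> 'n fock \<Rightarrow> real \<Rightarrow> 'n fock" where
  "reg_solution q lam b c k \<psi>0 t = Abs_ell2 (reg_coef q lam b c k \<psi>0 t)"

lemma eigval_nonneg: "(\<And>i. 0 < lam i) \<Longrightarrow> 0 \<le> eigval lam m"
  unfolding eigval_def by (intro sum_nonneg mult_nonneg_nonneg) (auto intro: less_imp_le)

lemma finite_cutoff_set:
  fixes lam :: "'n::finite \<Rightarrow> real"
  assumes pos: "\<And>i. 0 < lam i"
  shows "finite (cutoff_set lam k)"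
proof -
  define M where "M = nat \<lceil>MAX i. k / lam i\<rceil>"
  have "m i \<le> M" if "eigval lam m \<le> k" for m i
  proof -
    have "lam i * real (m i) \<le> eigval lam m"
      unfolding eigval_def
      by (rule member_le_sum) (auto intro: mult_nonneg_nonneg less_imp_le[OF pos])
    then have "real (m i) \<le> k / lam i"
      using that pos[of i] by (simp add: field_simps)
    also have "\<dots> \<le> (MAX i. k / lam i)" by (intro Max_ge) auto
    finally show ?thesis unfolding M_def by linarith
  qed
  then have "cutoff_set lam k \<subseteq> (UNIV \<rightarrow>\<^sub>E {..M})"
    by (auto simp: cutoff_set_def PiE_def)
  then show ?thesis by (rule finite_subset) (intro finite_PiE, auto)
qed

lemma coef_reg_solution:
  assumes pos: "\<And>i. 0 < lam i" and "0 \<le> t"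
  shows "coef (reg_solution q lam b c k \<psi>0 t) = reg_coef q lam b c k \<psi>0 t"
  unfolding reg_solution_def
proof (rule coef_Abs, rule square_summable_finite_change)
  show "square_summable (coef \<psi>0)" by simp
  show "finite (cutoff_set lam k)" by (rule finite_cutoff_set[OF pos])
  fix m assume "m \<notin> cutoff_set lam k"
  moreover have "exp (- (eigval lam m * t)) \<le> 1"
    using eigval_nonneg[of lam m] assms by simp
  ultimately show "cmod (reg_coef q lam b c k \<psi>0 t m) \<le> cmod (coef \<psi>0 m)"
    by (simp add: reg_coef_def norm_mult mult_left_le_one_le)
qed


section \<open>Assumptions on the coefficients\<close>

definition sparse_coeffs :: "nat \<Rightarrow> ('n::finite \<Rightarrow> 'n \<Rightarrow> real) \<Rightarrow> ('n \<Rightarrow> 'n \<Rightarrow> 'n \<Rightarrow> real) \<Rightarrow> bool" where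
  "sparse_coeffs s b c \<longleftrightarrow>
     (\<forall>i. card {j. b i j \<noteq> 0} \<le> s) \<and> (\<forall>j. card {i. b i j \<noteq> 0} \<le> s) \<and>
     (\<forall>i. card {(j, k). c i j k \<noteq> 0} \<le> s) \<and>
     (\<forall>j. card {(i, k). c i j k \<noteq> 0} \<le> s) \<and>
     (\<forall>k. card {(i, j). c i j k \<noteq> 0} \<le> s)"

definition divergence_free ::
    "('n::finite \<Rightarrow> real) \<Rightarrow> ('n \<Rightarrow> 'n \<Rightarrow> real) \<Rightarrow> ('n \<Rightarrow> 'n \<Rightarrow> 'n \<Rightarrow> real) \<Rightarrow> bool" where
  "divergence_free lam b c \<longleftrightarrow>
     (\<forall>i. b i i = 0) \<and>
     (\<forall>i j. c i j j = 0 \<and> c j i j = 0 \<and> c j j i = 0) \<and>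
     (\<forall>i j. i \<noteq> j \<longrightarrow> lam i * b i j + lam j * b j i = 0) \<and>
     (\<forall>i j k. i \<noteq> j \<and> j \<noteq> k \<and> i \<noteq> k \<longrightarrow>
        lam i * c i j k + lam j * c j k i + lam k * c k i j = 0)"

end

theory Submission
  imports Defs
begin

text \<open>
  By divergence-freeness the operator \<open>M = B + C\<close> is real and antisymmetric, so only commutators
  enter the evolution of \<open>\<langle>h(A)\<rangle>\<close>. The commutator with \<open>A\<close> is controlled by \<open>A\<^sup>2\<close>, which makes
  \<open>\<langle>A\<rangle> + \<kappa>\<^sub>1\<langle>1\<rangle>\<close> decrease at rate at least \<open>\<langle>A\<^sup>2\<rangle>\<close>. For two cutoffs \<open>k \<le> l\<close> the distance of the
  regularized solutions grows at most at rate \<open>3\<gamma> k\<^sup>-\<^sup>1\<^sup>/\<^sup>2\<close> times the sum of their \<open>\<langle>A\<^sup>2\<rangle>\<close>, because by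
  antisymmetry only components above level \<open>k\<close> contribute. Adding both gives a Lyapunov function,
  hence a Cauchy estimate as \<open>k \<rightarrow> \<infinity>\<close>. A Gronwall bound on the eighth moment passes to the limit and
  bounds the second derivative of the solution. The matrices have finite rows, so the
  differential equation passes to the limit coefficientwise, and Taylor's theorem gives the
  quadratic remainder.
\<close>

section \<open>Ladder operators on level sets\<close>

text \<open>The obstacle is unboundedness: \<open>B\<close> and \<open>C\<close> do not map all of
  Fock space into itself, and \<open>C\<close> changes the number of excitations, so forms such as
  \<langle>f|M f\<rangle> cannot be manipulated directly. All algebra is therefore done with finite
  sums over \<open>lev lam k\<close>. Annihilation preserves support in such a set, creation does
  not, so creation operators are moved by adjunction to the other side of the form. What remains are
  expectations of number operators, estimated by Young's inequality with a free parameter. Sparsity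
  keeps the number of modes out of the explicit constants. The parameter is chosen last: in the
  energy estimate so that \<open>B\<close> and \<open>C\<close> consume one of the two copies of the
  second moment that damping provides, in the distance estimate as \<open>sqrt k\<close>, which
  balances a tail of size \<open>1 / k\<close> against a bulk term and is the origin of the rate.
  For the higher moments no explicit constant is required, so there the bounds are crude and only
  powers of a weight are counted: each ladder operator costs one.\<close>

definition lev :: "('n::finite \<Rightarrow> real) \<Rightarrow> real \<Rightarrow> ('n \<Rightarrow> nat) set" where
  "lev lam k = {m. eigval lam m \<le> k}"

definition supp_in :: "'a set \<Rightarrow> ('a \<Rightarrow> complex) \<Rightarrow> bool" where
  "supp_in S f \<longleftrightarrow> (\<forall>m. m \<notin> S \<longrightarrow> f m = 0)"

text \<open>This is the real part of the Hermitian form, since \<open>inner\<close> on complex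
  numbers is the inner product of the plane. It suffices because \<open>B\<close> and
  \<open>C\<close> have real coefficients and derivatives of squared norms see only this
  part.\<close>

definition ip :: "'a set \<Rightarrow> ('a \<Rightarrow> complex) \<Rightarrow> ('a \<Rightarrow> complex) \<Rightarrow> real" where
  "ip S f g = (\<Sum>m\<in>S. inner (f m) (g m))"

text \<open>The expectation of the diagonal operator with entries \<open>v\<close>, kept as a sum
  over a chosen set so that no summability has to be tracked before the final limit.\<close>

definition wsum :: "'a set \<Rightarrow> ('a \<Rightarrow> real) \<Rightarrow> ('a \<Rightarrow> complex) \<Rightarrow> real" where
  "wsum S v f = (\<Sum>m\<in>S. v m * (cmod (f m))\<^sup>2)"

lemma eigval_raise:
  "eigval lam (m(i := Suc (m i))) = eigval lam m + lam i"
proof -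
  have "eigval lam (m(i := Suc (m i))) = (\<Sum>j\<in>UNIV. lam j * real (m j) + (if j = i then lam i else 0))"
    unfolding eigval_def by (intro sum.cong) (auto simp: algebra_simps)
  then show ?thesis by (simp add: sum.distrib eigval_def)
qed

lemma eigval_lower:
  assumes "m i \<noteq> 0"
  shows "eigval lam (m(i := m i - 1)) = eigval lam m - lam i"
  using eigval_raise[of lam "m(i := m i - 1)" i] assms by simp

lemma create_annihilate: "create i (annihilate i f) m = of_real (real (m i)) * f m"
  by (simp add: create_def annihilate_def flip: of_real_mult mult.assoc)

lemma inner_of_real_mult_left: "inner (of_real r * z) (w::complex) = r * inner z w"
  by (metis inner_scaleR_left scaleR_conv_of_real)

lemma inner_of_real_mult_right: "inner z (of_real r * w::complex) = r * inner z w"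
  by (metis inner_scaleR_right scaleR_conv_of_real)

lemmas inner_of_real_mult = inner_of_real_mult_left inner_of_real_mult_right

lemma annihilate_mult:
  "annihilate i (\<lambda>m. of_real (v m) * f m) n = of_real (v (n(i := n i + 1))) * annihilate i f n"
  by (simp add: annihilate_def)

text \<open>The relation a_i h(A) = h(A + \<lambda>_i) a_i, from which all commutators with
  functions of \<open>A\<close> are computed.\<close>

lemma annihilate_eigval:
  "annihilate i (\<lambda>m. of_real (h (eigval lam m)) * f m) =
    (\<lambda>n. of_real (h (eigval lam n + lam i)) * annihilate i f n)"
  by (rule ext) (simp add: annihilate_mult[where v = "\<lambda>m. h (eigval lam m)"] eigval_raise)

lemma wsum_nonneg: "(\<And>m. m \<in> S \<Longrightarrow> 0 \<le> v m) \<Longrightarrow> 0 \<le> wsum S v f"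
  unfolding wsum_def by (intro sum_nonneg) auto

lemma wsum_mono: "(\<And>m. m \<in> S \<Longrightarrow> v m \<le> w m) \<Longrightarrow> wsum S v f \<le> wsum S w f"
  unfolding wsum_def by (intro sum_mono mult_right_mono) auto

lemma wsum_cmult: "wsum S (\<lambda>m. r * v m) f = r * wsum S v f"
  by (simp add: wsum_def sum_distrib_left mult_ac)

lemma wsum_add: "wsum S (\<lambda>m. v m + w m) f = wsum S v f + wsum S w f"
  by (simp add: wsum_def sum.distrib algebra_simps)

lemma wsum_sum: "wsum S (\<lambda>m. \<Sum>i\<in>I. v i m) f = (\<Sum>i\<in>I. wsum S (v i) f)"
  unfolding wsum_def sum_distrib_right by (rule sum.swap)

lemma wsum_cutoff_le:
  assumes "\<And>m. m \<in> S \<Longrightarrow> 0 \<le> v m" "\<And>m. m \<in> S \<Longrightarrow> g m = f m \<or> g m = 0"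
  shows "wsum S v g \<le> wsum S v f"
  unfolding wsum_def using assms by (intro sum_mono mult_left_mono power_mono) fastforce+

text \<open>Cauchy-Schwarz followed by Young's inequality, termwise. The parameter stays free
  because each application weights its two arguments differently.\<close>

lemma ip_le:
  assumes "0 < (\<mu>::real)"
  shows "\<bar>ip S f g\<bar> \<le> (\<mu> * wsum S (\<lambda>_. 1) f + wsum S (\<lambda>_. 1) g / \<mu>) / 2"
proof -
  have "\<bar>ip S f g\<bar> \<le> (\<Sum>m\<in>S. \<bar>inner (f m) (g m)\<bar>)"
    unfolding ip_def by (rule sum_abs)
  also have "\<dots> \<le> (\<Sum>m\<in>S. (\<mu> * (1 * (cmod (f m))\<^sup>2) + (1 * (cmod (g m))\<^sup>2) / \<mu>) / 2)"
  proof (rule sum_mono)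
    fix m
    have "\<bar>inner (f m) (g m)\<bar> \<le> cmod (f m) * cmod (g m)"
      by (rule Cauchy_Schwarz_ineq2)
    also have "\<dots> \<le> (\<mu> * (cmod (f m))\<^sup>2 + (cmod (g m))\<^sup>2 / \<mu>) / 2"
    proof -
      have "0 \<le> (\<mu> * cmod (f m) - cmod (g m))\<^sup>2" by simp
      then show ?thesis using assms by (simp add: field_simps power2_eq_square)
    qed
    finally show "\<bar>inner (f m) (g m)\<bar> \<le> (\<mu> * (1 * (cmod (f m))\<^sup>2) + (1 * (cmod (g m))\<^sup>2) / \<mu>) / 2"
      by simp
  qed
  also have "\<dots> = (\<mu> * wsum S (\<lambda>_. 1) f + wsum S (\<lambda>_. 1) g / \<mu>) / 2"
    by (simp add: wsum_def sum.distrib sum_distrib_left sum_divide_distrib add_divide_distrib)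
  finally show ?thesis .
qed

text \<open>The spectrum enters the explicit constants only through the lower bound
  \<open>l1\<close>, later instantiated with the eigenvalue of the least mode.\<close>

locale spectrum =
  fixes lam :: "'n::finite \<Rightarrow> real" and l1 :: real
  assumes l1_pos: "0 < l1" and l1_le: "\<And>i. l1 \<le> lam i"
begin

abbreviation ev :: "('n \<Rightarrow> nat) \<Rightarrow> real" where "ev \<equiv> eigval lam"
abbreviation L :: "real \<Rightarrow> ('n \<Rightarrow> nat) set" where "L \<equiv> lev lam"

lemma lam_pos: "0 < lam i" using l1_pos l1_le[of i] by linarith

lemma ev_nonneg [simp]: "0 \<le> ev m" using eigval_nonneg[of lam m] lam_pos by blast

lemma ev_zero [simp]: "ev (\<lambda>_. 0) = 0" by (simp add: eigval_def)

lemma lam_mult_le_ev: "lam i * real (m i) \<le> ev m"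
  unfolding eigval_def
  by (rule member_le_sum) (auto intro: mult_nonneg_nonneg less_imp_le[OF lam_pos])

lemma l1_mult_le_ev: "l1 * real (m i) \<le> ev m"
  by (rule order_trans[OF mult_right_mono[OF l1_le] lam_mult_le_ev]) simp

lemma ev_ge: assumes "m \<noteq> (\<lambda>_. 0)" shows "l1 \<le> ev m"
proof -
  obtain i where "m i \<noteq> 0" using assms by auto
  then have "l1 * 1 \<le> l1 * real (m i)" using l1_pos by (intro mult_left_mono) auto
  then show ?thesis using l1_mult_le_ev[of m i] by simp
qed

text \<open>Off the vacuum the eigenvalue is at least \<open>l1\<close>, and on the vacuum both
  sides vanish; so first and second moments compare without any condition on the vacuum
  coefficient.\<close>

lemma l1_mult_ev_le: "l1 * ev m \<le> (ev m)\<^sup>2"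
proof (cases "m = (\<lambda>_. 0)")
  case False
  then show ?thesis using ev_ge[OF False] by (simp add: power2_eq_square mult_right_mono)
qed simp

lemma finite_L [simp]: "finite (L k)"
proof -
  have "L k \<subseteq> insert (\<lambda>_. 0) (cutoff_set lam k)" by (auto simp: lev_def cutoff_set_def)
  then show ?thesis using finite_cutoff_set[of lam k] lam_pos finite_subset by blast
qed

lemma supp_annihilate:
  assumes "supp_in (L k) f" shows "supp_in (L k) (annihilate i f)"
  using assms lam_pos[of i] by (auto simp: supp_in_def annihilate_def lev_def eigval_raise)

lemma supp_mult: "supp_in (L k) f \<Longrightarrow> supp_in (L k) (\<lambda>m. of_real (v m) * f m)"
  by (simp add: supp_in_def)

text \<open>Adjointness survives truncation: where the raised index leaves \<open>L k\<close>, the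
  coefficient of \<open>f\<close> is zero, so no boundary term appears. The second argument is
  arbitrary.\<close>

lemma ip_create:
  assumes "supp_in (L k) f"
  shows "ip (L k) f (create j g) = ip (L k) (annihilate j f) g"
proof -
  let ?T = "{m \<in> L k. m j \<noteq> 0}" and ?U = "{n. n(j := n j + 1) \<in> L k}"
  have sub: "?U \<subseteq> L k" using lam_pos[of j] by (auto simp: lev_def eigval_raise)
  have "ip (L k) f (create j g) = (\<Sum>m\<in>?T. inner (f m) (create j g m))"
    unfolding ip_def by (rule sum.mono_neutral_right) (auto simp: create_def)
  also have "\<dots> = (\<Sum>n\<in>?U. inner (f (n(j := n j + 1))) (create j g (n(j := n j + 1))))"
    by (rule sum.reindex_bij_witness[where i = "\<lambda>n. n(j := n j + 1)" and j = "\<lambda>m. m(j := m j - 1)"])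
      auto
  also have "\<dots> = (\<Sum>n\<in>?U. inner (annihilate j f n) (g n))"
    by (intro sum.cong) (simp_all add: create_def annihilate_def inner_of_real_mult add.commute
        del: of_real_add)
  also have "\<dots> = ip (L k) (annihilate j f) g"
    unfolding ip_def using sub assms
    by (intro sum.mono_neutral_left) (auto simp: annihilate_def supp_in_def)
  finally show ?thesis .
qed

text \<open>The weight on the left is evaluated at the raised index, the one from which
  \<open>annihilate\<close> reads its coefficient; after adjunction it becomes the unshifted weight
  times the number operator.\<close>

lemma wsum_annihilate:
  assumes "supp_in (L k) f"
  shows "wsum (L k) (\<lambda>n. v (n(i := n i + 1))) (annihilate i f) = wsum (L k) (\<lambda>m. v m * real (m i)) f"
proof -
  have "wsum (L k) (\<lambda>n. v (n(i := n i + 1))) (annihilate i f) =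
      ip (L k) (annihilate i (\<lambda>m. of_real (v m) * f m)) (annihilate i f)"
    by (simp add: wsum_def ip_def annihilate_mult inner_of_real_mult power2_norm_eq_inner)
  also have "\<dots> = ip (L k) (\<lambda>m. of_real (v m) * f m) (create i (annihilate i f))"
    using ip_create[OF supp_mult[OF assms]] by simp
  also have "\<dots> = wsum (L k) (\<lambda>m. v m * real (m i)) f"
    unfolding wsum_def ip_def create_annihilate inner_of_real_mult power2_norm_eq_inner
    by (simp add: mult_ac)
  finally show ?thesis .
qed

lemma wsum_annihilate1:
  assumes "supp_in (L k) f"
  shows "wsum (L k) (\<lambda>_. 1) (annihilate i f) = wsum (L k) (\<lambda>m. real (m i)) f"
  using wsum_annihilate[OF assms, of "\<lambda>_. 1"] by simp

text \<open>The exact weight is \<open>m j * m k'\<close> for different modes and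
  \<open>m j * (m j - 1)\<close> for equal ones; the bound drops the correction.\<close>

lemma wsum_annihilate2:
  assumes "supp_in (L k) f"
  shows "wsum (L k) (\<lambda>_. 1) (annihilate k' (annihilate j f))
    \<le> wsum (L k) (\<lambda>m. real (m j) * real (m k')) f"
proof -
  have "wsum (L k) (\<lambda>_. 1) (annihilate k' (annihilate j f)) =
      wsum (L k) (\<lambda>n. real (n k')) (annihilate j f)"
    by (rule wsum_annihilate1[OF supp_annihilate[OF assms]])
  also have "\<dots> \<le> wsum (L k) (\<lambda>n. real ((n(j := n j + 1)) k')) (annihilate j f)"
    by (intro wsum_mono) auto
  also have "\<dots> = wsum (L k) (\<lambda>m. real (m j) * real (m k')) f"
    using wsum_annihilate[OF assms, of "\<lambda>m. real (m k')" j] by (simp add: mult.commute)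
  finally show ?thesis .
qed

lemma wsum_create_annihilate:
  assumes "supp_in (L k) f"
  shows "wsum (L k) (\<lambda>_. 1) (create k' (annihilate i f))
    \<le> wsum (L k) (\<lambda>m. real (m i) * real (m k')) f + wsum (L k) (\<lambda>m. real (m i)) f"
proof -
  define g where "g = annihilate i f"
  \<comment> \<open>Creation can leave the level set, so its result is truncated before it serves as
    a supported argument; on \<open>L k\<close> itself nothing is lost.\<close>
  define h where "h = (\<lambda>m. if m \<in> L k then create k' g m else 0)"
  have "wsum (L k) (\<lambda>_. 1) (create k' g) = ip (L k) h (create k' g)"
    by (simp add: wsum_def ip_def h_def power2_norm_eq_inner)
  also have "\<dots> = ip (L k) (annihilate k' h) g"
    by (rule ip_create) (simp add: supp_in_def h_def)
  \<comment> \<open>Annihilating what was created multiplies by the occupation number plus one; only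
    an inequality results, because \<open>h\<close> may vanish at the raised index.\<close>
  also have "\<dots> \<le> wsum (L k) (\<lambda>n. real (n k') + 1) g"
    unfolding ip_def wsum_def
  proof (rule sum_mono)
    fix n
    have "create k' g (n(k' := n k' + 1)) = of_real (sqrt (real (n k') + 1)) * g n"
      by (simp add: create_def add.commute)
    then show "inner (annihilate k' h n) (g n) \<le> (real (n k') + 1) * (cmod (g n))\<^sup>2"
      by (simp add: annihilate_def h_def inner_of_real_mult power2_norm_eq_inner
          flip: mult.assoc of_real_mult)
  qed
  also have "\<dots> \<le> wsum (L k) (\<lambda>n. real ((n(i := n i + 1)) k') + 1) g"
    by (intro wsum_mono) auto
  also have "\<dots> = wsum (L k) (\<lambda>m. (real (m k') + 1) * real (m i)) f"
    unfolding g_def using wsum_annihilate[OF assms, of "\<lambda>m. real (m k') + 1" i] by simp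
  also have "\<dots> = wsum (L k) (\<lambda>m. real (m i) * real (m k')) f + wsum (L k) (\<lambda>m. real (m i)) f"
    by (simp add: algebra_simps flip: wsum_add)
  finally show ?thesis by (simp add: g_def)
qed

lemma sum_wsum_annihilate:
  assumes "supp_in (L k) f"
  shows "(\<Sum>i\<in>UNIV. lam i * wsum (L k) (\<lambda>_. 1) (annihilate i f)) = wsum (L k) ev f"
proof -
  have "(\<Sum>i\<in>UNIV. lam i * wsum (L k) (\<lambda>_. 1) (annihilate i f)) =
      wsum (L k) (\<lambda>m. \<Sum>i\<in>UNIV. lam i * real (m i)) f"
    by (simp add: wsum_annihilate1[OF assms] wsum_sum wsum_cmult)
  then show ?thesis by (simp add: eigval_def[abs_def])
qed

lemma sum_wsum_pair:
  "(\<Sum>j\<in>UNIV. \<Sum>k'\<in>UNIV. lam j * lam k' * wsum (L k) (\<lambda>m. real (m j) * real (m k')) f)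
    = wsum (L k) (\<lambda>m. (ev m)\<^sup>2) f"
proof -
  have "(ev m)\<^sup>2 = (\<Sum>j\<in>UNIV. \<Sum>k'\<in>UNIV. (lam j * lam k') * (real (m j) * real (m k')))" for m
    unfolding eigval_def power2_eq_square sum_product by (intro sum.cong) (auto simp: mult_ac)
  then show ?thesis by (simp add: wsum_sum wsum_cmult)
qed

end

lemma ip_commute: "ip S f g = ip S g f"
  by (simp add: ip_def inner_commute)

lemma ip_add_right: "ip S f (\<lambda>m. g m + h m) = ip S f g + ip S f h"
  by (simp add: ip_def inner_add_right sum.distrib)

lemma ip_diff_right: "ip S f (\<lambda>m. g m - h m) = ip S f g - ip S f h"
  by (simp add: ip_def inner_diff_right sum_subtractf)

lemma ip_add_left: "ip S (\<lambda>m. g m + h m) f = ip S g f + ip S h f"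
  by (simp add: ip_def inner_add_left sum.distrib)

lemma ip_scale_right: "ip S f (\<lambda>m. of_real r * g m) = r * ip S f g"
  by (simp add: ip_def inner_of_real_mult sum_distrib_left)

lemma ip_sum_right: "ip S f (\<lambda>m. \<Sum>i\<in>I. g i m) = (\<Sum>i\<in>I. ip S f (g i))"
  unfolding ip_def inner_sum_right by (rule sum.swap)

lemmas ip_linear = ip_add_right ip_diff_right ip_scale_right ip_sum_right

lemma ip_self: "ip S f f = wsum S (\<lambda>_. 1) f"
  by (simp add: ip_def wsum_def power2_norm_eq_inner)

section \<open>Sparse sums\<close>

lemma sum_if_card_le:
  assumes "finite A" "card {i \<in> A. P i} \<le> s" "0 \<le> (x::real)"
  shows "(\<Sum>i\<in>A. if P i then x else 0) \<le> real s * x"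
proof -
  have "(\<Sum>i\<in>A. if P i then x else 0) = real (card {i \<in> A. P i}) * x"
    using assms(1) by (simp flip: sum.inter_filter)
  also have "\<dots> \<le> real s * x" using assms(2,3) by (intro mult_right_mono) auto
  finally show ?thesis .
qed

text \<open>Each \<open>x i\<close> is charged once per nonzero of its row, hence at most
  \<open>s\<close> times. This is what keeps the number of modes out of the constants.\<close>

lemma sum_outer_sparse:
  fixes P :: "'a::finite \<Rightarrow> 'b::finite \<Rightarrow> bool"
  assumes "\<And>i. card {j. P i j} \<le> s" "\<And>i. 0 \<le> (x i::real)"
  shows "(\<Sum>i\<in>UNIV. \<Sum>j\<in>UNIV. if P i j then x i else 0) \<le> real s * (\<Sum>i\<in>UNIV. x i)"
  unfolding sum_distrib_left using assms by (intro sum_mono sum_if_card_le) auto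

lemma sum_inner_sparse:
  fixes P :: "'a::finite \<Rightarrow> 'b::finite \<Rightarrow> bool"
  assumes "\<And>j. card {i. P i j} \<le> s" "\<And>j. 0 \<le> (y j::real)"
  shows "(\<Sum>i\<in>UNIV. \<Sum>j\<in>UNIV. if P i j then y j else 0) \<le> real s * (\<Sum>j\<in>UNIV. y j)"
  by (subst sum.swap) (rule sum_outer_sparse[OF assms])

lemma sum_pair_UNIV:
  fixes f :: "'a::finite \<Rightarrow> 'b::finite \<Rightarrow> real"
  shows "(\<Sum>p\<in>UNIV. f (fst p) (snd p)) = (\<Sum>j\<in>UNIV. \<Sum>k\<in>UNIV. f j k)"
  by (simp add: sum.cartesian_product case_prod_beta UNIV_Times_UNIV)

lemma card_slice_le:
  fixes P :: "'a::finite \<Rightarrow> 'b::finite \<Rightarrow> bool"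
  assumes "card {(i, k). P i k} \<le> s"
  shows "card {i. P i k} \<le> s"
proof -
  have "card {i. P i k} = card ((\<lambda>i. (i, k)) ` {i. P i k})"
    by (rule card_image[symmetric]) (auto intro: inj_onI)
  also have "\<dots> \<le> card {(i, k). P i k}" by (intro card_mono) auto
  finally show ?thesis using assms by simp
qed

text \<open>Formulated for a predicate rather than for \<open>c\<close>, so that supports of
  coefficients with permuted indices qualify as well.\<close>

definition sparse3 :: "nat \<Rightarrow> ('n::finite \<Rightarrow> 'n \<Rightarrow> 'n \<Rightarrow> bool) \<Rightarrow> bool" where
  "sparse3 s P \<longleftrightarrow> (\<forall>i. card {(j, k). P i j k} \<le> s) \<and> (\<forall>j. card {(i, k). P i j k} \<le> s) \<and>
     (\<forall>k. card {(i, j). P i j k} \<le> s)"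

lemma card_Collect_swap: "card {(i, j). P i j} = card {(j, i). P i j}"
proof -
  have "card {(j, i). P i j} = card (prod.swap ` {(i, j). P i j})"
    by (rule arg_cong[of _ _ card]) (auto simp: image_def)
  then show ?thesis by (simp add: card_image)
qed

lemma sparse3_rotate: "sparse3 s P \<Longrightarrow> sparse3 s (\<lambda>i j k. P j k i)"
  unfolding sparse3_def using card_Collect_swap by metis

lemma sparse3_sum1:
  assumes "sparse3 s P" "\<And>i. 0 \<le> (x i::real)"
  shows "(\<Sum>i\<in>UNIV. \<Sum>j\<in>UNIV. \<Sum>k\<in>UNIV. if P i j k then x i else 0) \<le> real s * (\<Sum>i\<in>UNIV. x i)"
proof -
  have "card {p. P i (fst p) (snd p)} \<le> s" for i
    using assms(1) by (simp add: sparse3_def split_def)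
  then have "(\<Sum>i\<in>UNIV. \<Sum>p\<in>UNIV. if P i (fst p) (snd p) then x i else 0) \<le> real s * (\<Sum>i\<in>UNIV. x i)"
    by (intro sum_outer_sparse assms(2))
  then show ?thesis by (simp add: sum_pair_UNIV[of "\<lambda>j k. if P _ j k then x _ else 0"])
qed

text \<open>The number of \<open>i\<close> admissible for a pair \<open>(j, k)\<close> is bounded by
  the two-dimensional slice that fixes \<open>j\<close> alone.\<close>

lemma sparse3_sum23:
  assumes "sparse3 s P" "\<And>j k. 0 \<le> (y j k::real)"
  shows "(\<Sum>i\<in>UNIV. \<Sum>j\<in>UNIV. \<Sum>k\<in>UNIV. if P i j k then y j k else 0)
    \<le> real s * (\<Sum>j\<in>UNIV. \<Sum>k\<in>UNIV. y j k)"
proof -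
  have "card {i. P i (fst p) (snd p)} \<le> s" for p
    using assms(1) card_slice_le[of "\<lambda>i k. P i (fst p) k"] by (simp add: sparse3_def)
  then have "(\<Sum>i\<in>UNIV. \<Sum>p\<in>UNIV. if P i (fst p) (snd p) then y (fst p) (snd p) else 0)
      \<le> real s * (\<Sum>p\<in>UNIV. y (fst p) (snd p))"
    by (intro sum_inner_sparse assms(2))
  then show ?thesis
    by (simp add: sum_pair_UNIV[of "\<lambda>j k. if P _ j k then y j k else 0"] sum_pair_UNIV)
qed

section \<open>Coefficients of the flow\<close>

locale flow_coeffs = spectrum lam l1 for lam :: "'n::finite \<Rightarrow> real" and l1 +
  fixes q J :: real and s :: nat and b :: "'n \<Rightarrow> 'n \<Rightarrow> real" and c :: "'n \<Rightarrow> 'n \<Rightarrow> 'n \<Rightarrow> real"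
  assumes q_pos: "0 < q"
    and b_le: "\<And>i j. \<bar>b i j\<bar> \<le> J" and c_le: "\<And>i j k. \<bar>c i j k\<bar> \<le> J"
    and sparse: "sparse_coeffs s b c" and div_free: "divergence_free lam b c"
begin

definition \<beta> :: "'n \<Rightarrow> 'n \<Rightarrow> real" where
  "\<beta> i j = b i j * sqrt (lam i / lam j)"

definition \<theta> :: "'n \<Rightarrow> 'n \<Rightarrow> 'n \<Rightarrow> real" where
  "\<theta> i j k = lam i * c i j k / sqrt (lam i * lam j * lam k)"

definition M :: "(('n \<Rightarrow> nat) \<Rightarrow> complex) \<Rightarrow> ('n \<Rightarrow> nat) \<Rightarrow> complex" where
  "M f m = B_op lam b f m + C_op q lam c f m"

lemma J_nonneg: "0 \<le> J"
  using b_le[of undefined undefined] by linarith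

lemma b_antisym: "lam i * b i j + lam j * b j i = 0"
  using div_free by (cases "i = j") (auto simp: divergence_free_def)

text \<open>When indices coincide every summand is zero, so the relation holds for all triples and
  sums need no exclusion of diagonals. It is the input of the energy estimate.\<close>

lemma c_cyclic: "lam i * c i j k + lam j * c j k i + lam k * c k i j = 0"
  using div_free by (cases "i = j"; cases "j = k"; cases "i = k") (auto simp: divergence_free_def)

text \<open>Over a denominator symmetric in \<open>i\<close> and \<open>j\<close>, the divergence
  relation for \<open>b\<close> becomes plain antisymmetry.\<close>

lemma \<beta>_alt: "\<beta> i j = lam i * b i j / sqrt (lam i * lam j)"
proof -
  have "sqrt (lam i) \<noteq> 0" "sqrt (lam j) \<noteq> 0" "lam i = (sqrt (lam i))\<^sup>2"
    using lam_pos[of i] lam_pos[of j] by auto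
  then show ?thesis
    unfolding \<beta>_def real_sqrt_divide real_sqrt_mult by (simp add: field_simps power2_eq_square)
qed

lemma \<beta>_antisym: "\<beta> j i = - \<beta> i j"
  using b_antisym[of i j] unfolding \<beta>_alt by (simp add: mult.commute add_divide_distrib[symmetric]
      eq_neg_iff_add_eq_0 add.commute)

lemma sparse_b: "card {j. b i j \<noteq> 0} \<le> s" "card {i. b i j \<noteq> 0} \<le> s"
  using sparse by (auto simp: sparse_coeffs_def)

lemma sparse_c: "sparse3 s (\<lambda>i j k. c i j k \<noteq> 0)"
  using sparse by (auto simp: sparse_coeffs_def sparse3_def)

text \<open>The outermost operators of \<open>M\<close> are creations; they are all moved onto
  \<open>f\<close>, so only \<open>f\<close> has to be supported in the level set.\<close>

lemma ip_M:
  assumes "supp_in (L k) f"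
  shows "ip (L k) f (M g) =
    (\<Sum>i\<in>UNIV. \<Sum>j\<in>UNIV. \<beta> i j * ip (L k) (annihilate j f) (annihilate i g)) +
    sqrt (q / 2) * (\<Sum>i\<in>UNIV. \<Sum>j\<in>UNIV. \<Sum>l\<in>UNIV. \<theta> i j l *
      (ip (L k) (annihilate l (annihilate j f)) (annihilate i g) -
       ip (L k) (annihilate i f) (annihilate l (annihilate j g))))"
  unfolding M_def[abs_def] B_op_def C_op_def
  by (simp only: ip_linear ip_create[OF assms] ip_create[OF supp_annihilate[OF assms]] \<beta>_def \<theta>_def)

text \<open>The quadratic part inherits antisymmetry from \<beta>. In the cubic part every summand
  is an operator minus its adjoint, with a real coefficient.\<close>

lemma ip_M_antisym:
  assumes "supp_in (L k) f" "supp_in (L k) g"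
  shows "ip (L k) g (M f) = - ip (L k) f (M g)"
proof -
  have "(\<Sum>i\<in>UNIV. \<Sum>j\<in>UNIV. \<beta> i j * ip (L k) (annihilate j g) (annihilate i f)) =
      (\<Sum>i\<in>UNIV. \<Sum>j\<in>UNIV. \<beta> j i * ip (L k) (annihilate i g) (annihilate j f))"
    by (rule sum.swap)
  also have "\<dots> = - (\<Sum>i\<in>UNIV. \<Sum>j\<in>UNIV. \<beta> i j * ip (L k) (annihilate j f) (annihilate i g))"
    by (subst \<beta>_antisym) (simp add: sum_negf ip_commute)
  moreover have "\<theta> i j l * (ip (L k) (annihilate l (annihilate j g)) (annihilate i f) -
       ip (L k) (annihilate i g) (annihilate l (annihilate j f))) =
     - (\<theta> i j l * (ip (L k) (annihilate l (annihilate j f)) (annihilate i g) -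
       ip (L k) (annihilate i f) (annihilate l (annihilate j g))))" for i j l
    by (simp add: algebra_simps ip_commute)
  ultimately show ?thesis
    unfolding ip_M[OF assms(1)] ip_M[OF assms(2)] by (simp add: sum_negf)
qed

lemma ip_M_self: "supp_in (L k) f \<Longrightarrow> ip (L k) f (M f) = 0"
  using ip_M_antisym[of k f f] by simp

definition hw :: "(real \<Rightarrow> real) \<Rightarrow> (('n \<Rightarrow> nat) \<Rightarrow> complex) \<Rightarrow> ('n \<Rightarrow> nat) \<Rightarrow> complex" where
  "hw h f = (\<lambda>m. of_real (h (ev m)) * f m)"

text \<open>Annihilation operators shift the argument of \<open>h\<close>, so only differences of its values survive.\<close>

lemma ip_hw_M:
  assumes "supp_in (L k) f"
  shows "ip (L k) (hw h f) (M f) =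
    (\<Sum>i\<in>UNIV. \<Sum>j\<in>UNIV. \<beta> i j *
      (\<Sum>n\<in>L k. (h (ev n + lam j) - h (ev n)) * inner (annihilate j f n) (annihilate i f n))) +
    sqrt (q / 2) * (\<Sum>i\<in>UNIV. \<Sum>j\<in>UNIV. \<Sum>l\<in>UNIV. \<theta> i j l *
      (\<Sum>n\<in>L k. (h (ev n + lam j + lam l) - h (ev n + lam i)) *
         inner (annihilate l (annihilate j f) n) (annihilate i f n)))"
proof -
  have 1: "annihilate i (hw h f) = (\<lambda>n. of_real (h (ev n + lam i)) * annihilate i f n)" for i
    unfolding hw_def by (rule annihilate_eigval)
  have 2: "annihilate l (annihilate j (hw h f)) =
      (\<lambda>n. of_real (h (ev n + lam j + lam l)) * annihilate l (annihilate j f) n)" for j l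
    unfolding 1 using annihilate_eigval[of l "\<lambda>x. h (x + lam j)"] by (simp add: add_ac)
  let ?X = "\<lambda>i j. \<Sum>n\<in>L k. h (ev n) * inner (annihilate j f n) (annihilate i f n)"
  \<comment> \<open>The quadratic terms contain a single value of \<open>h\<close>, not a
    difference. The same sum weighted with \<open>h (ev n)\<close> vanishes, as \<beta> is
    antisymmetric and the inner product symmetric, and may be subtracted.\<close>
  have "(\<Sum>i\<in>UNIV. \<Sum>j\<in>UNIV. \<beta> i j * ?X i j) = (\<Sum>i\<in>UNIV. \<Sum>j\<in>UNIV. \<beta> j i * ?X j i)"
    by (rule sum.swap)
  also have "\<dots> = - (\<Sum>i\<in>UNIV. \<Sum>j\<in>UNIV. \<beta> i j * ?X i j)"
    by (subst \<beta>_antisym) (simp add: sum_negf inner_commute)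
  finally have 0: "(\<Sum>i\<in>UNIV. \<Sum>j\<in>UNIV. \<beta> i j * ?X i j) = 0" by simp
  have B: "(\<Sum>i\<in>UNIV. \<Sum>j\<in>UNIV. \<beta> i j * ip (L k) (annihilate j (hw h f)) (annihilate i f)) =
     (\<Sum>i\<in>UNIV. \<Sum>j\<in>UNIV. \<beta> i j *
      (\<Sum>n\<in>L k. (h (ev n + lam j) - h (ev n)) * inner (annihilate j f n) (annihilate i f n)))"
    (is "?l = ?r")
  proof -
    have "?r = ?l - (\<Sum>i\<in>UNIV. \<Sum>j\<in>UNIV. \<beta> i j * ?X i j)"
      unfolding ip_def 1 inner_of_real_mult by (simp add: sum_subtractf algebra_simps)
    then show ?thesis using 0 by simp
  qed
  have C: "ip (L k) (annihilate l (annihilate j (hw h f))) (annihilate i f) -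
       ip (L k) (annihilate i (hw h f)) (annihilate l (annihilate j f)) =
      (\<Sum>n\<in>L k. (h (ev n + lam j + lam l) - h (ev n + lam i)) *
         inner (annihilate l (annihilate j f) n) (annihilate i f n))" for i j l
    unfolding 2 unfolding 1 ip_def inner_of_real_mult
    by (simp add: sum_subtractf algebra_simps inner_commute)
  have "supp_in (L k) (hw h f)" unfolding hw_def by (rule supp_mult[OF assms])
  from ip_M[OF this, of f] show ?thesis unfolding B C .
qed

end

section \<open>Energy estimates\<close>

text \<open>Young's inequality with parameter \<open>\<mu> * sqrt x / sqrt y\<close>, so that the
  roots on the left reappear as full weights on the right.\<close>

lemma ip_le_scaled:
  assumes "0 < (\<mu>::real)" "0 < x" "0 < y"
  shows "sqrt x * sqrt y * \<bar>ip S f g\<bar> \<le> (\<mu> * (x * wsum S (\<lambda>_. 1) f) + y * wsum S (\<lambda>_. 1) g / \<mu>) / 2"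
proof -
  define u v where "u = sqrt x" and "v = sqrt y"
  have uv: "0 < u" "0 < v" and xy: "x = u\<^sup>2" "y = v\<^sup>2" using assms by (auto simp: u_def v_def)
  have "\<bar>ip S f g\<bar> \<le> ((\<mu> * u / v) * wsum S (\<lambda>_. 1) f + wsum S (\<lambda>_. 1) g / (\<mu> * u / v)) / 2"
    using assms uv by (intro ip_le) simp
  then have "u * v * \<bar>ip S f g\<bar> \<le> u * v * (((\<mu> * u / v) * wsum S (\<lambda>_. 1) f + wsum S (\<lambda>_. 1) g / (\<mu> * u / v)) / 2)"
    using uv by (intro mult_left_mono) auto
  also have "\<dots> = (\<mu> * (u\<^sup>2 * wsum S (\<lambda>_. 1) f) + v\<^sup>2 * wsum S (\<lambda>_. 1) g / \<mu>) / 2"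
    using uv assms by (simp add: field_simps power2_eq_square)
  finally show ?thesis unfolding xy using uv by (simp add: real_sqrt_abs)
qed

lemma abs_sum2_le:
  fixes F :: "'a \<Rightarrow> 'b \<Rightarrow> real"
  assumes "\<And>i j. \<bar>F i j\<bar> \<le> G i j"
  shows "\<bar>\<Sum>i\<in>A. \<Sum>j\<in>B. F i j\<bar> \<le> (\<Sum>i\<in>A. \<Sum>j\<in>B. G i j)"
  by (intro order_trans[OF sum_abs] sum_mono assms)

lemma abs_sum3_le:
  fixes F :: "'a \<Rightarrow> 'b \<Rightarrow> 'c \<Rightarrow> real"
  assumes "\<And>i j k. \<bar>F i j k\<bar> \<le> G i j k"
  shows "\<bar>\<Sum>i\<in>A. \<Sum>j\<in>B. \<Sum>k\<in>C. F i j k\<bar> \<le> (\<Sum>i\<in>A. \<Sum>j\<in>B. \<Sum>k\<in>C. G i j k)"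
  by (intro order_trans[OF sum_abs] sum_mono abs_sum2_le assms)

lemma sparse3_swap12: "sparse3 s P \<Longrightarrow> sparse3 s (\<lambda>i j k. P j i k)"
  using card_Collect_swap[of "\<lambda>i j. P j i k" for k] by (simp add: sparse3_def)

lemma sparse3_sum2:
  assumes "sparse3 s P" "\<And>j. 0 \<le> (x j::real)"
  shows "(\<Sum>i\<in>UNIV. \<Sum>j\<in>UNIV. \<Sum>k\<in>UNIV. if P i j k then x j else 0) \<le> real s * (\<Sum>j\<in>UNIV. x j)"
proof -
  have "(\<Sum>i\<in>UNIV. \<Sum>j\<in>UNIV. \<Sum>k\<in>UNIV. if P i j k then x j else 0) =
      (\<Sum>j\<in>UNIV. \<Sum>i\<in>UNIV. \<Sum>k\<in>UNIV. if P i j k then x j else 0)"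
    by (rule sum.swap)
  also have "\<dots> \<le> real s * (\<Sum>j\<in>UNIV. x j)"
    by (rule sparse3_sum1[of s "\<lambda>j i k. P i j k" x, OF sparse3_swap12[of s P, OF assms(1)] assms(2)])
  finally show ?thesis .
qed

lemma sparse3_sum13:
  assumes "sparse3 s P" "\<And>i k. 0 \<le> (y i k::real)"
  shows "(\<Sum>i\<in>UNIV. \<Sum>j\<in>UNIV. \<Sum>k\<in>UNIV. if P i j k then y i k else 0)
    \<le> real s * (\<Sum>i\<in>UNIV. \<Sum>k\<in>UNIV. y i k)"
proof -
  have "(\<Sum>i\<in>UNIV. \<Sum>j\<in>UNIV. \<Sum>k\<in>UNIV. if P i j k then y i k else 0) =
      (\<Sum>j\<in>UNIV. \<Sum>i\<in>UNIV. \<Sum>k\<in>UNIV. if P i j k then y i k else 0)"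
    by (rule sum.swap)
  also have "\<dots> \<le> real s * (\<Sum>i\<in>UNIV. \<Sum>k\<in>UNIV. y i k)"
    by (rule sparse3_sum23[of s "\<lambda>j i k. P i j k" y, OF sparse3_swap12[of s P, OF assms(1)] assms(2)])
  finally show ?thesis .
qed

context flow_coeffs
begin

definition A1 :: "real \<Rightarrow> (('n \<Rightarrow> nat) \<Rightarrow> complex) \<Rightarrow> real" where
  "A1 k f = wsum (L k) ev f"

definition A2 :: "real \<Rightarrow> (('n \<Rightarrow> nat) \<Rightarrow> complex) \<Rightarrow> real" where
  "A2 k f = wsum (L k) (\<lambda>m. (ev m)\<^sup>2) f"

lemma A1_nonneg: "0 \<le> A1 k f" and A2_nonneg: "0 \<le> A2 k f"
  unfolding A1_def A2_def by (intro wsum_nonneg; simp)+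

lemma l1_A1_le: "l1 * A1 k f \<le> A2 k f"
  unfolding A1_def A2_def wsum_cmult[symmetric] by (intro wsum_mono l1_mult_ev_le)

text \<open>Coefficients of size \<open>sqrt (lam j) * sqrt (lam i)\<close> are what turns one
  annihilation on each side into a share of the expectation of \<open>A\<close>. Column sparsity
  sums the \<open>f\<close> part, row sparsity the \<open>g\<close> part.\<close>

lemma quadratic_bound:
  assumes "\<And>i j. \<bar>G i j\<bar> \<le> (if b i j \<noteq> 0 then R * (sqrt (lam j) * sqrt (lam i)) else 0)"
    and "0 \<le> R" "0 < \<mu>" and f: "supp_in (L k) f" and g: "supp_in (L k) g"
  shows "\<bar>\<Sum>i\<in>UNIV. \<Sum>j\<in>UNIV. G i j * ip (L k) (annihilate j f) (annihilate i g)\<bar>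
    \<le> R * real s / 2 * (\<mu> * A1 k f + A1 k g / \<mu>)"
proof -
  let ?x = "\<lambda>j. R / 2 * \<mu> * (lam j * wsum (L k) (\<lambda>_. 1) (annihilate j f))"
  let ?y = "\<lambda>i. R / 2 / \<mu> * (lam i * wsum (L k) (\<lambda>_. 1) (annihilate i g))"
  have nn: "0 \<le> ?x j" "0 \<le> ?y i" for i j
    using assms(2,3) less_imp_le[OF lam_pos]
    by (auto intro!: mult_nonneg_nonneg divide_nonneg_nonneg wsum_nonneg)
  have "\<bar>G i j * ip (L k) (annihilate j f) (annihilate i g)\<bar>
     \<le> (if b i j \<noteq> 0 then ?x j else 0) + (if b i j \<noteq> 0 then ?y i else 0)" for i j
  proof (cases "b i j \<noteq> 0")
    case True
    have "\<bar>G i j * ip (L k) (annihilate j f) (annihilate i g)\<bar> \<le>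
        R * (sqrt (lam j) * sqrt (lam i) * \<bar>ip (L k) (annihilate j f) (annihilate i g)\<bar>)"
      using assms(1)[of i j] True by (simp add: abs_mult mult_right_mono flip: mult.assoc)
    also have "\<dots> \<le> R * ((\<mu> * (lam j * wsum (L k) (\<lambda>_. 1) (annihilate j f)) +
        lam i * wsum (L k) (\<lambda>_. 1) (annihilate i g) / \<mu>) / 2)"
      using assms(2,3) lam_pos by (intro mult_left_mono ip_le_scaled) auto
    also have "\<dots> = ?x j + ?y i" by (simp add: field_simps)
    finally show ?thesis using True by simp
  next
    case False
    then show ?thesis using assms(1)[of i j] by simp
  qed
  then have "\<bar>\<Sum>i\<in>UNIV. \<Sum>j\<in>UNIV. G i j * ip (L k) (annihilate j f) (annihilate i g)\<bar> \<le>
    (\<Sum>i\<in>UNIV. \<Sum>j\<in>UNIV. (if b i j \<noteq> 0 then ?x j else 0) + (if b i j \<noteq> 0 then ?y i else 0))"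
    by (rule abs_sum2_le)
  also have "\<dots> \<le> real s * (\<Sum>j\<in>UNIV. ?x j) + real s * (\<Sum>i\<in>UNIV. ?y i)"
    unfolding sum.distrib using sparse_b nn
    by (intro add_mono sum_inner_sparse sum_outer_sparse) auto
  also have "\<dots> = R * real s / 2 * (\<mu> * A1 k f + A1 k g / \<mu>)"
    unfolding sum_distrib_left[symmetric] sum_wsum_annihilate[OF f] sum_wsum_annihilate[OF g]
    by (simp add: A1_def field_simps)
  finally show ?thesis .
qed

text \<open>Two annihilations stand against one: the root of \<open>lam j * lam l\<close> goes with
  \<open>f\<close> and produces its second moment, the root of \<open>lam i\<close> goes with
  \<open>g\<close> and produces its first. The pattern \<open>P\<close> is general because the
  energy estimate uses permuted coefficients.\<close>

lemma cubic_bound: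
  assumes G: "\<And>i j l. \<bar>G i j l\<bar> \<le> (if P i j l then R * sqrt (lam i * lam j * lam l) else 0)"
    and P: "sparse3 s P"
    and "0 \<le> R" "0 < \<mu>" and f: "supp_in (L k) f" and g: "supp_in (L k) g"
  shows "\<bar>\<Sum>i\<in>UNIV. \<Sum>j\<in>UNIV. \<Sum>l\<in>UNIV. G i j l * ip (L k) (annihilate l (annihilate j f)) (annihilate i g)\<bar>
    \<le> R * real s / 2 * (A2 k f / \<mu> + \<mu> * A1 k g)"
proof -
  let ?x = "\<lambda>j l. R / 2 / \<mu> * (lam j * lam l * wsum (L k) (\<lambda>m. real (m j) * real (m l)) f)"
  let ?y = "\<lambda>i. R / 2 * \<mu> * (lam i * wsum (L k) (\<lambda>_. 1) (annihilate i g))"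
  have nn: "0 \<le> ?x j l" "0 \<le> ?y i" for i j l
    using assms(3,4) less_imp_le[OF lam_pos]
    by (auto intro!: mult_nonneg_nonneg divide_nonneg_nonneg wsum_nonneg)
  have "\<bar>G i j l * ip (L k) (annihilate l (annihilate j f)) (annihilate i g)\<bar>
     \<le> (if P i j l then ?x j l else 0) + (if P i j l then ?y i else 0)" for i j l
  proof (cases "P i j l")
    case True
    let ?I = "\<bar>ip (L k) (annihilate l (annihilate j f)) (annihilate i g)\<bar>"
    have "\<bar>G i j l * ip (L k) (annihilate l (annihilate j f)) (annihilate i g)\<bar> \<le>
        R * sqrt (lam i * lam j * lam l) * ?I"
      using G[of i j l] True by (simp add: abs_mult mult_right_mono)
    also have "\<dots> = R * (sqrt (lam j * lam l) * sqrt (lam i) * ?I)"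
      by (simp add: real_sqrt_mult mult_ac)
    also have "\<dots> \<le> R * ((1 / \<mu> * (lam j * lam l * wsum (L k) (\<lambda>_. 1) (annihilate l (annihilate j f))) +
        lam i * wsum (L k) (\<lambda>_. 1) (annihilate i g) / (1 / \<mu>)) / 2)"
      using assms(3,4) lam_pos by (intro mult_left_mono ip_le_scaled) auto
    also have "\<dots> = R / 2 / \<mu> * (lam j * lam l * wsum (L k) (\<lambda>_. 1) (annihilate l (annihilate j f))) + ?y i"
      by (simp add: field_simps)
    also have "\<dots> \<le> ?x j l + ?y i"
      using assms(3,4) less_imp_le[OF lam_pos]
      by (intro add_mono mult_left_mono wsum_annihilate2[OF f]) auto
    finally show ?thesis using True by simp
  next
    case False
    then show ?thesis using G[of i j l] by simp
  qed
  then have "\<bar>\<Sum>i\<in>UNIV. \<Sum>j\<in>UNIV. \<Sum>l\<in>UNIV. G i j l * ip (L k) (annihilate l (annihilate j f)) (annihilate i g)\<bar> \<le>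
    (\<Sum>i\<in>UNIV. \<Sum>j\<in>UNIV. \<Sum>l\<in>UNIV. (if P i j l then ?x j l else 0) + (if P i j l then ?y i else 0))"
    by (rule abs_sum3_le)
  also have "\<dots> \<le> real s * (\<Sum>j\<in>UNIV. \<Sum>l\<in>UNIV. ?x j l) + real s * (\<Sum>i\<in>UNIV. ?y i)"
    unfolding sum.distrib by (intro add_mono sparse3_sum23 sparse3_sum1 P nn)
  also have "\<dots> = R * real s / 2 * (A2 k f / \<mu> + \<mu> * A1 k g)"
    unfolding sum_distrib_left[symmetric] sum_wsum_pair sum_wsum_annihilate[OF g]
    by (simp add: A1_def A2_def field_simps)
  finally show ?thesis .
qed

text \<open>The double annihilation sits on \<open>f\<close>, yet only the first moment of
  \<open>f\<close> may appear, since a tail is small in its first moment relative to the second. One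
  annihilation is therefore moved back onto \<open>g\<close> as a creation, and \<open>g\<close>
  pays with its second moment.\<close>

lemma cubic_bound_create:
  assumes "0 < \<mu>" and f: "supp_in (L k) f" and g: "supp_in (L k) g"
  shows "\<bar>\<Sum>i\<in>UNIV. \<Sum>j\<in>UNIV. \<Sum>l\<in>UNIV. \<theta> i j l * ip (L k) (annihilate l (annihilate j f)) (annihilate i g)\<bar>
    \<le> J * real s / (2 * l1\<^sup>2) * (\<mu> * A1 k f + 2 * A2 k g / \<mu>)"
proof -
  let ?K = "J / (2 * l1\<^sup>2)"
  let ?w = "\<lambda>i l. wsum (L k) (\<lambda>m. real (m i) * real (m l)) g"
  let ?x = "\<lambda>j. ?K * \<mu> * (lam j * wsum (L k) (\<lambda>_. 1) (annihilate j f))"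
  let ?y = "\<lambda>i l. ?K / \<mu> * (lam i * lam l * ?w i l)"
  let ?z = "\<lambda>i. ?K / \<mu> * l1 * (lam i * wsum (L k) (\<lambda>_. 1) (annihilate i g))"
  have w0: "0 \<le> ?w i l" for i l by (intro wsum_nonneg) auto
  have nn: "0 \<le> ?x j" "0 \<le> ?y i l" "0 \<le> ?z i" for i j l
    using assms(1) J_nonneg less_imp_le[OF lam_pos] w0 l1_pos
    by (auto intro!: mult_nonneg_nonneg divide_nonneg_nonneg wsum_nonneg)
  have "\<bar>\<theta> i j l * ip (L k) (annihilate l (annihilate j f)) (annihilate i g)\<bar>
     \<le> (if c i j l \<noteq> 0 then ?x j else 0) + (if c i j l \<noteq> 0 then ?y i l else 0) +
       (if c i j l \<noteq> 0 then ?z i else 0)" for i j l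
  proof (cases "c i j l = 0")
    case False
    let ?I = "\<bar>ip (L k) (annihilate j f) (create l (annihilate i g))\<bar>"
    let ?Y = "wsum (L k) (\<lambda>_. 1) (create l (annihilate i g))"
    let ?Yi = "wsum (L k) (\<lambda>m. real (m i)) g"
    have Yi: "?Yi = wsum (L k) (\<lambda>_. 1) (annihilate i g)" using wsum_annihilate1[OF g] by simp
    have Yi0: "0 \<le> ?Yi" by (intro wsum_nonneg) auto
    have th: "\<bar>\<theta> i j l\<bar> \<le> J / l1 * (sqrt (lam j) * sqrt (lam i / lam l))"
    proof -
      have pos: "0 < lam i" "0 < lam j" "0 < lam l" by (rule lam_pos)+
      define u v w where "u = sqrt (lam i)" and "v = sqrt (lam j)" and "w = sqrt (lam l)"
      have uvw: "0 < u" "0 < v" "0 < w" and e: "lam i = u\<^sup>2" "lam j = v\<^sup>2" "lam l = w\<^sup>2"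
        using pos by (auto simp: u_def v_def w_def)
      have "\<theta> i j l = c i j l / lam j * (sqrt (lam j) * sqrt (lam i / lam l))"
        unfolding \<theta>_def real_sqrt_mult real_sqrt_divide unfolding e using uvw
        by (simp add: field_simps power2_eq_square)
      then have "\<bar>\<theta> i j l\<bar> = \<bar>c i j l\<bar> / lam j * (sqrt (lam j) * sqrt (lam i / lam l))"
        using pos by (simp add: abs_mult)
      also have "\<dots> \<le> J / l1 * (sqrt (lam j) * sqrt (lam i / lam l))"
        using pos c_le l1_le l1_pos J_nonneg by (intro mult_right_mono frac_le) auto
      finally show ?thesis .
    qed
    have "\<bar>\<theta> i j l * ip (L k) (annihilate l (annihilate j f)) (annihilate i g)\<bar> = \<bar>\<theta> i j l\<bar> * ?I"
      by (simp add: abs_mult ip_create[OF supp_annihilate[OF f]])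
    also have "\<dots> \<le> J / l1 * (sqrt (lam j) * sqrt (lam i / lam l)) * ?I"
      by (intro mult_right_mono th) simp
    also have "\<dots> = J / l1 * (sqrt (lam j) * sqrt (lam i / lam l) * ?I)"
      by (simp only: mult.assoc)
    \<comment> \<open>The weights \<open>lam j\<close> and \<open>lam i / lam l\<close> match the
      roots in the coefficient; the parameter \<open>\<mu> / l1\<close> makes \<open>?K\<close> the
      common prefactor.\<close>
    also have "\<dots> \<le> J / l1 * ((\<mu> / l1 * (lam j * wsum (L k) (\<lambda>_. 1) (annihilate j f)) +
        lam i / lam l * ?Y / (\<mu> / l1)) / 2)"
      using J_nonneg assms(1) lam_pos l1_pos by (intro mult_left_mono ip_le_scaled) auto
    also have "\<dots> = ?x j + ?K / \<mu> * l1\<^sup>2 * (lam i / lam l * ?Y)"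
      using l1_pos by (simp add: field_simps power2_eq_square)
    also have "\<dots> \<le> ?x j + ?K / \<mu> * (lam i * lam l * ?w i l + l1 * (lam i * ?Yi))"
    proof -
      \<comment> \<open>The quotient \<open>lam i / lam l\<close> is exchanged for the product
        \<open>lam i * lam l\<close> at the price of \<open>l1\<^sup>2\<close>, since only with
        products do the pair expectations sum to the second moment.\<close>
      have a: "l1\<^sup>2 \<le> (lam l)\<^sup>2" using l1_le l1_pos by (intro power_mono) auto
      have "l1\<^sup>2 * (lam i / lam l * ?Y) \<le> l1\<^sup>2 * (lam i / lam l * (?w i l + ?Yi))"
        using lam_pos[of i] lam_pos[of l]
        by (intro mult_left_mono wsum_create_annihilate[OF g]) (auto intro: less_imp_le)
      also have "\<dots> = lam i / lam l * ?w i l * l1\<^sup>2 + l1 / lam l * (l1 * (lam i * ?Yi))"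
        using lam_pos[of l] by (simp add: field_simps power2_eq_square)
      also have "\<dots> \<le> lam i / lam l * ?w i l * (lam l)\<^sup>2 + 1 * (l1 * (lam i * ?Yi))"
        using lam_pos[of i] lam_pos[of l] l1_le[of l] l1_pos w0 Yi0 a
        by (intro add_mono mult_mono) (auto intro!: mult_nonneg_nonneg divide_nonneg_nonneg less_imp_le)
      also have "\<dots> = lam i * lam l * ?w i l + l1 * (lam i * ?Yi)"
        using lam_pos[of l] by (simp add: power2_eq_square)
      finally have "?K / \<mu> * (l1\<^sup>2 * (lam i / lam l * ?Y)) \<le>
          ?K / \<mu> * (lam i * lam l * ?w i l + l1 * (lam i * ?Yi))"
        using J_nonneg assms(1) by (intro mult_left_mono) auto
      then show ?thesis by (simp only: mult.assoc add_left_mono)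
    qed
    also have "\<dots> = ?x j + ?y i l + ?z i"
      unfolding Yi by (simp add: algebra_simps)
    finally show ?thesis using False by simp
  qed (simp add: \<theta>_def)
  then have "\<bar>\<Sum>i\<in>UNIV. \<Sum>j\<in>UNIV. \<Sum>l\<in>UNIV. \<theta> i j l * ip (L k) (annihilate l (annihilate j f)) (annihilate i g)\<bar> \<le>
    (\<Sum>i\<in>UNIV. \<Sum>j\<in>UNIV. \<Sum>l\<in>UNIV. (if c i j l \<noteq> 0 then ?x j else 0) + (if c i j l \<noteq> 0 then ?y i l else 0) +
       (if c i j l \<noteq> 0 then ?z i else 0))"
    by (rule abs_sum3_le)
  also have "\<dots> \<le> real s * (\<Sum>j\<in>UNIV. ?x j) + real s * (\<Sum>i\<in>UNIV. \<Sum>l\<in>UNIV. ?y i l) + real s * (\<Sum>i\<in>UNIV. ?z i)"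
    unfolding sum.distrib
    by (intro add_mono sparse3_sum2[OF sparse_c] sparse3_sum13[OF sparse_c] sparse3_sum1[OF sparse_c] nn)
  also have "\<dots> = ?K * real s * (\<mu> * A1 k f + (A2 k g + l1 * A1 k g) / \<mu>)"
    unfolding sum_distrib_left[symmetric] sum_wsum_pair sum_wsum_annihilate[OF g] sum_wsum_annihilate[OF f]
    using assms(1) l1_pos by (simp add: A1_def A2_def field_simps)
  \<comment> \<open>The first moment of \<open>g\<close> stems from the one in "occupation number
    plus one"; it is absorbed by \<open>A2\<close>, which thereby doubles.\<close>
  also have "\<dots> \<le> ?K * real s * (\<mu> * A1 k f + (2 * A2 k g) / \<mu>)"
    using l1_A1_le[of k g] assms(1) J_nonneg by (intro mult_left_mono add_left_mono divide_right_mono) auto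
  finally show ?thesis by simp
qed


text \<open>Multiplied out, the summands \<open>sqrt l1\<close> and \<open>sqrt q\<close> are the
  contributions of \<open>B\<close> and \<open>C\<close> to \<open>ip_M_bound\<close>, up to
  numerical factors.\<close>

definition \<gamma> :: real where
  "\<gamma> = 2 * sqrt q * real s * J / l1\<^sup>2 * (1 + sqrt l1 / sqrt q)"

text \<open>The first summand pays for \<open>B\<close>, the one with \<open>q\<close> for
  \<open>C\<close>; both arise when half of \<open>A2\<close> is spent on each of them.\<close>

definition \<kappa> :: real where
  "\<kappa> = 2 * J\<^sup>2 * (real s)\<^sup>2 / l1 * (1 + 16 * q / l1)"

lemma \<kappa>_nonneg: "0 \<le> \<kappa>"
  using q_pos l1_pos by (simp add: \<kappa>_def)

lemma \<gamma>_alt: "\<gamma> = 2 * real s * J / l1\<^sup>2 * (sqrt l1 + sqrt q)"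
proof -
  have "sqrt q * (1 + sqrt l1 / sqrt q) = sqrt l1 + sqrt q"
    using q_pos by (simp add: field_simps)
  then have "2 * real s * J / l1\<^sup>2 * (sqrt q * (1 + sqrt l1 / sqrt q)) =
      2 * real s * J / l1\<^sup>2 * (sqrt l1 + sqrt q)"
    by (rule arg_cong)
  then show ?thesis by (simp add: \<gamma>_def mult_ac)
qed

lemma \<gamma>_nonneg: "0 \<le> \<gamma>"
  unfolding \<gamma>_alt using q_pos l1_pos J_nonneg by (intro mult_nonneg_nonneg divide_nonneg_nonneg) auto

text \<open>The cyclic relation turns the a priori \<open>\<lambda>\<^sub>i\<^sup>2\<close> term into products of distinct eigenvalues,
  so that the bound does not involve the largest eigenvalue.\<close>

lemma \<theta>_energy:
  "\<theta> i j l * (lam j + lam l - lam i) =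
    lam i * lam j * c i j l / sqrt (lam i * lam j * lam l) + lam i * lam l * c i j l / sqrt (lam i * lam j * lam l)
    + lam i * lam j * c j l i / sqrt (lam i * lam j * lam l) + lam i * lam l * c l i j / sqrt (lam i * lam j * lam l)"
proof -
  have "lam i * (lam i * c i j l + lam j * c j l i + lam l * c l i j) = 0"
    using c_cyclic by simp
  then have "lam i * c i j l * (lam j + lam l - lam i) =
    lam i * lam j * c i j l + lam i * lam l * c i j l + lam i * lam j * c j l i + lam i * lam l * c l i j"
    by (simp add: algebra_simps)
  then show ?thesis
    unfolding \<theta>_def add_divide_distrib[symmetric] by simp
qed

text \<open>Two eigenvalues over the root equal the root divided by the third eigenvalue, which is
  at least \<open>l1\<close>. The square of one eigenvalue would leave an uncontrolled ratio
  instead.\<close>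

lemma energy_coeff_le:
  assumes "\<bar>r\<bar> \<le> J"
  shows "\<bar>lam i * lam j * r / sqrt (lam i * lam j * lam l)\<bar> \<le>
    (if r \<noteq> 0 then J / l1 * sqrt (lam i * lam j * lam l) else 0)"
proof -
  have pos: "0 < lam i" "0 < lam j" "0 < lam l" by (rule lam_pos)+
  let ?D = "sqrt (lam i * lam j * lam l)"
  have D: "0 < ?D" "?D * ?D = lam i * lam j * lam l" using pos by auto
  have "lam i * lam j * r / ?D = r / lam l * ?D"
    using D pos by (simp add: field_simps)
  then have "\<bar>lam i * lam j * r / ?D\<bar> = \<bar>r\<bar> / lam l * ?D"
    using D pos by (simp add: abs_mult)
  also have "\<dots> \<le> J / l1 * ?D"
    using D pos assms l1_le l1_pos J_nonneg by (intro mult_right_mono frac_le) auto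
  finally show ?thesis by auto
qed

text \<open>Damping will contribute \<open>- 2 * A2\<close> to the derivative of the first moment.
  The budget here is one \<open>A2\<close>, half for \<open>B\<close> and half for \<open>C\<close>;
  the rest is charged to \<open>A1\<close>, which the decay of the norm pays for.\<close>

lemma ip_energy:
  assumes f: "supp_in (L k) f"
  shows "2 * ip (L k) (hw (\<lambda>x. x) f) (M f) \<le> A2 k f + 2 * \<kappa> * A1 k f"
proof -
  let ?D = "\<lambda>i j l. sqrt (lam i * lam j * lam l)"
  let ?T = "\<lambda>i j l. ip (L k) (annihilate l (annihilate j f)) (annihilate i f)"
  let ?SB = "\<Sum>i\<in>UNIV. \<Sum>j\<in>UNIV. (\<beta> i j * lam j) * ip (L k) (annihilate j f) (annihilate i f)"
  define S where "S G = (\<Sum>i\<in>UNIV. \<Sum>j\<in>UNIV. \<Sum>l\<in>UNIV. G i j l * ?T i j l)" for G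
  have SC: "(\<Sum>i\<in>UNIV. \<Sum>j\<in>UNIV. \<Sum>l\<in>UNIV. (\<theta> i j l * (lam j + lam l - lam i)) * ?T i j l) =
      S (\<lambda>i j l. lam i * lam j * c i j l / ?D i j l) + S (\<lambda>i j l. lam i * lam l * c i j l / ?D i j l) +
      S (\<lambda>i j l. lam i * lam j * c j l i / ?D i j l) + S (\<lambda>i j l. lam i * lam l * c l i j / ?D i j l)"
    (is "_ = ?S1 + ?S2 + ?S3 + ?S4")
    unfolding S_def \<theta>_energy distrib_right sum.distrib ..
  have sum_eq: "ip (L k) (hw (\<lambda>x. x) f) (M f) = ?SB + sqrt (q / 2) * (?S1 + ?S2 + ?S3 + ?S4)"
  proof -
    have 1: "(\<Sum>n\<in>L k. (ev n + lam j - ev n) * inner (annihilate j f n) (annihilate i f n)) =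
        lam j * ip (L k) (annihilate j f) (annihilate i f)" for i j
      by (simp add: ip_def sum_distrib_left)
    have 2: "(\<Sum>n\<in>L k. (ev n + lam j + lam l - (ev n + lam i)) *
          inner (annihilate l (annihilate j f) n) (annihilate i f n)) =
        (lam j + lam l - lam i) * ?T i j l" for i j l
      unfolding ip_def sum_distrib_left by (intro sum.cong) auto
    show ?thesis
      unfolding ip_hw_M[OF f] SC[symmetric] 1 2 by (simp only: mult.assoc)
  qed
  have B: "?SB \<le> J * real s * A1 k f"
  proof -
    have "\<bar>?SB\<bar> \<le> J * real s / 2 * (1 * A1 k f + A1 k f / 1)"
    proof (rule quadratic_bound[OF _ J_nonneg _ f f])
      fix i j
      have "\<beta> i j * lam j = b i j * (sqrt (lam j) * sqrt (lam i))"
      proof -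
        have "sqrt (lam i / lam j) * lam j = sqrt (lam i) * (lam j / sqrt (lam j))"
          by (simp add: real_sqrt_divide)
        also have "\<dots> = sqrt (lam i) * sqrt (lam j)"
          using lam_pos[of j] by (simp add: real_div_sqrt less_imp_le)
        finally show ?thesis by (simp add: \<beta>_def mult_ac)
      qed
      then show "\<bar>\<beta> i j * lam j\<bar> \<le> (if b i j \<noteq> 0 then J * (sqrt (lam j) * sqrt (lam i)) else 0)"
        using b_le[of i j] lam_pos[of i] lam_pos[of j] by (simp add: abs_mult mult_right_mono)
    qed simp
    then show ?thesis by simp
  qed
  \<comment> \<open>The cyclic relation produced coefficients with rotated indices, whose supports
    inherit sparsity. The second and fourth sums have \<open>l\<close> in place of \<open>j\<close>,
    whence the exchange under the root.\<close>
  have sp: "sparse3 s (\<lambda>i j l. c j l i \<noteq> 0)" by (rule sparse3_rotate[OF sparse_c])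
  have sp': "sparse3 s (\<lambda>i j l. c l i j \<noteq> 0)" by (rule sparse3_rotate[OF sp])
  have swap: "?D i j l = ?D i l j" for i j l by (simp add: mult_ac)
  have R: "0 \<le> J / l1" using J_nonneg l1_pos by simp
  note S_le = cubic_bound[OF _ _ R _ f f, folded S_def]
  have C: "?S1 + ?S2 + ?S3 + ?S4 \<le> 4 * (J / l1 * real s / 2 * (A2 k f / \<mu> + \<mu> * A1 k f))" if "0 < \<mu>" for \<mu>
  proof -
    have "\<bar>?S1\<bar> \<le> J / l1 * real s / 2 * (A2 k f / \<mu> + \<mu> * A1 k f)"
      by (rule S_le[OF _ sparse_c that]) (rule energy_coeff_le[OF c_le])
    moreover have "\<bar>?S2\<bar> \<le> J / l1 * real s / 2 * (A2 k f / \<mu> + \<mu> * A1 k f)"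
      by (rule S_le[OF _ sparse_c that]) (subst (1 2) swap, rule energy_coeff_le[OF c_le])
    moreover have "\<bar>?S3\<bar> \<le> J / l1 * real s / 2 * (A2 k f / \<mu> + \<mu> * A1 k f)"
      by (rule S_le[OF _ sp that]) (rule energy_coeff_le[OF c_le])
    moreover have "\<bar>?S4\<bar> \<le> J / l1 * real s / 2 * (A2 k f / \<mu> + \<mu> * A1 k f)"
      by (rule S_le[OF _ sp' that]) (subst (1 2) swap, rule energy_coeff_le[OF c_le])
    ultimately have "?S1 + ?S2 + ?S3 + ?S4 \<le> Y + Y + Y + Y"
      if "Y = J / l1 * real s / 2 * (A2 k f / \<mu> + \<mu> * A1 k f)" for Y
      unfolding that[symmetric] by linarith
    from this[OF refl] show ?thesis by simp
  qed
  define Z where "Z = 4 * sqrt (q / 2) * J * real s / l1"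
  have Z0: "0 \<le> Z" using J_nonneg l1_pos q_pos by (simp add: Z_def)
  have C': "2 * (sqrt (q / 2) * (?S1 + ?S2 + ?S3 + ?S4)) \<le> Z * (A2 k f / \<mu> + \<mu> * A1 k f)" if "0 < \<mu>" for \<mu>
  proof -
    have "2 * (sqrt (q / 2) * (?S1 + ?S2 + ?S3 + ?S4)) \<le>
        2 * (sqrt (q / 2) * (4 * (J / l1 * real s / 2 * (A2 k f / \<mu> + \<mu> * A1 k f))))"
      using q_pos by (intro mult_left_mono C[OF that]) auto
    then show ?thesis by (simp add: Z_def)
  qed
  \<comment> \<open>The parameter \<open>2 * Z\<close> spends exactly half of \<open>A2\<close>; if
    \<open>Z\<close> vanishes, any parameter will do.\<close>
  have C'': "2 * (sqrt (q / 2) * (?S1 + ?S2 + ?S3 + ?S4)) \<le> A2 k f / 2 + 2 * Z\<^sup>2 * A1 k f"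
  proof (cases "Z = 0")
    case True
    then show ?thesis using C'[of 1] A2_nonneg[of k f] by simp
  next
    case False
    then have "0 < Z" using Z0 by simp
    then have "Z * (A2 k f / (2 * Z) + 2 * Z * A1 k f) = A2 k f / 2 + 2 * Z\<^sup>2 * A1 k f"
      by (simp add: field_simps power2_eq_square)
    with C'[of "2 * Z"] \<open>0 < Z\<close> show ?thesis by simp
  qed
  \<comment> \<open>Completing the square leaves a constant, which off the vacuum is charged to
    \<open>ev m / l1\<close>; on the vacuum both sides vanish.\<close>
  have "2 * J * real s * ev m \<le> (ev m)\<^sup>2 / 2 + 2 * J\<^sup>2 * (real s)\<^sup>2 / l1 * ev m" for m
  proof (cases "m = (\<lambda>_. 0)")
    case False
    have "0 \<le> (ev m - 2 * J * real s)\<^sup>2" by simp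
    then have "2 * J * real s * ev m \<le> (ev m)\<^sup>2 / 2 + 2 * J\<^sup>2 * (real s)\<^sup>2 * 1"
      by (simp add: power2_eq_square algebra_simps)
    also have "\<dots> \<le> (ev m)\<^sup>2 / 2 + 2 * J\<^sup>2 * (real s)\<^sup>2 * (ev m / l1)"
      using ev_ge[OF False] l1_pos by (intro add_left_mono mult_left_mono) auto
    finally show ?thesis by simp
  qed simp
  then have "wsum (L k) (\<lambda>m. 2 * J * real s * ev m) f \<le>
      wsum (L k) (\<lambda>m. 1 / 2 * (ev m)\<^sup>2 + 2 * J\<^sup>2 * (real s)\<^sup>2 / l1 * ev m) f"
    by (intro wsum_mono) simp
  then have D: "2 * J * real s * A1 k f \<le> A2 k f / 2 + 2 * J\<^sup>2 * (real s)\<^sup>2 / l1 * A1 k f"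
    unfolding wsum_add wsum_cmult A1_def A2_def by simp
  have Z2: "Z\<^sup>2 = 8 * q * J\<^sup>2 * (real s)\<^sup>2 / l1\<^sup>2"
    using q_pos by (simp add: Z_def power_mult_distrib power_divide)
  have "2 * J\<^sup>2 * (real s)\<^sup>2 / l1 + 2 * Z\<^sup>2 \<le> 2 * \<kappa>"
    unfolding Z2 \<kappa>_def using q_pos l1_pos J_nonneg by (simp add: field_simps power2_eq_square)
  then have "(2 * J\<^sup>2 * (real s)\<^sup>2 / l1 + 2 * Z\<^sup>2) * A1 k f \<le> 2 * \<kappa> * A1 k f"
    by (intro mult_right_mono A1_nonneg)
  then have "2 * J\<^sup>2 * (real s)\<^sup>2 / l1 * A1 k f + 2 * Z\<^sup>2 * A1 k f \<le> 2 * \<kappa> * A1 k f"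
    by (simp add: algebra_simps)
  then show ?thesis using B C'' D unfolding sum_eq by (simp add: algebra_simps)
qed

text \<open>Deliberately asymmetric: the argument that will be a tail enters through its first
  moment only. In \<open>?S2\<close> the double annihilation already acts on \<open>g\<close>; in
  \<open>?S1\<close> it acts on \<open>f\<close> and \<open>cubic_bound_create\<close> rearranges
  it.\<close>

lemma ip_M_bound:
  assumes "0 < \<mu>" and f: "supp_in (L k) f" and g: "supp_in (L k) g"
  shows "\<bar>ip (L k) f (M g)\<bar> \<le> 3 / 4 * \<gamma> * (\<mu> * A1 k f + A2 k g / \<mu>)"
proof -
  define K where "K = J * real s / (2 * l1\<^sup>2)"
  have K0: "0 \<le> K" using J_nonneg by (simp add: K_def)
  define a a2 where "a = \<mu> * A1 k f" and "a2 = A2 k g / \<mu>"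
  have nn: "0 \<le> a" "0 \<le> a2" using assms(1) A1_nonneg A2_nonneg by (auto simp: a_def a2_def)
  let ?SB = "\<Sum>i\<in>UNIV. \<Sum>j\<in>UNIV. \<beta> i j * ip (L k) (annihilate j f) (annihilate i g)"
  let ?S1 = "\<Sum>i\<in>UNIV. \<Sum>j\<in>UNIV. \<Sum>l\<in>UNIV. \<theta> i j l * ip (L k) (annihilate l (annihilate j f)) (annihilate i g)"
  let ?S2 = "\<Sum>i\<in>UNIV. \<Sum>j\<in>UNIV. \<Sum>l\<in>UNIV. \<theta> i j l * ip (L k) (annihilate l (annihilate j g)) (annihilate i f)"
  have split: "ip (L k) f (M g) = ?SB + sqrt (q / 2) * (?S1 - ?S2)"
    unfolding ip_M[OF f] by (simp add: right_diff_distrib sum_subtractf ip_commute)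
  have B: "\<bar>?SB\<bar> \<le> K * sqrt l1 * (a + a2)"
  proof -
    define w where "w = sqrt l1"
    have w: "0 < w" "l1 = w\<^sup>2" using l1_pos by (auto simp: w_def)
    \<comment> \<open>Dividing the parameter by \<open>sqrt l1\<close> leaves the common factor
      \<open>K * sqrt l1\<close> once \<open>l1 * A1\<close> of the second argument is traded for
      \<open>A2\<close>.\<close>
    have "\<bar>?SB\<bar> \<le> J / l1 * real s / 2 * (\<mu> / w * A1 k f + A1 k g / (\<mu> / w))"
    proof (rule quadratic_bound[OF _ _ _ f g])
      show "0 \<le> J / l1" "0 < \<mu> / w" using J_nonneg l1_pos w assms(1) by auto
      fix i j
      have "sqrt (lam i / lam j) = sqrt (lam i) * (sqrt (lam j) / lam j)"
        using lam_pos[of j] by (simp add: real_sqrt_divide field_simps)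
      then have "\<beta> i j = b i j / lam j * (sqrt (lam j) * sqrt (lam i))"
        by (simp add: \<beta>_def)
      then have "\<bar>\<beta> i j\<bar> = \<bar>b i j\<bar> / lam j * (sqrt (lam j) * sqrt (lam i))"
        using lam_pos[of i] lam_pos[of j] by (simp add: abs_mult)
      also have "\<dots> \<le> J / l1 * (sqrt (lam j) * sqrt (lam i))"
        using lam_pos[of i] lam_pos[of j] b_le l1_le l1_pos J_nonneg
        by (intro mult_right_mono frac_le) auto
      finally show "\<bar>\<beta> i j\<bar> \<le> (if b i j \<noteq> 0 then J / l1 * (sqrt (lam j) * sqrt (lam i)) else 0)"
        by (auto simp: \<beta>_def)
    qed
    also have "\<dots> = K * w * (a + l1 * A1 k g / \<mu>)"
      using w assms(1) unfolding K_def a_def w(2)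
      by (simp add: field_simps power2_eq_square)
    also have "\<dots> \<le> K * w * (a + a2)"
      unfolding a2_def using K0 w assms(1) l1_A1_le[of k g]
      by (intro mult_left_mono add_left_mono divide_right_mono) auto
    finally show ?thesis by (simp add: w_def)
  qed
  have S1: "\<bar>?S1\<bar> \<le> K * (a + 2 * a2)"
    using cubic_bound_create[OF assms(1) f g] by (simp add: K_def a_def a2_def)
  have S2: "\<bar>?S2\<bar> \<le> K * (a2 + a)"
  proof -
    have "\<bar>?S2\<bar> \<le> J / l1\<^sup>2 * real s / 2 * (A2 k g / \<mu> + \<mu> * A1 k f)"
    proof (rule cubic_bound[OF _ sparse_c _ assms(1) g f])
      show "0 \<le> J / l1\<^sup>2" using J_nonneg by simp
      fix i j l
      have pos: "0 < lam i" "0 < lam j" "0 < lam l" by (rule lam_pos)+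
      let ?D = "sqrt (lam i * lam j * lam l)"
      have D: "0 < ?D" "?D * ?D = lam i * lam j * lam l" using pos by auto
      have "\<theta> i j l = c i j l / (lam j * lam l) * ?D"
        unfolding \<theta>_def using D pos by (simp add: field_simps)
      then have "\<bar>\<theta> i j l\<bar> = \<bar>c i j l\<bar> / (lam j * lam l) * ?D"
        using D pos by (simp add: abs_mult)
      also have "\<dots> \<le> J / l1\<^sup>2 * ?D"
        using D pos c_le l1_le l1_pos J_nonneg unfolding power2_eq_square
        by (intro mult_right_mono frac_le mult_mono) auto
      finally show "\<bar>\<theta> i j l\<bar> \<le> (if c i j l \<noteq> 0 then J / l1\<^sup>2 * ?D else 0)"
        by (auto simp: \<theta>_def)
    qed
    then show ?thesis by (simp add: K_def a_def a2_def mult_ac)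
  qed
  have "\<bar>?S1 - ?S2\<bar> \<le> K * (a + 2 * a2) + K * (a2 + a)"
    using abs_triangle_ineq4[of ?S1 ?S2] S1 S2 by linarith
  also have "\<dots> = K * (2 * a + 3 * a2)" by (simp add: algebra_simps)
  also have "\<dots> \<le> K * (3 * (a + a2))" using K0 nn by (intro mult_left_mono) auto
  finally have S12: "\<bar>?S1 - ?S2\<bar> \<le> K * (3 * (a + a2))" .
  have "\<bar>ip (L k) f (M g)\<bar> \<le> \<bar>?SB\<bar> + sqrt (q / 2) * \<bar>?S1 - ?S2\<bar>"
    unfolding split using q_pos by (intro order_trans[OF abs_triangle_ineq]) (simp add: abs_mult)
  also have "\<dots> \<le> K * sqrt l1 * (a + a2) + sqrt q * (K * (3 * (a + a2)))"
    using q_pos by (intro add_mono mult_mono B S12) auto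
  \<comment> \<open>The quadratic part is enlarged threefold to share the factor of the cubic part.
    As \<gamma> is \<open>4 * K * (sqrt l1 + sqrt q)\<close>, the total factor
    \<open>3 * K * (sqrt l1 + sqrt q)\<close> is three quarters of it.\<close>
  also have "\<dots> \<le> K * (3 * sqrt l1) * (a + a2) + sqrt q * (K * (3 * (a + a2)))"
    using K0 nn l1_pos by (intro add_mono mult_right_mono mult_left_mono) auto
  also have "\<dots> = 3 / 4 * \<gamma> * (a + a2)"
    unfolding \<gamma>_alt K_def by (simp add: algebra_simps add_divide_distrib)
  finally show ?thesis by (simp add: a_def a2_def)
qed

end

section \<open>Truncated dynamics\<close>

lemma wsum_has_derivative:
  assumes "\<And>m. m \<in> S \<Longrightarrow> ((\<lambda>t. f t m) has_vector_derivative f' m) (at t within T)"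
  shows "((\<lambda>t. wsum S v (f t)) has_real_derivative 2 * (\<Sum>m\<in>S. v m * inner (f t m) (f' m))) (at t within T)"
proof -
  have "((\<lambda>t. inner (f t m) (f t m)) has_real_derivative 2 * inner (f t m) (f' m)) (at t within T)"
    if "m \<in> S" for m
  proof -
    have d: "((\<lambda>t. f t m) has_derivative (\<lambda>h. h *\<^sub>R f' m)) (at t within T)"
      using assms[OF that] by (simp add: has_vector_derivative_def)
    have "((\<lambda>t. inner (f t m) (f t m)) has_derivative
        (\<lambda>h. inner (f t m) (h *\<^sub>R f' m) + inner (h *\<^sub>R f' m) (f t m))) (at t within T)"
      by (rule has_derivative_inner[OF d d])
    moreover have "(\<lambda>h. inner (f t m) (h *\<^sub>R f' m) + inner (h *\<^sub>R f' m) (f t m)) =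
        (*) (2 * inner (f t m) (f' m))"
      by (auto simp: fun_eq_iff inner_commute algebra_simps)
    ultimately show ?thesis by (simp add: has_field_derivative_def)
  qed
  then have "((\<lambda>t. \<Sum>m\<in>S. v m * inner (f t m) (f t m)) has_real_derivative
      (\<Sum>m\<in>S. v m * (2 * inner (f t m) (f' m)))) (at t within T)"
    by (intro DERIV_sum DERIV_cmult)
  then show ?thesis
    by (simp add: wsum_def power2_norm_eq_inner sum_distrib_left mult_ac)
qed

lemma gronwall_exp:
  fixes g :: "real \<Rightarrow> real"
  assumes "\<And>t. (g has_real_derivative g' t) (at t)" "\<And>t. g' t \<le> a * g t" "0 \<le> t"
  shows "g t \<le> exp (a * t) * g 0"
proof -
  have "exp (- (a * t)) * g t \<le> exp (- (a * 0)) * g 0"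
  proof (rule DERIV_nonpos_imp_nonincreasing[OF assms(3)])
    fix x
    have "((\<lambda>t. exp (- (a * t)) * g t) has_real_derivative exp (- (a * x)) * (g' x - a * g x)) (at x)"
      by (auto intro!: derivative_eq_intros assms(1) simp: algebra_simps)
    moreover have "exp (- (a * x)) * (g' x - a * g x) \<le> 0"
      using assms(2)[of x] by (simp add: mult_le_0_iff)
    ultimately show "\<exists>y. ((\<lambda>t. exp (- (a * t)) * g t) has_real_derivative y) (at x) \<and> y \<le> 0"
      by blast
  qed
  then have "exp (a * t) * (exp (- (a * t)) * g t) \<le> exp (a * t) * g 0"
    by (intro mult_left_mono) simp_all
  moreover have "exp (a * t) * (exp (- (a * t)) * g t) = g t"
    by (simp add: exp_minus field_simps)
  ultimately show ?thesis by (simp only:)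
qed

lemma power_Suc_diff_le:
  fixes x y z :: real
  assumes "0 \<le> x" "x \<le> z" "0 \<le> y" "y \<le> z"
  shows "\<bar>x ^ Suc p - y ^ Suc p\<bar> \<le> real (Suc p) * z ^ p * \<bar>x - y\<bar>"
proof (induction p)
  case (Suc p)
  have z: "0 \<le> z" using assms by linarith
  have "x ^ Suc (Suc p) - y ^ Suc (Suc p) = x * (x ^ Suc p - y ^ Suc p) + (x - y) * y ^ Suc p"
    by (simp add: algebra_simps)
  also have "\<bar>\<dots>\<bar> \<le> x * \<bar>x ^ Suc p - y ^ Suc p\<bar> + \<bar>x - y\<bar> * y ^ Suc p"
    using assms by (intro order_trans[OF abs_triangle_ineq]) (simp add: abs_mult)
  also have "\<dots> \<le> z * (real (Suc p) * z ^ p * \<bar>x - y\<bar>) + \<bar>x - y\<bar> * z ^ Suc p"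
    using assms z by (intro add_mono mult_mono Suc.IH power_mono mult_nonneg_nonneg) auto
  also have "\<dots> = real (Suc (Suc p)) * z ^ Suc p * \<bar>x - y\<bar>"
    by (simp add: algebra_simps)
  finally show ?case .
qed simp

context flow_coeffs
begin

text \<open>Coefficientwise and for all real times: the regularized solutions extend to negative
  \<open>t\<close>, so two-sided derivatives are available at zero as well.\<close>

definition solves :: "real \<Rightarrow> (real \<Rightarrow> ('n \<Rightarrow> nat) \<Rightarrow> complex) \<Rightarrow> bool" where
  "solves k u \<longleftrightarrow> (\<forall>t. u t (\<lambda>_. 0) = 0) \<and>
     (\<forall>t m. ((\<lambda>t. u t m) has_vector_derivative
        (- of_real (ev m) * u t m + cutoff lam k (M (cutoff lam k (u t))) m)) (at t))"

lemma supp_cutoff: "k \<le> l \<Longrightarrow> supp_in (L l) (cutoff lam k f)"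
  by (auto simp: supp_in_def cutoff_def cutoff_set_def lev_def)

text \<open>\<open>cutoff\<close> also removes the vacuum coefficient, hence the condition that it
  be zero.\<close>

lemma cutoff_eq: "f (\<lambda>_. 0) = 0 \<Longrightarrow> m \<in> L k \<Longrightarrow> cutoff lam k f m = f m"
  by (auto simp: cutoff_def cutoff_set_def lev_def)

lemma wsum_cutoff: "(\<And>m. m \<in> S \<Longrightarrow> 0 \<le> v m) \<Longrightarrow> wsum S v (cutoff lam k f) \<le> wsum S v f"
  by (rule wsum_cutoff_le) (auto simp: cutoff_def)

text \<open>The projection is self-adjoint and commutes with the diagonal h(A), so it moves onto the
  left argument. The observed level \<open>l\<close> is independent of the cutoff \<open>k\<close>
  of the dynamics, which lets two cutoffs be compared on one level set.\<close>

lemma wsum_solves_derivative: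
  assumes u: "solves k u"
  shows "((\<lambda>t. wsum (L l) (\<lambda>m. h (ev m)) (u t)) has_real_derivative
    2 * (ip (L l) (hw h (cutoff lam k (u t))) (M (cutoff lam k (u t))) -
      wsum (L l) (\<lambda>m. h (ev m) * ev m) (u t))) (at t)"
proof -
  have "((\<lambda>t. wsum (L l) (\<lambda>m. h (ev m)) (u t)) has_real_derivative
     2 * (\<Sum>m\<in>L l. h (ev m) * inner (u t m)
       (- of_real (ev m) * u t m + cutoff lam k (M (cutoff lam k (u t))) m))) (at t)"
    by (rule wsum_has_derivative) (use u in \<open>simp add: solves_def\<close>)
  moreover have "h (ev m) * inner (u t m) (- of_real (ev m) * u t m + cutoff lam k (M (cutoff lam k (u t))) m)
     = inner (hw h (cutoff lam k (u t)) m) (M (cutoff lam k (u t)) m) - h (ev m) * ev m * (cmod (u t m))\<^sup>2" for m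
  proof -
    have "inner (u t m) (cutoff lam k g m) = inner (cutoff lam k (u t) m) (g m)" for g
      by (simp add: cutoff_def)
    moreover have "inner (u t m) (- of_real (ev m) * u t m) = - (ev m * (cmod (u t m))\<^sup>2)"
      by (simp add: inner_of_real_mult power2_norm_eq_inner)
    ultimately show ?thesis
      unfolding inner_add_right by (simp add: hw_def inner_of_real_mult algebra_simps)
  qed
  ultimately show ?thesis by (simp add: ip_def wsum_def sum_subtractf)
qed

definition En :: "real \<Rightarrow> (('n \<Rightarrow> nat) \<Rightarrow> complex) \<Rightarrow> real" where
  "En l f = A1 l f + \<kappa> * wsum (L l) (\<lambda>_. 1) f"

lemma En_nonneg: "0 \<le> En l f"
  unfolding En_def using A1_nonneg \<kappa>_nonneg wsum_nonneg[of "L l" "\<lambda>_. 1" f] by simp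

text \<open>By antisymmetry the squared norm changes through damping alone, at rate
  \<open>- 2 * A1\<close>. Multiplied by \<kappa> this cancels the lower-order term of
  \<open>ip_energy\<close>, and one \<open>A2\<close> of the damping survives.\<close>

lemma En_derivative:
  assumes u: "solves k u" and kl: "k \<le> l"
  obtains e where "((\<lambda>t. En l (u t)) has_real_derivative e) (at t)" "e \<le> - A2 l (u t)"
proof -
  let ?f = "cutoff lam k (u t)"
  have f: "supp_in (L l) ?f" by (rule supp_cutoff[OF kl])
  have "((\<lambda>t. wsum (L l) ev (u t)) has_real_derivative
      2 * (ip (L l) (hw (\<lambda>x. x) ?f) (M ?f) - wsum (L l) (\<lambda>m. ev m * ev m) (u t))) (at t)"
    by (rule wsum_solves_derivative[OF u, where h = "\<lambda>x. x"])
  moreover have "((\<lambda>t. wsum (L l) (\<lambda>_. 1) (u t)) has_real_derivative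
      2 * (ip (L l) (hw (\<lambda>x. 1) ?f) (M ?f) - wsum (L l) (\<lambda>m. 1 * ev m) (u t))) (at t)"
    by (rule wsum_solves_derivative[OF u, where h = "\<lambda>x. 1"])
  moreover have "ip (L l) (hw (\<lambda>x. 1) ?f) (M ?f) = 0"
    using ip_M_self[OF f] by (simp add: hw_def)
  ultimately have "((\<lambda>t. En l (u t)) has_real_derivative
      2 * (ip (L l) (hw (\<lambda>x. x) ?f) (M ?f) - A2 l (u t)) + \<kappa> * (- 2 * A1 l (u t))) (at t)"
    unfolding En_def A1_def A2_def power2_eq_square
    by (intro DERIV_add DERIV_cmult) simp_all
  moreover have "2 * (ip (L l) (hw (\<lambda>x. x) ?f) (M ?f) - A2 l (u t)) + \<kappa> * (- 2 * A1 l (u t)) \<le> - A2 l (u t)"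
  proof -
    have "A2 l ?f \<le> A2 l (u t)" "A1 l ?f \<le> A1 l (u t)"
      unfolding A1_def A2_def by (intro wsum_cutoff; simp)+
    then have "2 * ip (L l) (hw (\<lambda>x. x) ?f) (M ?f) \<le> A2 l (u t) + 2 * \<kappa> * A1 l (u t)"
      using ip_energy[OF f] \<kappa>_nonneg mult_left_mono[of "A1 l ?f" "A1 l (u t)" "2 * \<kappa>"] by linarith
    then show ?thesis by simp
  qed
  ultimately show ?thesis by (rule that)
qed

section \<open>Comparison of two cutoffs\<close>

definition tail :: "real \<Rightarrow> (('n \<Rightarrow> nat) \<Rightarrow> complex) \<Rightarrow> ('n \<Rightarrow> nat) \<Rightarrow> complex" where
  "tail k f m = (if ev m \<le> k then 0 else f m)"

text \<open>A Chebyshev estimate: above level \<open>k\<close> one power of the eigenvalue is at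
  most its square over \<open>k\<close>.\<close>

lemma A1_tail_le:
  assumes "0 < k"
  shows "A1 l (tail k f) \<le> A2 l f / k"
proof -
  have "A1 l (tail k f) \<le> (\<Sum>m\<in>L l. (ev m)\<^sup>2 / k * (cmod (f m))\<^sup>2)"
    unfolding A1_def wsum_def
  proof (rule sum_mono)
    fix m
    have "ev m * ev m \<ge> k * ev m" if "ev m > k" using that assms by (intro mult_right_mono) auto
    then have "ev m \<le> (ev m)\<^sup>2 / k" if "ev m > k"
      using that assms by (simp add: field_simps power2_eq_square)
    then have "ev m * (cmod (f m))\<^sup>2 \<le> (ev m)\<^sup>2 / k * (cmod (f m))\<^sup>2" if "ev m > k"
      using that by (intro mult_right_mono) auto
    then show "ev m * (cmod (tail k f m))\<^sup>2 \<le> (ev m)\<^sup>2 / k * (cmod (f m))\<^sup>2"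
      using assms by (auto simp: tail_def)
  qed
  then show ?thesis by (simp add: A2_def wsum_def sum_divide_distrib)
qed

text \<open>Antisymmetry leaves only terms in which one argument lives above the cutoff \<open>k\<close>.\<close>

lemma distance_derivative_bound:
  assumes "0 < k" "k \<le> l" and u0: "u (\<lambda>_. 0) = 0" and v0: "v (\<lambda>_. 0) = 0"
  shows "(\<Sum>m\<in>L l. inner (u m - v m)
      (cutoff lam k (M (cutoff lam k u)) m - cutoff lam l (M (cutoff lam l v)) m))
    \<le> 3 / 2 * \<gamma> / sqrt k * (A2 l u + A2 l v)"
proof -
  let ?U = "cutoff lam l u" and ?V = "cutoff lam l v"
  let ?PU = "cutoff lam k u" and ?PV = "cutoff lam k v"
  let ?QU = "tail k ?U" and ?QV = "tail k ?V"
  note supp = supp_cutoff[OF order_refl, of l u] supp_cutoff[OF order_refl, of l v]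
    supp_cutoff[OF assms(2), of u] supp_cutoff[OF assms(2), of v]
  have sQ: "supp_in (L l) ?QU" "supp_in (L l) ?QV"
    using supp(1,2) by (auto simp: supp_in_def tail_def)
  have Us: "?U = (\<lambda>m. ?PU m + ?QU m)" and Vs: "?V = (\<lambda>m. ?PV m + ?QV m)"
    using assms(2) by (auto simp: fun_eq_iff cutoff_def cutoff_set_def tail_def)
  have "(\<Sum>m\<in>L l. inner (u m - v m)
      (cutoff lam k (M ?PU) m - cutoff lam l (M ?V) m)) =
    (\<Sum>m\<in>L l. (inner (?PU m) (M ?PU m) - inner (?PV m) (M ?PU m))
       - (inner (?U m) (M ?V m) - inner (?V m) (M ?V m)))"
    by (intro sum.cong refl) (simp add: cutoff_def inner_diff_left inner_diff_right)
  also have "\<dots> = ip (L l) ?PU (M ?PU) - ip (L l) ?PV (M ?PU) - (ip (L l) ?U (M ?V) - ip (L l) ?V (M ?V))"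
    by (simp add: ip_def sum_subtractf)
  \<comment> \<open>The diagonal terms vanish. Splitting at level \<open>k\<close> and using
    antisymmetry once more cancels the part where both arguments live below \<open>k\<close>, so
    every surviving term has a tail on the left.\<close>
  also have "\<dots> = - ip (L l) ?PV (M ?PU) - ip (L l) ?U (M ?V)"
    using ip_M_self[OF supp(2)] ip_M_self[OF supp(3)] by simp
  also have "ip (L l) ?U (M ?V) = ip (L l) ?PU (M ?V) + ip (L l) ?QU (M ?V)"
    by (subst (1) Us) (rule ip_add_left)
  also have "ip (L l) ?PU (M ?V) = - ip (L l) ?V (M ?PU)"
    by (rule ip_M_antisym[OF supp(2,3)])
  also have "ip (L l) ?V (M ?PU) = ip (L l) ?PV (M ?PU) + ip (L l) ?QV (M ?PU)"
    by (subst Vs) (rule ip_add_left)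
  finally have eq: "(\<Sum>m\<in>L l. inner (u m - v m)
      (cutoff lam k (M ?PU) m - cutoff lam l (M ?V) m)) = ip (L l) ?QV (M ?PU) - ip (L l) ?QU (M ?V)"
    by simp
  have sk: "0 < sqrt k" "sqrt k * sqrt k = k" using assms(1) by auto
  \<comment> \<open>With parameter \<open>sqrt k\<close>, the tail's first moment, at most
    \<open>A2 / k\<close>, is multiplied by \<open>sqrt k\<close> and the second moment of the other
    argument is divided by it; both contributions scale as \<open>1 / sqrt k\<close>.\<close>
  have bound: "\<bar>ip (L l) (tail k f) (M g)\<bar> \<le> 3 / 4 * \<gamma> / sqrt k * (A2 l f' + A2 l g')"
    if "supp_in (L l) (tail k f)" "supp_in (L l) g" "A2 l f \<le> A2 l f'" "A2 l g \<le> A2 l g'" for f g f' g'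
  proof -
    have "\<bar>ip (L l) (tail k f) (M g)\<bar> \<le> 3 / 4 * \<gamma> * (sqrt k * A1 l (tail k f) + A2 l g / sqrt k)"
      using sk that by (intro ip_M_bound)
    also have "\<dots> \<le> 3 / 4 * \<gamma> * (sqrt k * (A2 l f' / k) + A2 l g' / sqrt k)"
    proof -
      have "A1 l (tail k f) \<le> A2 l f' / k"
        using A1_tail_le[OF assms(1), of l f] that(3) assms(1) by (meson divide_right_mono less_imp_le order_trans)
      then show ?thesis
        using \<gamma>_nonneg sk that by (intro mult_left_mono add_mono divide_right_mono) auto
    qed
    also have "\<dots> = 3 / 4 * \<gamma> / sqrt k * (A2 l f' + A2 l g')"
    proof -
      have "sqrt k * (A2 l f' / k) = A2 l f' / sqrt k"
        using sk by (simp add: field_simps)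
      then show ?thesis
        by (simp only: add_divide_distrib[symmetric] times_divide_eq_left times_divide_eq_right)
    qed
    finally show ?thesis .
  qed
  have le: "A2 l ?U \<le> A2 l u" "A2 l ?V \<le> A2 l v" "A2 l ?PU \<le> A2 l u"
    unfolding A2_def by (intro wsum_cutoff; simp)+
  show ?thesis
    using bound[OF sQ(2) supp(3) le(2,3)] bound[OF sQ(1) supp(2) le(1,2)]
    unfolding eq by (simp add: algebra_simps)
qed

lemma distance_bound:
  assumes u: "solves k u" and v: "solves l v" and "u 0 = v 0" and "0 < k" "k \<le> l" "0 \<le> t"
  shows "wsum (L l) (\<lambda>_. 1) (\<lambda>m. u t m - v t m) \<le> 6 * \<gamma> / sqrt k * En l (u 0)"
proof -
  \<comment> \<open>Twice the constant of \<open>distance_derivative_bound\<close>, the 2 coming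
    from differentiating a square. With this weight the decrease of the two energies compensates the
    growth of the distance.\<close>
  let ?g = "3 * \<gamma> / sqrt k"
  have g0: "0 \<le> ?g" using \<gamma>_nonneg assms(4) by simp
  let ?E = "\<lambda>t. wsum (L l) (\<lambda>_. 1) (\<lambda>m. u t m - v t m) + ?g * (En l (u t) + En l (v t))"
  have "?E t \<le> ?E 0"
  proof (rule DERIV_nonpos_imp_nonincreasing[OF assms(6)])
    fix x
    let ?F = "\<lambda>m. cutoff lam k (M (cutoff lam k (u x))) m - cutoff lam l (M (cutoff lam l (v x))) m"
    obtain e1 where e1: "((\<lambda>t. En l (u t)) has_real_derivative e1) (at x)" "e1 \<le> - A2 l (u x)"
      using En_derivative[OF u assms(5)] .
    obtain e2 where e2: "((\<lambda>t. En l (v t)) has_real_derivative e2) (at x)" "e2 \<le> - A2 l (v x)"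
      using En_derivative[OF v order_refl] .
    let ?d = "2 * (\<Sum>m\<in>L l. 1 * inner (u x m - v x m) (- of_real (ev m) * (u x m - v x m) + ?F m))"
    have d: "((\<lambda>t. wsum (L l) (\<lambda>_. 1) (\<lambda>m. u t m - v t m)) has_real_derivative ?d) (at x)"
    proof (rule wsum_has_derivative)
      fix m
      have "((\<lambda>t. u t m - v t m) has_vector_derivative
          ((- of_real (ev m) * u x m + cutoff lam k (M (cutoff lam k (u x))) m) -
           (- of_real (ev m) * v x m + cutoff lam l (M (cutoff lam l (v x))) m))) (at x)"
        using u v by (intro has_vector_derivative_diff) (auto simp: solves_def)
      then show "((\<lambda>t. u t m - v t m) has_vector_derivative
          (- of_real (ev m) * (u x m - v x m) + ?F m)) (at x)"
        by (simp add: algebra_simps)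
    qed
    have "1 * inner (u x m - v x m) (- of_real (ev m) * (u x m - v x m) + ?F m)
        \<le> inner (u x m - v x m) (?F m)" for m
    proof -
      have "inner (u x m - v x m) (- of_real (ev m) * (u x m - v x m)) = - (ev m * (cmod (u x m - v x m))\<^sup>2)"
        by (simp add: inner_of_real_mult power2_norm_eq_inner)
      also have "\<dots> \<le> 0" by simp
      finally show ?thesis unfolding inner_add_right by simp
    qed
    then have "?d \<le> 2 * (\<Sum>m\<in>L l. inner (u x m - v x m) (?F m))"
      by (intro mult_left_mono sum_mono) auto
    also have "\<dots> \<le> 2 * (3 / 2 * \<gamma> / sqrt k * (A2 l (u x) + A2 l (v x)))"
      using assms u v by (intro mult_left_mono distance_derivative_bound) (auto simp: solves_def)
    finally have dle: "?d \<le> ?g * (A2 l (u x) + A2 l (v x))" by simp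
    have "?g * (e1 + e2) \<le> ?g * - (A2 l (u x) + A2 l (v x))"
      using e1 e2 g0 by (intro mult_left_mono) auto
    from add_mono[OF dle this] have "?d + ?g * (e1 + e2) \<le> 0"
      by (simp only: mult_minus_right add.right_inverse)
    moreover have "(?E has_real_derivative ?d + ?g * (e1 + e2)) (at x)"
      by (intro DERIV_add DERIV_cmult d e1 e2)
    ultimately show "\<exists>y. (?E has_real_derivative y) (at x) \<and> y \<le> 0" by blast
  qed
  \<comment> \<open>At time zero the distance vanishes and the two energies agree, which turns 3
    into 6; at time \<open>t\<close> the energies are dropped as nonnegative.\<close>
  moreover have "wsum (L l) (\<lambda>_. 1) (\<lambda>m. u 0 m - v 0 m) = 0"
    using assms(3) by (simp add: wsum_def)
  moreover have "0 \<le> ?g * (En l (u t) + En l (v t))"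
    using g0 En_nonneg by (intro mult_nonneg_nonneg add_nonneg_nonneg)
  ultimately show ?thesis using assms(3) by simp
qed

end

section \<open>Higher moments\<close>

context spectrum
begin

text \<open>The sum is doubled to cover shifts by two eigenvalues, possibly equal ones; the summand
  1 makes every weight at least one, so that its powers increase with the exponent.\<close>

definition lam_sum :: real where "lam_sum = 1 + 2 * (\<Sum>i\<in>UNIV. lam i)"

definition wt :: "('n \<Rightarrow> nat) \<Rightarrow> real" where "wt m = ev m + lam_sum"

lemma sum_lam_pos: "0 \<le> (\<Sum>i\<in>UNIV. lam i)"
  by (intro sum_nonneg) (auto intro: less_imp_le[OF lam_pos])

lemma lam_le_sum: "lam i \<le> (\<Sum>i\<in>UNIV. lam i)"
  by (rule member_le_sum) (auto intro: less_imp_le[OF lam_pos])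

lemma lam_sum_nonneg [simp]: "0 \<le> lam_sum"
  using sum_lam_pos by (simp add: lam_sum_def)

lemma wt_ge1: "1 \<le> wt m"
  using ev_nonneg[of m] sum_lam_pos by (simp add: wt_def lam_sum_def)

lemma wt_nonneg [simp]: "0 \<le> wt m" and wt_pos [simp]: "0 < wt m"
  using wt_ge1[of m] by auto

lemma mult_le_wt: "l1 * real (m i) \<le> wt m"
  using l1_mult_le_ev[of m i] sum_lam_pos by (simp add: wt_def lam_sum_def)

lemma wsum_wt_annihilate:
  assumes "supp_in (L k) f"
  shows "wsum (L k) (\<lambda>n. wt n ^ p) (annihilate i f) \<le> wsum (L k) (\<lambda>m. wt m ^ Suc p) f / l1"
proof -
  have "wsum (L k) (\<lambda>n. wt n ^ p) (annihilate i f) \<le>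
      wsum (L k) (\<lambda>n. wt (n(i := n i + 1)) ^ p) (annihilate i f)"
    by (intro wsum_mono power_mono) (auto simp: wt_def eigval_raise less_imp_le[OF lam_pos])
  also have "\<dots> = wsum (L k) (\<lambda>m. wt m ^ p * real (m i)) f"
    by (rule wsum_annihilate[OF assms])
  also have "\<dots> \<le> wsum (L k) (\<lambda>m. 1 / l1 * wt m ^ Suc p) f"
  proof (rule wsum_mono)
    fix m
    have "wt m ^ p * (l1 * real (m i)) \<le> wt m ^ p * wt m" by (intro mult_left_mono mult_le_wt) simp
    then show "wt m ^ p * real (m i) \<le> 1 / l1 * wt m ^ Suc p"
      using l1_pos by (simp add: field_simps)
  qed
  also have "\<dots> = wsum (L k) (\<lambda>m. wt m ^ Suc p) f / l1" unfolding wsum_cmult by simp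
  finally show ?thesis .
qed

end

context flow_coeffs
begin

text \<open>The shifts are at most \<open>lam_sum\<close>, so both bases are at most twice the
  weight, which gives \<open>2 ^ p\<close>. The difference is one power lower than its
  terms.\<close>

lemma shift_power_diff_le:
  assumes "0 \<le> a" "a \<le> lam_sum" "0 \<le> a'" "a' \<le> lam_sum"
  shows "\<bar>(ev n + a + lam_sum) ^ Suc p - (ev n + a' + lam_sum) ^ Suc p\<bar>
    \<le> real (Suc p) * 2 ^ p * lam_sum * wt n ^ p"
proof -
  have "\<bar>(ev n + a + lam_sum) ^ Suc p - (ev n + a' + lam_sum) ^ Suc p\<bar>
      \<le> real (Suc p) * (2 * wt n) ^ p * \<bar>(ev n + a + lam_sum) - (ev n + a' + lam_sum)\<bar>"
  proof (rule power_Suc_diff_le)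
    show "0 \<le> ev n + a + lam_sum" "ev n + a + lam_sum \<le> 2 * wt n"
      "0 \<le> ev n + a' + lam_sum" "ev n + a' + lam_sum \<le> 2 * wt n"
      unfolding wt_def distrib_left using assms ev_nonneg[of n] by linarith+
  qed
  also have "\<dots> \<le> real (Suc p) * (2 * wt n) ^ p * lam_sum"
    using assms by (intro mult_left_mono) auto
  finally show ?thesis by (simp add: power_mult_distrib mult_ac)
qed

lemma sum_weighted_inner_le:
  assumes "\<And>n. \<bar>G n\<bar> \<le> K * wt n ^ p" "0 \<le> K" "0 < (\<epsilon>::real)"
  shows "\<bar>\<Sum>n\<in>L k. G n * inner (f n) (g n)\<bar>
    \<le> K * (\<epsilon> * wsum (L k) (\<lambda>n. wt n ^ p) f + wsum (L k) (\<lambda>n. wt n ^ p) g / \<epsilon>)"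
proof -
  have "\<bar>\<Sum>n\<in>L k. G n * inner (f n) (g n)\<bar> \<le>
      (\<Sum>n\<in>L k. K * wt n ^ p * (\<epsilon> * (cmod (f n))\<^sup>2 + (cmod (g n))\<^sup>2 / \<epsilon>))"
  proof (rule order_trans[OF sum_abs], rule sum_mono)
    fix n
    have "\<bar>inner (f n) (g n)\<bar> \<le> (\<epsilon> * (cmod (f n))\<^sup>2 + (cmod (g n))\<^sup>2 / \<epsilon>) / 2"
      using ip_le[OF assms(3), of "{n}" f g] by (simp add: ip_def wsum_def)
    also have "\<dots> \<le> \<epsilon> * (cmod (f n))\<^sup>2 + (cmod (g n))\<^sup>2 / \<epsilon>"
    proof -
      have "0 \<le> \<epsilon> * (cmod (f n))\<^sup>2 + (cmod (g n))\<^sup>2 / \<epsilon>" using assms(3) by simp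
      moreover have "x / 2 \<le> x" if "0 \<le> x" for x :: real using that by simp
      ultimately show ?thesis by blast
    qed
    finally show "\<bar>G n * inner (f n) (g n)\<bar> \<le> K * wt n ^ p * (\<epsilon> * (cmod (f n))\<^sup>2 + (cmod (g n))\<^sup>2 / \<epsilon>)"
      unfolding abs_mult using assms by (intro mult_mono) auto
  qed
  also have "\<dots> = K * (\<epsilon> * wsum (L k) (\<lambda>n. wt n ^ p) f + wsum (L k) (\<lambda>n. wt n ^ p) g / \<epsilon>)"
    by (simp add: wsum_def sum_distrib_left sum_divide_distrib algebra_simps sum.distrib)
  finally show ?thesis .
qed

text \<open>Count powers of the weight: the difference of \<open>?h\<close> loses one, each
  annihilation costs one on its own argument. So \<open>B\<close> stays at order
  \<open>Suc p\<close>, while \<open>C\<close> reaches \<open>Suc (Suc p)\<close> through its double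
  annihilation; that term gets coefficient one, to be absorbed by damping.\<close>

lemma weighted_commutator_bound:
  "\<exists>C\<ge>0. \<forall>k f. supp_in (L k) f \<longrightarrow>
     ip (L k) (hw (\<lambda>x. (x + lam_sum) ^ Suc p) f) (M f)
       \<le> C * wsum (L k) (\<lambda>m. wt m ^ Suc p) f + wsum (L k) (\<lambda>m. wt m ^ Suc (Suc p)) f"
proof -
  let ?h = "\<lambda>x. (x + lam_sum) ^ Suc p"
  define K where "K = real (Suc p) * 2 ^ p * lam_sum"
  define SB where "SB = (\<Sum>i\<in>UNIV. \<Sum>j\<in>UNIV. \<bar>\<beta> i j\<bar>)"
  define ST where "ST = sqrt (q / 2) * (\<Sum>i\<in>UNIV. \<Sum>j\<in>UNIV. \<Sum>l\<in>UNIV. \<bar>\<theta> i j l\<bar>)"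
  have K0: "0 \<le> K" using sum_lam_pos by (simp add: K_def lam_sum_def)
  have SB0: "0 \<le> SB" unfolding SB_def by (intro sum_nonneg) auto
  have ST0: "0 \<le> ST" unfolding ST_def using q_pos by (intro mult_nonneg_nonneg sum_nonneg) auto
  \<comment> \<open>Young parameter making the total coefficient of the highest moment at most one;
    the \<open>+ 1\<close> avoids division by zero.\<close>
  define \<epsilon> where "\<epsilon> = l1\<^sup>2 / (ST * K + 1)"
  have \<epsilon>: "0 < \<epsilon>" using ST0 K0 l1_pos by (simp add: \<epsilon>_def add_nonneg_pos)
  have \<epsilon>': "ST * K * \<epsilon> / l1\<^sup>2 \<le> 1"
  proof -
    have "ST * K * \<epsilon> / l1\<^sup>2 = ST * K / (ST * K + 1)" using l1_pos by (simp add: \<epsilon>_def)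
    also have "\<dots> \<le> 1" using mult_nonneg_nonneg[OF ST0 K0] by (simp add: divide_le_eq)
    finally show ?thesis .
  qed
  define C where "C = SB * (2 * K / l1) + ST * K / (\<epsilon> * l1)"
  have C0: "0 \<le> C" using SB0 ST0 K0 l1_pos \<epsilon> by (simp add: C_def)
  have "ip (L k) (hw ?h f) (M f)
       \<le> C * wsum (L k) (\<lambda>m. wt m ^ Suc p) f + wsum (L k) (\<lambda>m. wt m ^ Suc (Suc p)) f"
    if f: "supp_in (L k) f" for k f
  proof -
    let ?W1 = "wsum (L k) (\<lambda>m. wt m ^ Suc p) f" and ?W2 = "wsum (L k) (\<lambda>m. wt m ^ Suc (Suc p)) f"
    have a1: "wsum (L k) (\<lambda>n. wt n ^ p) (annihilate i f) \<le> ?W1 / l1" for i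
      by (rule wsum_wt_annihilate[OF f])
    have a2: "wsum (L k) (\<lambda>n. wt n ^ p) (annihilate l (annihilate j f)) \<le> ?W2 / l1\<^sup>2" for j l
    proof -
      have "wsum (L k) (\<lambda>n. wt n ^ p) (annihilate l (annihilate j f)) \<le>
          wsum (L k) (\<lambda>n. wt n ^ Suc p) (annihilate j f) / l1"
        by (rule wsum_wt_annihilate[OF supp_annihilate[OF f]])
      also have "\<dots> \<le> ?W2 / l1 / l1"
        using l1_pos by (intro divide_right_mono wsum_wt_annihilate[OF f]) auto
      finally show ?thesis by (simp add: power2_eq_square)
    qed
    let ?IB = "\<lambda>i j. \<Sum>n\<in>L k. (?h (ev n + lam j) - ?h (ev n)) * inner (annihilate j f n) (annihilate i f n)"
    let ?IC = "\<lambda>i j l. \<Sum>n\<in>L k. (?h (ev n + lam j + lam l) - ?h (ev n + lam i)) *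
         inner (annihilate l (annihilate j f) n) (annihilate i f n)"
    have ls: "0 \<le> lam i" "lam i \<le> lam_sum" "0 \<le> lam i + lam j" "lam i + lam j \<le> lam_sum" "0 \<le> lam_sum" for i j
      using lam_le_sum[of i] lam_le_sum[of j] lam_pos[of i] lam_pos[of j] sum_lam_pos
      by (auto simp: lam_sum_def)
    have IB: "\<bar>?IB i j\<bar> \<le> 2 * K / l1 * ?W1" for i j
    proof -
      have "\<bar>?IB i j\<bar> \<le> K * (1 * wsum (L k) (\<lambda>n. wt n ^ p) (annihilate j f) +
          wsum (L k) (\<lambda>n. wt n ^ p) (annihilate i f) / 1)"
      proof (rule sum_weighted_inner_le[OF _ K0])
        show "\<bar>?h (ev n + lam j) - ?h (ev n)\<bar> \<le> K * wt n ^ p" for n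
          using shift_power_diff_le[of "lam j" 0 n p] ls by (simp add: K_def)
      qed simp
      also have "\<dots> \<le> K * (1 * (?W1 / l1) + ?W1 / l1 / 1)"
        using K0 by (intro mult_left_mono add_mono divide_right_mono a1) auto
      also have "\<dots> = 2 * K / l1 * ?W1" by simp
      finally show ?thesis .
    qed
    have IC: "\<bar>?IC i j l\<bar> \<le> K * (\<epsilon> * (?W2 / l1\<^sup>2) + ?W1 / l1 / \<epsilon>)" for i j l
    proof -
      have "\<bar>?IC i j l\<bar> \<le> K * (\<epsilon> * wsum (L k) (\<lambda>n. wt n ^ p) (annihilate l (annihilate j f)) +
          wsum (L k) (\<lambda>n. wt n ^ p) (annihilate i f) / \<epsilon>)"
      proof (rule sum_weighted_inner_le[OF _ K0 \<epsilon>])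
        show "\<bar>?h (ev n + lam j + lam l) - ?h (ev n + lam i)\<bar> \<le> K * wt n ^ p" for n
          using shift_power_diff_le[of "lam j + lam l" "lam i" n p] ls by (simp add: K_def add.assoc)
      qed
      also have "\<dots> \<le> K * (\<epsilon> * (?W2 / l1\<^sup>2) + ?W1 / l1 / \<epsilon>)"
        using K0 \<epsilon> by (intro mult_left_mono add_mono divide_right_mono a1 a2) auto
      finally show ?thesis .
    qed
    have "(\<Sum>i\<in>UNIV. \<Sum>j\<in>UNIV. \<beta> i j * ?IB i j) \<le> (\<Sum>i\<in>UNIV. \<Sum>j\<in>UNIV. \<bar>\<beta> i j\<bar> * (2 * K / l1 * ?W1))"
      by (rule order_trans[OF abs_ge_self abs_sum2_le]) (simp only: abs_mult, intro mult_left_mono IB, simp)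
    also have "\<dots> = SB * (2 * K / l1 * ?W1)" by (simp only: SB_def sum_distrib_right)
    finally have B: "(\<Sum>i\<in>UNIV. \<Sum>j\<in>UNIV. \<beta> i j * ?IB i j) \<le> SB * (2 * K / l1 * ?W1)" .
    have "(\<Sum>i\<in>UNIV. \<Sum>j\<in>UNIV. \<Sum>l\<in>UNIV. \<theta> i j l * ?IC i j l) \<le>
        (\<Sum>i\<in>UNIV. \<Sum>j\<in>UNIV. \<Sum>l\<in>UNIV. \<bar>\<theta> i j l\<bar> * (K * (\<epsilon> * (?W2 / l1\<^sup>2) + ?W1 / l1 / \<epsilon>)))"
      by (rule order_trans[OF abs_ge_self abs_sum3_le]) (simp only: abs_mult, intro mult_left_mono IC, simp)
    also have "\<dots> = (\<Sum>i\<in>UNIV. \<Sum>j\<in>UNIV. \<Sum>l\<in>UNIV. \<bar>\<theta> i j l\<bar>) * (K * (\<epsilon> * (?W2 / l1\<^sup>2) + ?W1 / l1 / \<epsilon>))"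
      by (simp only: sum_distrib_right)
    finally have "sqrt (q / 2) * (\<Sum>i\<in>UNIV. \<Sum>j\<in>UNIV. \<Sum>l\<in>UNIV. \<theta> i j l * ?IC i j l) \<le>
        ST * (K * (\<epsilon> * (?W2 / l1\<^sup>2) + ?W1 / l1 / \<epsilon>))"
      unfolding ST_def mult.assoc using q_pos by (intro mult_left_mono) auto
    then have "ip (L k) (hw ?h f) (M f) \<le> SB * (2 * K / l1 * ?W1) + ST * (K * (\<epsilon> * (?W2 / l1\<^sup>2) + ?W1 / l1 / \<epsilon>))"
      using B unfolding ip_hw_M[OF f] by (rule add_mono[rotated])
    also have "\<dots> = C * ?W1 + ST * K * \<epsilon> / l1\<^sup>2 * ?W2"
      by (simp add: C_def algebra_simps)
    also have "\<dots> \<le> C * ?W1 + 1 * ?W2"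
      by (intro add_mono mult_right_mono \<epsilon>' wsum_nonneg) auto
    finally show ?thesis by simp
  qed
  then show ?thesis using C0 by blast
qed

text \<open>Since \<open>ev m = wt m - lam_sum\<close>, damping subtracts the next higher moment,
  exactly what the commutator leaves over, up to \<open>lam_sum\<close> times the current one. The
  rate does not depend on the cutoff.\<close>

lemma weighted_moment_growth:
  "\<exists>a\<ge>0. \<forall>k u t. solves k u \<longrightarrow> 0 \<le> t \<longrightarrow>
     wsum (L k) (\<lambda>m. wt m ^ Suc p) (u t) \<le> exp (a * t) * wsum (L k) (\<lambda>m. wt m ^ Suc p) (u 0)"
proof -
  let ?h = "\<lambda>x. (x + lam_sum) ^ Suc p"
  obtain C where C: "0 \<le> C" "\<And>k f. supp_in (L k) f \<Longrightarrow>
     ip (L k) (hw ?h f) (M f)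
       \<le> C * wsum (L k) (\<lambda>m. wt m ^ Suc p) f + wsum (L k) (\<lambda>m. wt m ^ Suc (Suc p)) f"
    using weighted_commutator_bound[of p] by blast
  define a where "a = 2 * (C + lam_sum)"
  have a0: "0 \<le> a" using C(1) sum_lam_pos by (simp add: a_def lam_sum_def)
  have "wsum (L k) (\<lambda>m. wt m ^ Suc p) (u t) \<le> exp (a * t) * wsum (L k) (\<lambda>m. wt m ^ Suc p) (u 0)"
    if u: "solves k u" and "0 \<le> t" for k u t
  proof (rule gronwall_exp[OF _ _ \<open>0 \<le> t\<close>])
    fix t
    let ?f = "cutoff lam k (u t)"
    let ?d = "2 * (ip (L k) (hw ?h ?f) (M ?f) - wsum (L k) (\<lambda>m. wt m ^ Suc p * ev m) (u t))"
    show "((\<lambda>t. wsum (L k) (\<lambda>m. wt m ^ Suc p) (u t)) has_real_derivative ?d) (at t)"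
      using wsum_solves_derivative[OF u, of k ?h t] by (simp only: wt_def)
    have f: "supp_in (L k) ?f" by (rule supp_cutoff) simp
    have "wsum (L k) (\<lambda>m. wt m ^ Suc p * ev m) (u t) =
        wsum (L k) (\<lambda>m. wt m ^ Suc (Suc p) + (- lam_sum) * wt m ^ Suc p) (u t)"
      by (rule arg_cong[of _ _ "\<lambda>v. wsum (L k) v (u t)"]) (auto simp: wt_def algebra_simps)
    also have "\<dots> = wsum (L k) (\<lambda>m. wt m ^ Suc (Suc p)) (u t) - lam_sum * wsum (L k) (\<lambda>m. wt m ^ Suc p) (u t)"
      unfolding wsum_add wsum_cmult by simp
    finally have 1: "wsum (L k) (\<lambda>m. wt m ^ Suc p * ev m) (u t) =
        wsum (L k) (\<lambda>m. wt m ^ Suc (Suc p)) (u t) - lam_sum * wsum (L k) (\<lambda>m. wt m ^ Suc p) (u t)" .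
    have "wsum (L k) (\<lambda>m. wt m ^ r) ?f \<le> wsum (L k) (\<lambda>m. wt m ^ r) (u t)" for r
      by (intro wsum_cutoff) simp
    then have "ip (L k) (hw ?h ?f) (M ?f) \<le>
        C * wsum (L k) (\<lambda>m. wt m ^ Suc p) (u t) + wsum (L k) (\<lambda>m. wt m ^ Suc (Suc p)) (u t)"
      by (intro order_trans[OF C(2)[OF f]] add_mono mult_left_mono C(1))
    then show "?d \<le> a * wsum (L k) (\<lambda>m. wt m ^ Suc p) (u t)"
      unfolding 1 by (simp add: a_def algebra_simps)
  qed
  then show ?thesis using a0 by blast
qed

end

section \<open>Finite linear functionals of a coefficient family\<close>

text \<open>Linear functionals that read finitely many coefficients. Generating them inductively
  lets limits, series and derivatives pass through a row of \<open>K_op\<close> without its matrix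
  entries being written out.\<close>

inductive_set fin_lin :: "(('a \<Rightarrow> complex) \<Rightarrow> complex) set" where
  eval: "(\<lambda>f. f m) \<in> fin_lin"
| zero: "(\<lambda>_. 0) \<in> fin_lin"
| add: "F \<in> fin_lin \<Longrightarrow> G \<in> fin_lin \<Longrightarrow> (\<lambda>f. F f + G f) \<in> fin_lin"
| scale: "F \<in> fin_lin \<Longrightarrow> (\<lambda>f. r * F f) \<in> fin_lin"

lemma fin_lin_sum: "(\<And>i. i \<in> I \<Longrightarrow> F i \<in> fin_lin) \<Longrightarrow> (\<lambda>f. \<Sum>i\<in>I. F i f) \<in> fin_lin"
  by (induction I rule: infinite_finite_induct) (auto intro: fin_lin.intros)

lemma fin_lin_minus: "F \<in> fin_lin \<Longrightarrow> (\<lambda>f. - F f) \<in> fin_lin"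
  using fin_lin.scale[of F "-1"] by simp

lemma fin_lin_diff: "F \<in> fin_lin \<Longrightarrow> G \<in> fin_lin \<Longrightarrow> (\<lambda>f. F f - G f) \<in> fin_lin"
  using fin_lin.add[OF _ fin_lin_minus, of F G] by simp

lemma fin_lin_compose:
  assumes "F \<in> fin_lin" "\<And>m. (\<lambda>f. T f m) \<in> fin_lin"
  shows "(\<lambda>f. F (T f)) \<in> fin_lin"
  using assms by (induction rule: fin_lin.induct) (auto intro: fin_lin.intros)

lemma fin_lin_sums:
  assumes "F \<in> fin_lin" "\<And>m. (\<lambda>n. a n m) sums s m"
  shows "(\<lambda>n. F (a n)) sums F s"
  using assms(1) by induction (auto intro: assms(2) sums_add sums_mult)

lemma fin_lin_vector_derivative:
  assumes "F \<in> fin_lin" "\<And>m. ((\<lambda>t. f t m) has_vector_derivative f' m) (at t within S)"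
  shows "((\<lambda>t. F (f t)) has_vector_derivative F f') (at t within S)"
  using assms(1)
  by induction (auto intro: assms(2) has_vector_derivative_add has_vector_derivative_mult_right)

lemma fin_lin_apply_diff: "F \<in> fin_lin \<Longrightarrow> F (\<lambda>m. f m - g m) = F f - F g"
  by (induction rule: fin_lin.induct) (simp_all add: right_diff_distrib add_diff_add)

lemma fin_lin_apply_scale: "F \<in> fin_lin \<Longrightarrow> F (\<lambda>m. r * f m) = r * F f"
  by (induction rule: fin_lin.induct) (simp_all add: distrib_left mult.left_commute)

text \<open>One row at a time, in the supremum norm: a small norm distance bounds every coefficient,
  so this weak bound suffices for passing to the limit in each row.\<close>

lemma fin_lin_bounded:
  assumes "F \<in> fin_lin"
  shows "\<exists>C\<ge>0. \<forall>f X. (\<forall>m. cmod (f m) \<le> X) \<longrightarrow> cmod (F f) \<le> C * X"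
  using assms
proof induction
  case (eval m)
  show ?case by (intro exI[of _ 1]) auto
next
  case zero
  show ?case by (intro exI[of _ 0]) auto
next
  case (add F G)
  then obtain C D where "C \<ge> 0" "D \<ge> 0"
    and C: "\<And>f X. (\<forall>m. cmod (f m) \<le> X) \<Longrightarrow> cmod (F f) \<le> C * X"
    and D: "\<And>f X. (\<forall>m. cmod (f m) \<le> X) \<Longrightarrow> cmod (G f) \<le> D * X" by metis
  moreover have "cmod (F f + G f) \<le> (C + D) * X" if "\<forall>m. cmod (f m) \<le> X" for f X
    using norm_triangle_ineq[of "F f" "G f"] C[OF that] D[OF that] by (simp add: algebra_simps)
  ultimately show ?case by (intro exI[of _ "C + D"]) auto
next
  case (scale F r)
  then obtain C where "C \<ge> 0"
    and C: "\<And>f X. (\<forall>m. cmod (f m) \<le> X) \<Longrightarrow> cmod (F f) \<le> C * X" by metis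
  moreover have "cmod (r * F f) \<le> (cmod r * C) * X" if "\<forall>m. cmod (f m) \<le> X" for f X
    using mult_left_mono[OF C[OF that], of "cmod r"] by (simp add: norm_mult mult.assoc)
  ultimately show ?case by (intro exI[of _ "cmod r * C"]) auto
qed

lemma fin_lin_support:
  assumes "F \<in> fin_lin"
  shows "\<exists>R. finite R \<and> (\<forall>f g. (\<forall>m\<in>R. f m = g m) \<longrightarrow> F f = F g)"
  using assms
proof induction
  case (eval m)
  show ?case by (intro exI[of _ "{m}"]) auto
next
  case (add F G)
  then obtain R R' where "finite R" "finite R'"
    "\<forall>f g. (\<forall>m\<in>R. f m = g m) \<longrightarrow> F f = F g" "\<forall>f g. (\<forall>m\<in>R'. f m = g m) \<longrightarrow> G f = G g"
    by blast
  then show ?case by (intro exI[of _ "R \<union> R'"]) (simp, metis UnCI)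
qed auto

lemma fin_lin_annihilate: "(\<lambda>f. annihilate i f m) \<in> fin_lin"
  unfolding annihilate_def by (intro fin_lin.intros)

lemma fin_lin_create: "(\<lambda>f. create i f m) \<in> fin_lin"
  unfolding create_def by (cases "m i = 0") (auto intro: fin_lin.intros)

lemmas fin_lin_ladder = fin_lin_compose[OF fin_lin_create fin_lin_annihilate]
  fin_lin_compose[OF fin_lin_create fin_lin_compose[OF fin_lin_create fin_lin_annihilate]]
  fin_lin_compose[OF fin_lin_create fin_lin_compose[OF fin_lin_annihilate fin_lin_annihilate]]

lemma fin_lin_K: "(\<lambda>f. K_op q lam b c f m) \<in> fin_lin"
  unfolding K_op_def A_op_def B_op_def C_op_def
  by (intro fin_lin.add fin_lin_minus fin_lin_sum fin_lin.scale fin_lin_diff fin_lin_ladder)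

lemma fin_lin_cutoff: "(\<lambda>f. cutoff lam k f m) \<in> fin_lin"
  unfolding cutoff_def by (cases "m \<in> cutoff_set lam k") (auto intro: fin_lin.intros)

lemma fin_lin_K_cut: "(\<lambda>f. K_cut q lam b c k f m) \<in> fin_lin"
  unfolding K_cut_def
  by (rule fin_lin_compose[OF fin_lin_cutoff fin_lin_compose[OF fin_lin_K fin_lin_cutoff]])

section \<open>The exponential series of the truncated generator\<close>

context flow_coeffs
begin

abbreviation K :: "(('n \<Rightarrow> nat) \<Rightarrow> complex) \<Rightarrow> ('n \<Rightarrow> nat) \<Rightarrow> complex" where
  "K \<equiv> K_op q lam b c"

lemma K_alt: "K f m = - of_real (ev m) * f m + M f m"
  by (simp add: K_op_def M_def A_op_eigval)

lemma finite_cutoff [simp]: "finite (cutoff_set lam k)"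
  by (rule finite_cutoff_set) (rule lam_pos)

lemma K_cut_bounded:
  "\<exists>C\<ge>0. \<forall>f X m. 0 \<le> X \<longrightarrow> (\<forall>m. cmod (f m) \<le> X) \<longrightarrow> cmod (K_cut q lam b c k f m) \<le> C * X"
proof -
  obtain C where C: "\<And>m. C m \<ge> 0"
    "\<And>f X m. (\<forall>m. cmod (f m) \<le> X) \<Longrightarrow> cmod (K_cut q lam b c k f m) \<le> C m * X"
    using fin_lin_bounded[OF fin_lin_K_cut[of q lam b c k]] by metis
  have "cmod (K_cut q lam b c k f m) \<le> sum C (cutoff_set lam k) * X"
    if "\<forall>m. cmod (f m) \<le> X" "0 \<le> X" for f X m
  proof (cases "m \<in> cutoff_set lam k")
    case True
    then have "C m \<le> sum C (cutoff_set lam k)" by (intro member_le_sum C(1)) auto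
    then show ?thesis using C(2)[OF that(1), of m] that(2) mult_right_mono order_trans by blast
  next
    case False
    then have "K_cut q lam b c k f m = 0" by (simp add: K_cut_def cutoff_def)
    then show ?thesis using that C(1) by (simp add: sum_nonneg)
  qed
  then show ?thesis using C(1) by (intro exI[of _ "sum C (cutoff_set lam k)"]) (auto intro: sum_nonneg)
qed

text \<open>Compared with the exponential series of the supremum-norm bound. The variable is complex
  so that the power series can be differentiated termwise before restriction to real time.\<close>

lemma K_cut_series_summable:
  "summable (\<lambda>n. (K_cut q lam b c k ^^ n) (cutoff lam k f) m / fact n * z ^ n)"
proof -
  obtain C where C: "C \<ge> 0" "\<And>f X m. 0 \<le> X \<Longrightarrow> (\<forall>m. cmod (f m) \<le> X) \<Longrightarrow>
      cmod (K_cut q lam b c k f m) \<le> C * X"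
    using K_cut_bounded[of k] by metis
  define X where "X = (\<Sum>m\<in>cutoff_set lam k. cmod (f m))"
  have X0: "0 \<le> X" unfolding X_def by (intro sum_nonneg) auto
  have bound: "cmod ((K_cut q lam b c k ^^ n) (cutoff lam k f) m) \<le> C ^ n * X" for n m
  proof (induction n arbitrary: m)
    case 0
    show ?case
    proof (cases "m \<in> cutoff_set lam k")
      case True
      then have "cmod (f m) \<le> X" unfolding X_def by (intro member_le_sum) auto
      then show ?thesis by (simp add: cutoff_def X0)
    qed (simp add: cutoff_def X0)
  next
    case (Suc n)
    have "cmod (K_cut q lam b c k ((K_cut q lam b c k ^^ n) (cutoff lam k f)) m) \<le> C * (C ^ n * X)"
      using Suc.IH X0 C(1) by (intro C(2)) auto
    then show ?case by (simp add: mult.assoc)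
  qed
  have le: "norm ((K_cut q lam b c k ^^ n) (cutoff lam k f) m / fact n * z ^ n) \<le>
      X * (inverse (fact n) * (C * cmod z) ^ n)" for n
  proof -
    have "norm ((K_cut q lam b c k ^^ n) (cutoff lam k f) m / fact n * z ^ n) =
        cmod ((K_cut q lam b c k ^^ n) (cutoff lam k f) m) * (inverse (fact n) * cmod z ^ n)"
      by (simp add: norm_mult norm_divide norm_power field_simps)
    also have "\<dots> \<le> (C ^ n * X) * (inverse (fact n) * cmod z ^ n)"
      by (intro mult_right_mono bound) auto
    finally show ?thesis by (simp add: power_mult_distrib mult_ac)
  qed
  have "summable (\<lambda>n. X * (inverse (fact n) * (C * cmod z) ^ n))"
    by (intro summable_mult summable_exp)
  then show ?thesis by (rule summable_comparison_test'[where N = 0]) (rule le)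
qed

definition cut_exp :: "real \<Rightarrow> (('n \<Rightarrow> nat) \<Rightarrow> complex) \<Rightarrow> real \<Rightarrow> ('n \<Rightarrow> nat) \<Rightarrow> complex" where
  "cut_exp k f t m = (\<Sum>n. of_real (t ^ n / fact n) * (K_cut q lam b c k ^^ n) (cutoff lam k f) m)"

lemma cut_exp_alt:
  "cut_exp k f t m = (\<Sum>n. (K_cut q lam b c k ^^ n) (cutoff lam k f) m / fact n * of_real t ^ n)"
  unfolding cut_exp_def by (intro suminf_cong) simp

lemma cut_exp_sums:
  "(\<lambda>n. of_real (t ^ n / fact n) * (K_cut q lam b c k ^^ n) (cutoff lam k f) m) sums cut_exp k f t m"
  using summable_sums[OF K_cut_series_summable[of k f m "of_real t"]]
  unfolding cut_exp_alt by (simp add: mult_ac)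

lemma cut_exp_derivative:
  "((\<lambda>t. cut_exp k f t m) has_vector_derivative K_cut q lam b c k (cut_exp k f t) m) (at t)"
proof -
  let ?v = "\<lambda>n. (K_cut q lam b c k ^^ n) (cutoff lam k f)"
  have "((\<lambda>z. \<Sum>n. ?v n m / fact n * z ^ n) has_field_derivative
      (\<Sum>n. diffs (\<lambda>n. ?v n m / fact n) n * of_real t ^ n)) (at (of_real t))"
    by (rule termdiffs_strong_converges_everywhere[OF K_cut_series_summable])
  then have "((\<lambda>t. cut_exp k f t m) has_vector_derivative
      (\<Sum>n. diffs (\<lambda>n. ?v n m / fact n) n * of_real t ^ n)) (at t)"
    unfolding cut_exp_alt by (rule has_vector_derivative_real_field)
  \<comment> \<open>\<open>diffs\<close> shifts the index by one and (n + 1) / (n + 1)! = 1 / n!, so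
    each term of the differentiated series is the generator applied to the term of the same
    index.\<close>
  moreover have "diffs (\<lambda>n. ?v n m / fact n) n * of_real t ^ n =
      K_cut q lam b c k (\<lambda>m. of_real (t ^ n / fact n) * ?v n m) m" for n
  proof -
    have "diffs (\<lambda>n. ?v n m / fact n) n = ?v (Suc n) m / fact n"
      unfolding diffs_def fact_Suc by (simp del: of_nat_Suc)
    then show ?thesis
      unfolding fin_lin_apply_scale[OF fin_lin_K_cut] by simp
  qed
  moreover have "(\<lambda>n. K_cut q lam b c k (\<lambda>m. of_real (t ^ n / fact n) * ?v n m) m) sums
      K_cut q lam b c k (cut_exp k f t) m"
    by (rule fin_lin_sums[OF fin_lin_K_cut]) (rule cut_exp_sums)
  ultimately show ?thesis by (simp add: sums_iff)
qed

lemma reg_coef_alt: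
  "reg_coef q lam b c k \<psi> t m = (if m \<in> cutoff_set lam k then cut_exp k (coef \<psi>) t m
     else of_real (exp (- (eigval lam m * t))) * coef \<psi> m)"
  by (simp add: reg_coef_def cut_exp_def)

lemma reg_coef_0: "reg_coef q lam b c k \<psi> 0 = coef \<psi>"
proof
  fix m
  have "cut_exp k (coef \<psi>) 0 m = cutoff lam k (coef \<psi>) m"
    unfolding cut_exp_alt of_real_0 powser_zero by simp
  then show "reg_coef q lam b c k \<psi> 0 m = coef \<psi> m"
    unfolding reg_coef_alt by (simp add: cutoff_def)
qed

lemma reg_coef_solves:
  assumes "\<psi> \<in> fock0"
  shows "solves k (reg_coef q lam b c k \<psi>)"
  unfolding solves_def
proof (intro conjI allI)
  show "reg_coef q lam b c k \<psi> t (\<lambda>_. 0) = 0" for t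
    using assms by (simp add: reg_coef_alt cutoff_set_def fock0_def)
  fix t m
  let ?u = "reg_coef q lam b c k \<psi>"
  show "((\<lambda>t. ?u t m) has_vector_derivative
        (- of_real (ev m) * ?u t m + cutoff lam k (M (cutoff lam k (?u t))) m)) (at t)"
  proof (cases "m \<in> cutoff_set lam k")
    case True
    \<comment> \<open>Outside the cutoff set \<open>cut_exp\<close> and the regularized solution may
      differ, but \<open>K_cut\<close> truncates its argument and so sees the same vector.\<close>
    have "cutoff lam k (cut_exp k (coef \<psi>) t) = cutoff lam k (?u t)"
      by (auto simp: cutoff_def reg_coef_alt)
    then have "K_cut q lam b c k (cut_exp k (coef \<psi>) t) m =
        - of_real (ev m) * ?u t m + cutoff lam k (M (cutoff lam k (?u t))) m"
      using True unfolding K_cut_def by (simp add: cutoff_def K_alt)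
    then show ?thesis
      using cut_exp_derivative[of k "coef \<psi>" m t] True by (simp add: reg_coef_alt)
  next
    case False
    have "((\<lambda>t. of_real (exp (- (ev m * t))) * coef \<psi> m) has_vector_derivative
        of_real (exp (- (ev m * t)) * - ev m) * coef \<psi> m) (at t)"
      by (intro has_vector_derivative_mult_left has_vector_derivative_of_real)
         (auto intro!: derivative_eq_intros)
    then show ?thesis
      using False by (simp add: reg_coef_alt cutoff_def mult_ac)
  qed
qed

end

section \<open>Uniformly bounded families\<close>

lemma square_summable_wsum:
  assumes "\<And>F. finite F \<Longrightarrow> wsum F (\<lambda>_. 1) f \<le> C"
  shows "square_summable f"
  unfolding square_summable_def
  by (rule nonneg_bdd_above_summable_on) (use assms in \<open>auto simp: wsum_def intro!: bdd_aboveI\<close>)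

lemma norm_ell2_le:
  assumes "\<And>F. finite F \<Longrightarrow> wsum F (\<lambda>_. 1) (coef \<psi>) \<le> C"
  shows "(norm \<psi>)\<^sup>2 \<le> C"
proof -
  have "(\<Sum>\<^sub>\<infinity>x. (cmod (coef \<psi> x))\<^sup>2) \<le> C"
    by (rule infsum_le_finite_sums)
       (use assms square_summable_coef[of \<psi>] in \<open>auto simp: wsum_def square_summable_def\<close>)
  moreover have "0 \<le> (\<Sum>\<^sub>\<infinity>x. (cmod (coef \<psi> x))\<^sup>2)" by (rule infsum_nonneg) simp
  ultimately show ?thesis by (simp add: norm_ell2_def)
qed

lemma wsum_le_norm:
  assumes "finite F"
  shows "wsum F (\<lambda>_. 1) (coef \<psi>) \<le> (norm \<psi>)\<^sup>2"
proof -
  have "0 \<le> (\<Sum>\<^sub>\<infinity>x. (cmod (coef \<psi> x))\<^sup>2)" by (rule infsum_nonneg) simp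
  moreover have "(\<Sum>x\<in>F. (cmod (coef \<psi> x))\<^sup>2) \<le> (\<Sum>\<^sub>\<infinity>x. (cmod (coef \<psi> x))\<^sup>2)"
    using assms square_summable_coef[of \<psi>]
    by (intro finite_sum_le_infsum) (auto simp: square_summable_def)
  ultimately show ?thesis by (simp add: norm_ell2_def wsum_def)
qed

lemma wsum_mono_set:
  assumes "finite G" "F \<subseteq> G" "\<And>m. 0 \<le> v m"
  shows "wsum F v f \<le> wsum G v f"
  unfolding wsum_def using assms by (intro sum_mono2) auto

context spectrum
begin

lemma moment_le:
  assumes "\<And>F. finite F \<Longrightarrow> wsum F (\<lambda>m. ev m ^ p) (coef \<psi>) \<le> C"
  shows "moment lam p \<psi> \<le> ennreal C"
  unfolding moment_def
proof (rule infsum_le_finite_sums)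
  fix F :: "('n \<Rightarrow> nat) set" assume "finite F"
  have "(\<Sum>m\<in>F. ennreal (ev m ^ p * (cmod (coef \<psi> m))\<^sup>2)) = ennreal (wsum F (\<lambda>m. ev m ^ p) (coef \<psi>))"
    unfolding wsum_def by (rule sum_ennreal) simp
  then show "(\<Sum>m\<in>F. ennreal (ev m ^ p * (cmod (coef \<psi> m))\<^sup>2)) \<le> ennreal C"
    using assms[OF \<open>finite F\<close>] by (simp add: ennreal_leI)
qed (rule nonneg_summable_on_complete, simp)

lemma wsum_le_moment:
  assumes "finite F" "moment lam p \<psi> < \<infinity>"
  shows "wsum F (\<lambda>m. ev m ^ p) (coef \<psi>) \<le> enn2real (moment lam p \<psi>)"
proof -
  have "ennreal (wsum F (\<lambda>m. ev m ^ p) (coef \<psi>)) = (\<Sum>m\<in>F. ennreal (ev m ^ p * (cmod (coef \<psi> m))\<^sup>2))"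
    unfolding wsum_def by (rule sum_ennreal[symmetric]) simp
  also have "\<dots> \<le> moment lam p \<psi>"
    unfolding moment_def using assms(1) by (subst nonneg_infsum_complete) (auto intro: SUP_upper)
  also have "\<dots> = ennreal (enn2real (moment lam p \<psi>))"
    using assms(2) by (simp add: less_top)
  finally show ?thesis by (simp add: ennreal_le_iff)
qed

text \<open>Bounds on finite partial sums, unlike values of infinite sums, pass to pointwise limits
  at once; as weights are at least one, they contain square-summability.\<close>

definition ubd :: "'t set \<Rightarrow> nat \<Rightarrow> ('t \<Rightarrow> ('n \<Rightarrow> nat) \<Rightarrow> complex) \<Rightarrow> bool" where
  "ubd S p f \<longleftrightarrow> (\<exists>C. \<forall>t\<in>S. \<forall>F. finite F \<longrightarrow> wsum F (\<lambda>m. wt m ^ p) (f t) \<le> C)"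

lemma ubd_mono:
  assumes "ubd S r f" "p \<le> r" shows "ubd S p f"
proof -
  obtain C where C: "\<And>t F. t \<in> S \<Longrightarrow> finite F \<Longrightarrow> wsum F (\<lambda>m. wt m ^ r) (f t) \<le> C"
    using assms(1) unfolding ubd_def by blast
  have "wsum F (\<lambda>m. wt m ^ p) (f t) \<le> wsum F (\<lambda>m. wt m ^ r) (f t)" for t F
    by (intro wsum_mono power_increasing assms(2) wt_ge1)
  then show ?thesis unfolding ubd_def using C order_trans by blast
qed

lemma ubd_zero: "ubd S p (\<lambda>t m. 0)"
  unfolding ubd_def by (intro exI[of _ 0]) (simp add: wsum_def)

lemma ubd_add:
  assumes "ubd S p f" "ubd S p g" shows "ubd S p (\<lambda>t m. f t m + g t m)"
proof -
  obtain C where C: "\<And>t F. t \<in> S \<Longrightarrow> finite F \<Longrightarrow> wsum F (\<lambda>m. wt m ^ p) (f t) \<le> C"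
    using assms(1) unfolding ubd_def by blast
  obtain D where D: "\<And>t F. t \<in> S \<Longrightarrow> finite F \<Longrightarrow> wsum F (\<lambda>m. wt m ^ p) (g t) \<le> D"
    using assms(2) unfolding ubd_def by blast
  have le: "wsum F (\<lambda>m. wt m ^ p) (\<lambda>m. f t m + g t m) \<le>
      2 * wsum F (\<lambda>m. wt m ^ p) (f t) + 2 * wsum F (\<lambda>m. wt m ^ p) (g t)" for F t
  proof -
    have "wt m ^ p * (cmod (f t m + g t m))\<^sup>2 \<le>
        2 * (wt m ^ p * (cmod (f t m))\<^sup>2) + 2 * (wt m ^ p * (cmod (g t m))\<^sup>2)" for m
    proof -
      have "(cmod (f t m + g t m))\<^sup>2 \<le> (cmod (f t m) + cmod (g t m))\<^sup>2"
        by (intro power_mono norm_triangle_ineq) auto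
      also have "\<dots> \<le> 2 * (cmod (f t m))\<^sup>2 + 2 * (cmod (g t m))\<^sup>2"
        using zero_le_power2[of "cmod (f t m) - cmod (g t m)"]
        by (simp add: power2_eq_square algebra_simps)
      finally have "wt m ^ p * (cmod (f t m + g t m))\<^sup>2 \<le>
          wt m ^ p * (2 * (cmod (f t m))\<^sup>2 + 2 * (cmod (g t m))\<^sup>2)"
        by (intro mult_left_mono) auto
      then show ?thesis by (simp add: algebra_simps)
    qed
    then show ?thesis
      unfolding wsum_def sum_distrib_left sum.distrib[symmetric] by (intro sum_mono)
  qed
  have "wsum F (\<lambda>m. wt m ^ p) (\<lambda>m. f t m + g t m) \<le> 2 * C + 2 * D" if "t \<in> S" "finite F" for F t
    using le[of F t] C[OF that] D[OF that] by linarith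
  then show ?thesis unfolding ubd_def by blast
qed

lemma ubd_scale:
  assumes "ubd S p f" shows "ubd S p (\<lambda>t m. r * f t m)"
proof -
  obtain C where C: "\<And>t F. t \<in> S \<Longrightarrow> finite F \<Longrightarrow> wsum F (\<lambda>m. wt m ^ p) (f t) \<le> C"
    using assms unfolding ubd_def by blast
  have "wsum F (\<lambda>m. wt m ^ p) (\<lambda>m. r * f t m) = (cmod r)\<^sup>2 * wsum F (\<lambda>m. wt m ^ p) (f t)" for F t
    by (simp add: wsum_def sum_distrib_left norm_mult power_mult_distrib mult_ac)
  then have "wsum F (\<lambda>m. wt m ^ p) (\<lambda>m. r * f t m) \<le> (cmod r)\<^sup>2 * C" if "t \<in> S" "finite F" for F t
    using C[OF that] by (simp add: mult_left_mono)
  then show ?thesis unfolding ubd_def by blast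
qed

lemma ubd_minus: "ubd S p f \<Longrightarrow> ubd S p (\<lambda>t m. - f t m)"
  using ubd_scale[of S p f "-1"] by simp

lemma ubd_diff: "ubd S p f \<Longrightarrow> ubd S p g \<Longrightarrow> ubd S p (\<lambda>t m. f t m - g t m)"
  using ubd_add[OF _ ubd_minus, of S p f g] by simp

lemma ubd_sum: "(\<And>i. i \<in> I \<Longrightarrow> ubd S p (f i)) \<Longrightarrow> ubd S p (\<lambda>t m. \<Sum>i\<in>I. f i t m)"
  by (induction I rule: infinite_finite_induct) (auto intro: ubd_zero ubd_add)

text \<open>Injectivity is asked only on the support of \<open>g\<close>: lowering an index is not
  injective at zero, where \<open>create\<close> vanishes.\<close>

lemma wsum_reindex_le:
  assumes F: "finite F" "inj_on h {m\<in>F. g m \<noteq> 0}"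
    and le: "\<And>m. m \<in> F \<Longrightarrow> g m \<noteq> 0 \<Longrightarrow> v m * (cmod (g m))\<^sup>2 \<le> c * (w (h m) * (cmod (f (h m)))\<^sup>2)"
    and C: "\<And>F. finite F \<Longrightarrow> wsum F w f \<le> C" and "0 \<le> c"
  shows "wsum F v g \<le> c * C"
proof -
  let ?F = "{m\<in>F. g m \<noteq> 0}"
  have "wsum F v g = (\<Sum>m\<in>?F. v m * (cmod (g m))\<^sup>2)"
    unfolding wsum_def by (rule sum.mono_neutral_right) (auto simp: F)
  also have "\<dots> \<le> (\<Sum>m\<in>?F. c * (w (h m) * (cmod (f (h m)))\<^sup>2))"
    by (intro sum_mono le) auto
  also have "\<dots> = c * wsum (h ` ?F) w f"
    unfolding wsum_def sum_distrib_left by (rule sum.reindex[OF F(2), unfolded o_def, symmetric])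
  also have "\<dots> \<le> c * C" using F(1) assms(5) by (intro mult_left_mono C) auto
  finally show ?thesis .
qed

lemma ubd_annihilate:
  assumes "ubd S (Suc p) f" shows "ubd S p (\<lambda>t. annihilate i (f t))"
proof -
  obtain C where C: "\<And>t F. t \<in> S \<Longrightarrow> finite F \<Longrightarrow> wsum F (\<lambda>m. wt m ^ Suc p) (f t) \<le> C"
    using assms unfolding ubd_def by blast
  have "wsum F (\<lambda>m. wt m ^ p) (annihilate i (f t)) \<le> 1 / l1 * C" if "t \<in> S" "finite F" for t F
  proof (rule wsum_reindex_le[where h = "\<lambda>m. m(i := Suc (m i))", OF that(2) _ _ C[OF that(1)]])
    show "inj_on (\<lambda>m. m(i := Suc (m i))) {m \<in> F. annihilate i (f t) m \<noteq> 0}"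
      by (rule inj_on_inverseI[where g = "\<lambda>m. m(i := m i - 1)"]) simp
    fix m
    let ?m = "m(i := Suc (m i))"
    have "wt m ^ p * (real (m i) + 1) \<le> wt ?m ^ p * (wt ?m / l1)"
      using mult_le_wt[of ?m i] l1_pos lam_pos[of i]
      by (intro mult_mono power_mono) (auto simp: field_simps wt_def eigval_raise)
    then have "wt m ^ p * (real (m i) + 1) * (cmod (f t ?m))\<^sup>2 \<le> wt ?m ^ p * (wt ?m / l1) * (cmod (f t ?m))\<^sup>2"
      by (intro mult_right_mono) auto
    moreover have "(cmod (annihilate i (f t) m))\<^sup>2 = (real (m i) + 1) * (cmod (f t ?m))\<^sup>2"
      by (simp add: annihilate_def norm_mult power_mult_distrib del: of_real_add)
    ultimately show "wt m ^ p * (cmod (annihilate i (f t) m))\<^sup>2 \<le>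
        1 / l1 * (wt ?m ^ Suc p * (cmod (f t ?m))\<^sup>2)"
      by (simp add: mult_ac)
  qed (use l1_pos in auto)
  then show ?thesis unfolding ubd_def by blast
qed

text \<open>Raising one occupation number at most doubles the weight, as
  \<open>lam i \<le> lam_sum\<close>; this yields \<open>2 ^ p\<close>. The summand 1 in
  \<open>1 / l1 + 1\<close> pays for \<open>m i\<close> exceeding the lowered occupation number by
  one.\<close>

lemma ubd_create:
  assumes "ubd S (Suc p) f" shows "ubd S p (\<lambda>t. create i (f t))"
proof -
  obtain C where C: "\<And>t F. t \<in> S \<Longrightarrow> finite F \<Longrightarrow> wsum F (\<lambda>m. wt m ^ Suc p) (f t) \<le> C"
    using assms unfolding ubd_def by blast
  have "wsum F (\<lambda>m. wt m ^ p) (create i (f t)) \<le> (2 ^ p * (1 / l1 + 1)) * C" if "t \<in> S" "finite F" for t F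
  proof (rule wsum_reindex_le[where h = "\<lambda>m. m(i := m i - 1)", OF that(2) _ _ C[OF that(1)]])
    show "inj_on (\<lambda>m. m(i := m i - 1)) {m \<in> F. create i (f t) m \<noteq> 0}"
      by (rule inj_on_inverseI[where g = "\<lambda>m. m(i := Suc (m i))"]) (auto simp: create_def split: if_splits)
    fix m assume "create i (f t) m \<noteq> 0"
    then have mi: "m i \<noteq> 0" by (auto simp: create_def split: if_splits)
    let ?m = "m(i := m i - 1)"
    have "lam i \<le> lam_sum" using lam_le_sum[of i] sum_lam_pos by (simp add: lam_sum_def)
    then have "lam i \<le> wt ?m" unfolding wt_def by (rule add_increasing[OF ev_nonneg])
    moreover have "wt m = wt ?m + lam i" unfolding wt_def eigval_lower[of m i lam, OF mi] by simp
    ultimately have a: "wt m \<le> 2 * wt ?m" by simp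
    have "real (m i) = real (?m i) + 1" using mi by simp
    also have "\<dots> \<le> wt ?m / l1 + wt ?m"
      using mult_le_wt[of ?m i] l1_pos wt_ge1[of ?m] by (intro add_mono) (auto simp: field_simps)
    finally have b: "real (m i) \<le> (1 / l1 + 1) * wt ?m" by (simp add: algebra_simps)
    have "wt m ^ p * real (m i) \<le> (2 * wt ?m) ^ p * ((1 / l1 + 1) * wt ?m)"
      by (intro mult_mono power_mono a b) auto
    then have "wt m ^ p * real (m i) * (cmod (f t ?m))\<^sup>2 \<le>
        (2 * wt ?m) ^ p * ((1 / l1 + 1) * wt ?m) * (cmod (f t ?m))\<^sup>2"
      by (intro mult_right_mono) auto
    moreover have "(cmod (create i (f t) m))\<^sup>2 = real (m i) * (cmod (f t ?m))\<^sup>2"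
      using mi by (simp add: create_def norm_mult power_mult_distrib)
    ultimately show "wt m ^ p * (cmod (create i (f t) m))\<^sup>2 \<le>
        (2 ^ p * (1 / l1 + 1)) * (wt ?m ^ Suc p * (cmod (f t ?m))\<^sup>2)"
      by (simp only: power_mult_distrib power_Suc mult_ac)
  qed (use l1_pos in auto)
  then show ?thesis unfolding ubd_def by blast
qed

text \<open>Each ladder operator costs one power of the weight, and \<open>C\<close> contains three
  of them.\<close>

lemma ubd_K:
  assumes "ubd S (Suc (Suc (Suc p))) f" shows "ubd S p (\<lambda>t. K_op q lam b c (f t))"
proof -
  have f2: "ubd S (Suc (Suc p)) f" using assms by (rule ubd_mono) simp
  show ?thesis
    unfolding K_op_def[abs_def] A_op_def B_op_def C_op_def
    by (intro ubd_add ubd_minus ubd_sum ubd_scale ubd_diff ubd_create ubd_annihilate assms f2)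
qed

end

section \<open>The limit of the regularized solutions\<close>

locale flow_start = flow_coeffs lam l1 q J s b c
  for lam :: "'n::finite \<Rightarrow> real" and l1 q J s b c +
  fixes \<psi>0 :: "'n fock"
  assumes start_fock0: "\<psi>0 \<in> fock0" and start_moment: "moment lam 8 \<psi>0 < \<infinity>"
begin

abbreviation R :: "real \<Rightarrow> real \<Rightarrow> ('n \<Rightarrow> nat) \<Rightarrow> complex" where
  "R k t \<equiv> reg_coef q lam b c k \<psi>0 t"

lemma R_solves: "solves k (R k)"
  by (rule reg_coef_solves[OF start_fock0])

lemma R_outside: "m \<notin> L k \<Longrightarrow> R k t m = of_real (exp (- (ev m * t))) * coef \<psi>0 m"
  by (simp add: reg_coef_alt cutoff_set_def lev_def)

lemma R_vacuum: "R k t (\<lambda>_. 0) = 0"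
  using R_solves by (simp add: solves_def)

text \<open>On the vacuum the coefficient is zero; elsewhere \<open>ev m \<ge> l1\<close> makes the
  shifted weight at most a multiple of the eigenvalue.\<close>

lemma start_bound: "\<exists>C. \<forall>F. finite F \<longrightarrow> wsum F (\<lambda>m. wt m ^ 8) (coef \<psi>0) \<le> C"
proof (intro exI allI impI)
  let ?c = "(1 + lam_sum / l1) ^ 8"
  fix F :: "('n \<Rightarrow> nat) set" assume F: "finite F"
  have c0: "0 \<le> 1 + lam_sum / l1" using l1_pos by (simp add: add_nonneg_nonneg)
  have "wsum F (\<lambda>m. wt m ^ 8) (coef \<psi>0) \<le> (\<Sum>m\<in>F. ?c * (ev m ^ 8 * (cmod (coef \<psi>0 m))\<^sup>2))"
    unfolding wsum_def
  proof (rule sum_mono)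
    fix m
    show "wt m ^ 8 * (cmod (coef \<psi>0 m))\<^sup>2 \<le> ?c * (ev m ^ 8 * (cmod (coef \<psi>0 m))\<^sup>2)"
    proof (cases "m = (\<lambda>_. 0)")
      case True
      then show ?thesis using start_fock0 by (simp add: fock0_def)
    next
      case False
      have "lam_sum * l1 \<le> lam_sum * ev m" by (intro mult_left_mono ev_ge[OF False]) simp
      then have "wt m \<le> (1 + lam_sum / l1) * ev m"
        using l1_pos by (simp add: wt_def field_simps)
      then have "wt m ^ 8 \<le> ((1 + lam_sum / l1) * ev m) ^ 8" by (intro power_mono) auto
      then have "wt m ^ 8 * (cmod (coef \<psi>0 m))\<^sup>2 \<le> ((1 + lam_sum / l1) * ev m) ^ 8 * (cmod (coef \<psi>0 m))\<^sup>2"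
        by (intro mult_right_mono) auto
      then show ?thesis by (simp add: power_mult_distrib mult.assoc)
    qed
  qed
  also have "\<dots> = ?c * wsum F (\<lambda>m. ev m ^ 8) (coef \<psi>0)"
    by (simp add: wsum_def sum_distrib_left)
  also have "\<dots> \<le> ?c * enn2real (moment lam 8 \<psi>0)"
    by (intro mult_left_mono wsum_le_moment F start_moment zero_le_power c0)
  finally show "wsum F (\<lambda>m. wt m ^ 8) (coef \<psi>0) \<le> ?c * enn2real (moment lam 8 \<psi>0)" .
qed

lemma ev_power_le_wt: "p \<le> r \<Longrightarrow> ev m ^ p \<le> wt m ^ r"
proof -
  assume "p \<le> r"
  have "ev m ^ p \<le> wt m ^ p" by (intro power_mono) (auto simp: wt_def)
  also have "\<dots> \<le> wt m ^ r" by (intro power_increasing wt_ge1 \<open>p \<le> r\<close>)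
  finally show ?thesis .
qed

lemma moment1_finite: "moment lam 1 \<psi>0 < \<infinity>"
proof -
  obtain C where C: "\<And>F. finite F \<Longrightarrow> wsum F (\<lambda>m. wt m ^ 8) (coef \<psi>0) \<le> C" using start_bound by blast
  have "moment lam 1 \<psi>0 \<le> ennreal C"
    by (rule moment_le, rule order_trans[OF wsum_mono C]) (rule ev_power_le_wt, auto)
  also have "\<dots> < \<infinity>" by simp
  finally show ?thesis .
qed

definition E0 :: real where
  "E0 = enn2real (moment lam 1 \<psi>0) + \<kappa> * (norm \<psi>0)\<^sup>2"

lemma E0_nonneg: "0 \<le> E0"
  using \<kappa>_nonneg by (simp add: E0_def)

lemma En_start_le: "En l (coef \<psi>0) \<le> E0"
  unfolding En_def E0_def A1_def
  using wsum_le_moment[OF finite_L moment1_finite, of l] \<kappa>_nonneg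
  by (intro add_mono mult_left_mono wsum_le_norm) auto

definition \<eta> :: "real \<Rightarrow> real" where
  "\<eta> k = 6 * \<gamma> / sqrt k * E0"

lemma \<eta>_tendsto: "(\<lambda>n. \<eta> (real n)) \<longlonglongrightarrow> 0"
proof -
  have "filterlim (\<lambda>n. sqrt (real n)) at_top sequentially"
    by (rule filterlim_compose[OF sqrt_at_top filterlim_real_sequentially])
  then have "(\<lambda>n. (6 * \<gamma> * E0) / sqrt (real n)) \<longlonglongrightarrow> 0"
    by (intro tendsto_divide_0[OF tendsto_const] filterlim_at_top_imp_at_infinity)
  then show ?thesis by (simp add: \<eta>_def)
qed

lemma R_distance:
  assumes "0 < k" "k \<le> l" "0 \<le> t" "finite F"
  shows "wsum F (\<lambda>_. 1) (\<lambda>m. R k t m - R l t m) \<le> \<eta> k"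
proof -
  \<comment> \<open>Outside the larger level set both solutions are the same decaying coefficient,
    so the distance is a sum over a finite set.\<close>
  have out: "R k t m = R l t m" if "m \<notin> L l" for m
    using that assms(2) by (simp add: R_outside lev_def)
  have "wsum F (\<lambda>_. 1) (\<lambda>m. R k t m - R l t m) \<le> wsum (F \<union> L l) (\<lambda>_. 1) (\<lambda>m. R k t m - R l t m)"
    using assms by (intro wsum_mono_set) auto
  also have "\<dots> = wsum (L l) (\<lambda>_. 1) (\<lambda>m. R k t m - R l t m)"
    unfolding wsum_def using assms(4) by (intro sum.mono_neutral_right) (auto simp: out)
  also have "\<dots> \<le> 6 * \<gamma> / sqrt k * En l (R k 0)"
    by (rule distance_bound[OF R_solves R_solves _ assms(1-3)]) (simp add: reg_coef_0)
  also have "\<dots> \<le> \<eta> k"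
    unfolding reg_coef_0 \<eta>_def using \<gamma>_nonneg assms(1) by (intro mult_left_mono En_start_le) auto
  finally show ?thesis .
qed

lemma wsum_singleton_le: "wsum {m} (\<lambda>_. 1) f \<le> x \<Longrightarrow> cmod (f m) \<le> sqrt x"
  by (simp add: wsum_def real_le_rsqrt)

text \<open>For negative \<open>t\<close> nothing guarantees convergence and the value is
  unspecified; later statements about it assume \<open>0 \<le> t\<close>.\<close>

definition \<Psi> :: "real \<Rightarrow> ('n \<Rightarrow> nat) \<Rightarrow> complex" where
  "\<Psi> t m = lim (\<lambda>n. R (real n) t m)"

lemma \<Psi>_lim:
  assumes "0 \<le> t" shows "(\<lambda>n. R (real n) t m) \<longlonglongrightarrow> \<Psi> t m"
proof -
  have "Cauchy (\<lambda>n. R (real n) t m)"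
  proof (rule CauchyI)
    fix e :: real assume e: "0 < e"
    have "(\<lambda>n. sqrt (\<eta> (real n))) \<longlonglongrightarrow> sqrt 0" by (intro tendsto_real_sqrt \<eta>_tendsto)
    then have "\<forall>\<^sub>F n in sequentially. sqrt (\<eta> (real n)) < e / 2 \<and> n > 0"
      using order_tendstoD(2)[of _ "sqrt 0" sequentially "e / 2"] e eventually_gt_at_top
      by (intro eventually_conj) auto
    then obtain N where N: "sqrt (\<eta> (real N)) < e / 2" "N > 0"
      unfolding eventually_sequentially by blast
    have *: "cmod (R (real N) t m - R (real n) t m) < e / 2" if "n \<ge> N" for n
      using wsum_singleton_le[OF R_distance[of "real N" "real n" t "{m}"]] N that assms by simp
    show "\<exists>M. \<forall>i\<ge>M. \<forall>n\<ge>M. norm (R (real i) t m - R (real n) t m) < e"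
    proof (intro exI allI impI)
      fix i n assume "N \<le> i" "N \<le> n"
      have "norm (R (real i) t m - R (real n) t m) =
          norm ((R (real N) t m - R (real n) t m) - (R (real N) t m - R (real i) t m))" by simp
      also have "\<dots> \<le> norm (R (real N) t m - R (real n) t m) + norm (R (real N) t m - R (real i) t m)"
        by (rule norm_triangle_ineq4)
      also have "\<dots> < e" using *[OF \<open>N \<le> i\<close>] *[OF \<open>N \<le> n\<close>] by simp
      finally show "norm (R (real i) t m - R (real n) t m) < e" .
    qed
  qed
  then show ?thesis unfolding \<Psi>_def using Cauchy_convergent convergent_LIMSEQ_iff by blast
qed

lemma \<Psi>_start: "\<Psi> 0 = coef \<psi>0"
  using \<Psi>_lim[of 0] by (auto simp: reg_coef_0 fun_eq_iff LIMSEQ_const_iff)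

lemma \<Psi>_vacuum: "0 \<le> t \<Longrightarrow> \<Psi> t (\<lambda>_. 0) = 0"
  using \<Psi>_lim[of t "\<lambda>_. 0"] by (simp add: R_vacuum LIMSEQ_const_iff)

text \<open>The larger cutoff tends to infinity on a fixed finite set, while the bound depends on
  the smaller one only.\<close>

lemma \<Psi>_distance:
  assumes "0 < k" "0 \<le> t" "finite F"
  shows "wsum F (\<lambda>_. 1) (\<lambda>m. R k t m - \<Psi> t m) \<le> \<eta> k"
proof (rule LIMSEQ_le_const2)
  show "(\<lambda>n. wsum F (\<lambda>_. 1) (\<lambda>m. R k t m - R (real n) t m)) \<longlonglongrightarrow>
      wsum F (\<lambda>_. 1) (\<lambda>m. R k t m - \<Psi> t m)"
    unfolding wsum_def by (intro tendsto_intros \<Psi>_lim assms)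
  show "\<exists>N. \<forall>n\<ge>N. wsum F (\<lambda>_. 1) (\<lambda>m. R k t m - R (real n) t m) \<le> \<eta> k"
  proof (intro exI[of _ "nat \<lceil>k\<rceil>"] allI impI R_distance assms)
    fix n assume "nat \<lceil>k\<rceil> \<le> n"
    then show "k \<le> real n" by linarith
  qed
qed

lemma \<Psi>_distance_pointwise:
  assumes "0 < k" "0 \<le> t"
  shows "cmod (R k t m - \<Psi> t m) \<le> sqrt (\<eta> k)"
  using wsum_singleton_le[OF \<Psi>_distance[OF assms, of "{m}"]] by simp

text \<open>Inside \<open>L k\<close> the growth rate is independent of the cutoff; outside,
  coefficients only decay. Hence the bound is uniform in \<open>k\<close>.\<close>

lemma R_weighted_bound:
  "\<exists>C. \<forall>k t F. 0 \<le> t \<longrightarrow> t \<le> T \<longrightarrow> finite F \<longrightarrow> wsum F (\<lambda>m. wt m ^ 8) (R k t) \<le> C"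
proof -
  have eq: "Suc 7 = 8" by simp
  obtain a where a: "0 \<le> a" "\<And>k u t. solves k u \<Longrightarrow> 0 \<le> t \<Longrightarrow>
     wsum (L k) (\<lambda>m. wt m ^ 8) (u t) \<le> exp (a * t) * wsum (L k) (\<lambda>m. wt m ^ 8) (u 0)"
    using weighted_moment_growth[of 7, unfolded eq] by blast
  obtain C where C: "\<And>F. finite F \<Longrightarrow> wsum F (\<lambda>m. wt m ^ 8) (coef \<psi>0) \<le> C" using start_bound by blast
  have "wsum F (\<lambda>m. wt m ^ 8) (R k t) \<le> exp (a * T) * C + C"
    if t: "0 \<le> t" "t \<le> T" and F: "finite F" for k t F
  proof -
    have "wsum F (\<lambda>m. wt m ^ 8) (R k t) \<le> wsum (L k \<union> (F - L k)) (\<lambda>m. wt m ^ 8) (R k t)"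
      using F by (intro wsum_mono_set) auto
    also have "\<dots> = wsum (L k) (\<lambda>m. wt m ^ 8) (R k t) + wsum (F - L k) (\<lambda>m. wt m ^ 8) (R k t)"
      unfolding wsum_def using F by (intro sum.union_disjoint) auto
    also have "wsum (L k) (\<lambda>m. wt m ^ 8) (R k t) \<le> exp (a * t) * C"
      using a(2)[OF R_solves t(1)] C[OF finite_L] unfolding reg_coef_0
      by (meson exp_ge_zero mult_left_mono order_trans)
    \<comment> \<open>\<open>C\<close> is nonnegative because it bounds the empty sum.\<close>
    also have "exp (a * t) * C \<le> exp (a * T) * C"
      using t a(1) C[of "{}"] by (intro mult_right_mono) (auto simp: mult_left_mono wsum_def)
    also have "wsum (F - L k) (\<lambda>m. wt m ^ 8) (R k t) \<le> wsum (F - L k) (\<lambda>m. wt m ^ 8) (coef \<psi>0)"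
      unfolding wsum_def
    proof (intro sum_mono mult_left_mono power_mono)
      fix m assume m: "m \<in> F - L k"
      have "exp (- (ev m * t)) \<le> 1" using t by simp
      then show "cmod (R k t m) \<le> cmod (coef \<psi>0 m)"
        using m by (simp add: R_outside norm_mult mult_left_le_one_le)
    qed auto
    also have "\<dots> \<le> C" using F by (intro C) auto
    finally show ?thesis by simp
  qed
  then show ?thesis by blast
qed

lemma \<Psi>_ubd: "ubd {0..T} 8 \<Psi>"
proof -
  obtain C where C: "\<And>k t F. 0 \<le> t \<Longrightarrow> t \<le> T \<Longrightarrow> finite F \<Longrightarrow> wsum F (\<lambda>m. wt m ^ 8) (R k t) \<le> C"
    using R_weighted_bound[of T] by blast
  have "wsum F (\<lambda>m. wt m ^ 8) (\<Psi> t) \<le> C" if "t \<in> {0..T}" "finite F" for t F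
  proof (rule LIMSEQ_le_const2)
    show "(\<lambda>n. wsum F (\<lambda>m. wt m ^ 8) (R (real n) t)) \<longlonglongrightarrow> wsum F (\<lambda>m. wt m ^ 8) (\<Psi> t)"
      unfolding wsum_def using that by (intro tendsto_intros \<Psi>_lim) auto
    show "\<exists>N. \<forall>n\<ge>N. wsum F (\<lambda>m. wt m ^ 8) (R (real n) t) \<le> C"
      using C that by auto
  qed
  then show ?thesis unfolding ubd_def by blast
qed

lemma K_vacuum: "K f (\<lambda>_. 0) = 0"
  by (simp add: K_op_def A_op_def B_op_def C_op_def create_def)

text \<open>A row of \<open>K\<close> reads finitely many coefficients, so cutoffs above their
  levels leave it unchanged; the threshold depends on the row but not on time.\<close>

lemma eventually_cut_eq_K:
  "\<forall>\<^sub>F n in sequentially. \<forall>t. - of_real (ev m) * R (real n) t m +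
     cutoff lam (real n) (M (cutoff lam (real n) (R (real n) t))) m = K (R (real n) t) m"
proof -
  obtain D where D: "finite D" "\<forall>f g. (\<forall>m\<in>D. f m = g m) \<longrightarrow> K f m = K g m"
    using fin_lin_support[OF fin_lin_K[of q lam b c m]] by (elim exE conjE) (rule that)
  have "\<forall>\<^sub>F n in sequentially. \<forall>m'\<in>insert m D. ev m' \<le> real n"
    using D(1) by (intro eventually_ball_finite ballI)
      (auto intro: filterlim_at_top[THEN iffD1, rule_format, OF filterlim_real_sequentially])
  then show ?thesis
  proof eventually_elim
    case (elim n)
    show ?case
    proof
      fix t
      let ?k = "real n"
      let ?f = "cutoff lam ?k (R ?k t)"
      have f: "?f m' = R ?k t m'" if "m' \<in> insert m D" for m'
        using elim that by (intro cutoff_eq R_vacuum) (auto simp: lev_def)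
      have "K (R ?k t) m = K ?f m" using f D(2) by auto
      also have "\<dots> = - of_real (ev m) * R ?k t m + M ?f m" using f by (simp add: K_alt)
      finally have eq: "K (R ?k t) m = - of_real (ev m) * R ?k t m + M ?f m" .
      show "- of_real (ev m) * R ?k t m + cutoff lam ?k (M ?f) m = K (R ?k t) m"
      \<comment> \<open>The vacuum is in no cutoff set, but the vacuum row of \<open>K\<close> is
        zero anyway.\<close>
      proof (cases "m = (\<lambda>_. 0)")
        case True
        then show ?thesis by (simp add: K_vacuum cutoff_def cutoff_set_def)
      next
        case False
        then have "m \<in> cutoff_set lam ?k" using elim by (simp add: cutoff_set_def)
        then show ?thesis unfolding eq by (simp add: cutoff_def)
      qed
    qed
  qed
qed

text \<open>Differentiating a limit needs derivatives that converge uniformly in time. They do,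
  because \<eta> does not involve time and a row of \<open>K\<close> is bounded in the supremum
  norm.\<close>

lemma \<Psi>_derivative:
  assumes "0 \<le> t"
  shows "((\<lambda>t. \<Psi> t m) has_vector_derivative K (\<Psi> t) m) (at t within {0..})"
proof -
  let ?D = "\<lambda>n t. - of_real (ev m) * R (real n) t m +
     cutoff lam (real n) (M (cutoff lam (real n) (R (real n) t))) m"
  have "\<exists>g. \<forall>x\<in>{0..}. (\<lambda>n. R (real n) x m) \<longlonglongrightarrow> g x \<and>
      (g has_derivative (\<lambda>h. h *\<^sub>R K (\<Psi> x) m)) (at x within {0..})"
  proof (rule has_derivative_sequence[where f' = "\<lambda>n x h. h *\<^sub>R ?D n x"])
    show "convex {0::real..}" by simp
    show "((\<lambda>t. R (real n) t m) has_derivative (\<lambda>h. h *\<^sub>R ?D n x)) (at x within {0..})" for n x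
      using R_solves[of "real n"] unfolding solves_def has_vector_derivative_def
      by (blast intro: has_derivative_at_withinI)
    show "(0::real) \<in> {0..}" by simp
    show "(\<lambda>n. R (real n) 0 m) \<longlonglongrightarrow> \<Psi> 0 m" by (rule \<Psi>_lim) simp
    fix e :: real assume e: "0 < e"
    obtain C where C: "0 \<le> C" "\<forall>f X. (\<forall>m. cmod (f m) \<le> X) \<longrightarrow> cmod (K f m) \<le> C * X"
      using fin_lin_bounded[OF fin_lin_K[of q lam b c m]] by (elim exE conjE) (rule that)
    have "(\<lambda>n. C * sqrt (\<eta> (real n))) \<longlonglongrightarrow> C * sqrt 0"
      by (intro tendsto_mult tendsto_const tendsto_real_sqrt \<eta>_tendsto)
    then have small: "\<forall>\<^sub>F n in sequentially. C * sqrt (\<eta> (real n)) < e"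
      by (rule order_tendstoD) (use e in simp)
    show "\<forall>\<^sub>F n in sequentially. \<forall>x\<in>{0..}. \<forall>h. norm (h *\<^sub>R ?D n x - h *\<^sub>R K (\<Psi> x) m) \<le> e * norm h"
      using small eventually_cut_eq_K[of m] eventually_gt_at_top[of 0]
    proof eventually_elim
      case (elim n)
      show ?case
      proof (intro ballI allI)
        fix x h :: real assume x: "x \<in> {0..}"
        have "?D n x - K (\<Psi> x) m = K (\<lambda>m. R (real n) x m - \<Psi> x m) m"
          using elim(2) by (simp add: fin_lin_apply_diff[OF fin_lin_K])
        also have "cmod \<dots> \<le> C * sqrt (\<eta> (real n))"
          using elim(3) x by (intro C(2)[rule_format] \<Psi>_distance_pointwise) auto
        also have "\<dots> \<le> e" using elim(1) by simp
        finally have "norm (?D n x - K (\<Psi> x) m) \<le> e" .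
        then have "\<bar>h\<bar> * norm (?D n x - K (\<Psi> x) m) \<le> \<bar>h\<bar> * e" by (intro mult_left_mono) auto
        moreover have "norm (h *\<^sub>R ?D n x - h *\<^sub>R K (\<Psi> x) m) = \<bar>h\<bar> * norm (?D n x - K (\<Psi> x) m)"
          unfolding scaleR_diff_right[symmetric] norm_scaleR ..
        ultimately show "norm (h *\<^sub>R ?D n x - h *\<^sub>R K (\<Psi> x) m) \<le> e * norm h"
          by (simp only: real_norm_def mult.commute)
      qed
    qed
  qed
  then obtain g where g: "\<And>x. 0 \<le> x \<Longrightarrow> (\<lambda>n. R (real n) x m) \<longlonglongrightarrow> g x"
    "\<And>x. 0 \<le> x \<Longrightarrow> (g has_derivative (\<lambda>h. h *\<^sub>R K (\<Psi> x) m)) (at x within {0..})"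
    by auto
  have "\<Psi> x m = g x" if "0 \<le> x" for x
    by (rule LIMSEQ_unique[OF \<Psi>_lim[OF that] g(1)[OF that]])
  then show ?thesis
    unfolding has_vector_derivative_def using assms
    by (intro has_derivative_transform[OF _ _ g(2)]) auto
qed

text \<open>Testing against the remainder itself reduces Taylor's theorem to scalar functions.\<close>

lemma \<Psi>_taylor:
  assumes t: "0 \<le> t"
  shows "\<exists>C\<ge>0. \<forall>\<delta> F. - t \<le> \<delta> \<longrightarrow> \<delta> \<le> 1 \<longrightarrow> finite F \<longrightarrow>
    wsum F (\<lambda>_. 1) (\<lambda>m. \<Psi> (t + \<delta>) m - \<Psi> t m - of_real \<delta> * K (\<Psi> t) m) \<le> C * \<delta> ^ 4"
proof -
  let ?S = "{0..t + 1}"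
  \<comment> \<open>Two applications of \<open>K\<close> cost three powers of the weight each. The
    interval ends at \<open>t + 1\<close> because \<delta> is at most 1.\<close>
  have "ubd ?S (Suc (Suc (Suc (Suc (Suc (Suc 0)))))) \<Psi>" by (rule ubd_mono[OF \<Psi>_ubd]) simp
  then have "ubd ?S 0 (\<lambda>t. K (K (\<Psi> t)))" by (intro ubd_K)
  then obtain C where C: "\<And>t F. t \<in> ?S \<Longrightarrow> finite F \<Longrightarrow> wsum F (\<lambda>_. 1) (K (K (\<Psi> t))) \<le> C"
    unfolding ubd_def power_0 by blast
  have C0: "0 \<le> C" using C[of t "{}"] t by (simp add: wsum_def)
  have "wsum F (\<lambda>_. 1) (\<lambda>m. \<Psi> (t + \<delta>) m - \<Psi> t m - of_real \<delta> * K (\<Psi> t) m) \<le> C * \<delta> ^ 4"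
    if \<delta>: "- t \<le> \<delta>" "\<delta> \<le> 1" and F: "finite F" for \<delta> F
  proof (cases "\<delta> = 0")
    case False
    define r where "r = (\<lambda>m. \<Psi> (t + \<delta>) m - \<Psi> t m - of_real \<delta> * K (\<Psi> t) m)"
    define \<rho> where "\<rho> = wsum F (\<lambda>_. 1) r"
    \<comment> \<open>Young's inequality with parameter \<open>1 / \<delta>\<^sup>2\<close>:
      multiplied by \<open>\<delta>\<^sup>2\<close>, the \<rho> term becomes
      \<open>\<rho> / 2\<close>, which moves to the left and leaves
      \<open>C * \<delta> ^ 4\<close>.\<close>
    define B where "B = (1 / \<delta>\<^sup>2 * \<rho> + C / (1 / \<delta>\<^sup>2)) / 2"
    define f where "f i x = ip F r ((K ^^ i) (\<Psi> x))" for i x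
    have deriv: "((\<lambda>x. (K ^^ i) (\<Psi> x) m) has_vector_derivative (K ^^ Suc i) (\<Psi> x) m) (at x within {0..})"
      if "0 \<le> x" for i x m
      using that
    proof (induction i arbitrary: m)
      case 0
      then show ?case using \<Psi>_derivative by simp
    next
      case (Suc i)
      then show ?case
        using fin_lin_vector_derivative[OF fin_lin_K, of "\<lambda>x. (K ^^ i) (\<Psi> x)" "(K ^^ Suc i) (\<Psi> x)" x "{0..}"]
        by simp
    qed
    have "norm (f 0 (t + \<delta>) - (\<Sum>i\<le>1. f i t * (t + \<delta> - t) ^ i / fact i)) \<le>
        B * norm (t + \<delta> - t) ^ Suc 1 / fact 1"
    proof (rule field_Taylor)
      show "convex ?S" by simp
      show "t \<in> ?S" "t + \<delta> \<in> ?S" using t \<delta> by auto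
      fix i x assume x: "x \<in> ?S"
      have "((\<lambda>x. \<Sum>m\<in>F. inner (r m) ((K ^^ i) (\<Psi> x) m)) has_real_derivative
          (\<Sum>m\<in>F. inner (r m) ((K ^^ Suc i) (\<Psi> x) m))) (at x within {0..})"
      proof (rule DERIV_sum)
        fix m
        have "((\<lambda>x. (K ^^ i) (\<Psi> x) m) has_derivative (\<lambda>h. h *\<^sub>R (K ^^ Suc i) (\<Psi> x) m)) (at x within {0..})"
          using deriv[of x i m] x by (simp add: has_vector_derivative_def)
        from has_derivative_inner_right[OF this, of "r m"]
        show "((\<lambda>x. inner (r m) ((K ^^ i) (\<Psi> x) m)) has_real_derivative
          inner (r m) ((K ^^ Suc i) (\<Psi> x) m)) (at x within {0..})"
          by (simp add: has_field_derivative_def mult.commute[of _ "inner _ _"])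
      qed
      then show "(f i has_field_derivative f (Suc i) x) (at x within ?S)"
        unfolding f_def[abs_def] ip_def by (rule DERIV_subset) auto
      have "\<bar>ip F r (K (K (\<Psi> x)))\<bar> \<le> (1 / \<delta>\<^sup>2 * \<rho> + wsum F (\<lambda>_. 1) (K (K (\<Psi> x))) / (1 / \<delta>\<^sup>2)) / 2"
        unfolding \<rho>_def using False by (intro ip_le) simp
      also have "\<dots> \<le> B"
        unfolding B_def by (intro divide_right_mono add_left_mono C x F) auto
      finally show "norm (f (Suc 1) x) \<le> B" by (simp add: f_def)
    qed
    moreover have "f 0 (t + \<delta>) - (\<Sum>i\<le>1. f i t * (t + \<delta> - t) ^ i / fact i) = \<rho>"
    proof -
      have "\<rho> = ip F r (\<lambda>m. \<Psi> (t + \<delta>) m - \<Psi> t m - of_real \<delta> * K (\<Psi> t) m)"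
        unfolding \<rho>_def ip_self[symmetric] by (simp add: r_def)
      also have "\<dots> = ip F r (\<Psi> (t + \<delta>)) - ip F r (\<Psi> t) - \<delta> * ip F r (K (\<Psi> t))"
        unfolding ip_diff_right ip_scale_right ..
      finally show ?thesis by (simp add: f_def)
    qed
    ultimately have "\<bar>\<rho>\<bar> \<le> B * \<bar>\<delta>\<bar>\<^sup>2" by (simp add: power2_eq_square)
    then have "\<rho> \<le> B * \<delta>\<^sup>2" by simp
    also have "B * \<delta>\<^sup>2 = \<rho> / 2 + C * \<delta> ^ 4 / 2"
      using False by (simp add: B_def field_simps)
    finally show ?thesis by (simp add: \<rho>_def r_def)
  qed (simp add: wsum_def)
  then show ?thesis using C0 by blast
qed

end

section \<open>The limit as a curve in Fock space\<close>

context flow_start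
begin

definition \<psi> :: "real \<Rightarrow> 'n fock" where
  "\<psi> t = Abs_ell2 (\<Psi> t)"

lemma coef_\<psi>:
  assumes "0 \<le> t" shows "coef (\<psi> t) = \<Psi> t"
proof -
  have "ubd {0..t} 0 \<Psi>" by (rule ubd_mono[OF \<Psi>_ubd]) simp
  then obtain C where "\<And>F. finite F \<Longrightarrow> wsum F (\<lambda>_. 1) (\<Psi> t) \<le> C"
    unfolding ubd_def power_0 using assms by (meson atLeastAtMost_iff order_refl)
  then show ?thesis unfolding \<psi>_def by (intro coef_Abs square_summable_wsum)
qed

definition \<phi> :: "real \<Rightarrow> 'n fock" where
  "\<phi> t = Abs_ell2 (K (\<Psi> t))"

lemma coef_\<phi>:
  assumes "0 \<le> t" shows "coef (\<phi> t) = K (\<Psi> t)"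
proof -
  have "ubd {0..t} (Suc (Suc (Suc 0))) \<Psi>" by (rule ubd_mono[OF \<Psi>_ubd]) simp
  then have "ubd {0..t} 0 (\<lambda>t. K (\<Psi> t))" by (rule ubd_K)
  then obtain C where "\<And>F. finite F \<Longrightarrow> wsum F (\<lambda>_. 1) (K (\<Psi> t)) \<le> C"
    unfolding ubd_def power_0 using assms by (meson atLeastAtMost_iff order_refl)
  then show ?thesis unfolding \<phi>_def by (intro coef_Abs square_summable_wsum)
qed

lemma \<psi>_start: "\<psi> 0 = \<psi>0"
  by (simp add: \<psi>_def \<Psi>_start coef_inverse)

lemma \<psi>_moment:
  assumes "0 \<le> t" shows "moment lam 3 (\<psi> t) < \<infinity>"
proof -
  obtain C where C: "\<And>F. finite F \<Longrightarrow> wsum F (\<lambda>m. wt m ^ 8) (\<Psi> t) \<le> C"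
    using \<Psi>_ubd[of t] unfolding ubd_def using assms by (meson atLeastAtMost_iff order_refl)
  have "moment lam 3 (\<psi> t) \<le> ennreal C"
  proof (rule moment_le)
    fix F :: "('n \<Rightarrow> nat) set" assume F: "finite F"
    show "wsum F (\<lambda>m. ev m ^ 3) (coef (\<psi> t)) \<le> C"
      unfolding coef_\<psi>[OF assms]
      by (rule order_trans[OF wsum_mono C[OF F]]) (rule ev_power_le_wt, simp)
  qed
  also have "\<dots> < \<infinity>" by simp
  finally show ?thesis .
qed

lemma \<psi>_remainder:
  assumes "0 \<le> t"
  shows "\<exists>B\<ge>0. \<forall>\<delta>. - t \<le> \<delta> \<longrightarrow> \<delta> \<le> 1 \<longrightarrow> norm (\<psi> (t + \<delta>) - \<psi> t - \<delta> *\<^sub>R \<phi> t) \<le> B * \<delta>\<^sup>2"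
proof -
  obtain C where C: "0 \<le> C" "\<And>\<delta> F. - t \<le> \<delta> \<Longrightarrow> \<delta> \<le> 1 \<Longrightarrow> finite F \<Longrightarrow>
    wsum F (\<lambda>_. 1) (\<lambda>m. \<Psi> (t + \<delta>) m - \<Psi> t m - of_real \<delta> * K (\<Psi> t) m) \<le> C * \<delta> ^ 4"
    using \<Psi>_taylor[OF assms] by blast
  have "norm (\<psi> (t + \<delta>) - \<psi> t - \<delta> *\<^sub>R \<phi> t) \<le> sqrt C * \<delta>\<^sup>2" if "- t \<le> \<delta>" "\<delta> \<le> 1" for \<delta>
  proof -
    have "(norm (\<psi> (t + \<delta>) - \<psi> t - \<delta> *\<^sub>R \<phi> t))\<^sup>2 \<le> C * \<delta> ^ 4"
    proof (rule norm_ell2_le)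
      fix F :: "('n \<Rightarrow> nat) set" assume "finite F"
      then show "wsum F (\<lambda>_. 1) (coef (\<psi> (t + \<delta>) - \<psi> t - \<delta> *\<^sub>R \<phi> t)) \<le> C * \<delta> ^ 4"
        using C(2)[OF that] assms that by (simp add: coef_simps coef_\<psi> coef_\<phi>)
    qed
    also have "\<dots> = (sqrt C * \<delta>\<^sup>2)\<^sup>2" using C(1) by (simp add: power_mult_distrib)
    finally show ?thesis by (rule power2_le_imp_le) (use C(1) in simp)
  qed
  then show ?thesis using C(1) by (intro exI[of _ "sqrt C"]) auto
qed

lemma \<psi>_has_vector_derivative:
  assumes "0 \<le> t" shows "(\<psi> has_vector_derivative \<phi> t) (at t within {0..})"
proof -
  obtain B where B: "0 \<le> B" "\<And>\<delta>. - t \<le> \<delta> \<Longrightarrow> \<delta> \<le> 1 \<Longrightarrow>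
      norm (\<psi> (t + \<delta>) - \<psi> t - \<delta> *\<^sub>R \<phi> t) \<le> B * \<delta>\<^sup>2"
    using \<psi>_remainder[OF assms] by blast
  have "\<exists>d>0. \<forall>y\<in>{0..}. norm (y - t) < d \<longrightarrow>
      norm (\<psi> y - \<psi> t - (y - t) *\<^sub>R \<phi> t) \<le> e * norm (y - t)" if "0 < e" for e
  \<comment> \<open>The 1 keeps the increment in the range of the remainder bound;
    \<open>B + 1\<close> avoids division by zero.\<close>
  proof (intro exI[of _ "min 1 (e / (B + 1))"] conjI ballI impI)
    show "0 < min 1 (e / (B + 1))" using B(1) that by simp
    fix y :: real assume y: "y \<in> {0..}" "norm (y - t) < min 1 (e / (B + 1))"
    then have *: "\<bar>y - t\<bar> * (B + 1) \<le> e" using B(1) by (simp add: field_simps)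
    have "norm (\<psi> y - \<psi> t - (y - t) *\<^sub>R \<phi> t) \<le> B * (y - t)\<^sup>2"
    proof -
      have "y - t \<le> 1" using y(2) by (auto simp: abs_less_iff)
      then show ?thesis using B(2)[of "y - t"] y(1) by simp
    qed
    also have "\<dots> \<le> (B + 1) * (\<bar>y - t\<bar> * \<bar>y - t\<bar>)"
      by (simp add: power2_eq_square distrib_right)
    also have "\<dots> = (\<bar>y - t\<bar> * (B + 1)) * \<bar>y - t\<bar>" by simp
    also have "\<dots> \<le> e * \<bar>y - t\<bar>" by (intro mult_right_mono *) simp
    finally show "norm (\<psi> y - \<psi> t - (y - t) *\<^sub>R \<phi> t) \<le> e * norm (y - t)" by simp
  qed
  then show ?thesis
    unfolding has_vector_derivative_def has_derivative_within_alt
    by (simp add: bounded_linear_scaleR_left)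
qed

lemma \<psi>_remainder_bigo:
  assumes "0 \<le> t"
  shows "(\<lambda>\<delta>. norm (\<psi> (t + \<delta>) - \<psi> t - \<delta> *\<^sub>R \<phi> t)) \<in> O[at 0 within {-t..}](\<lambda>\<delta>. \<delta>\<^sup>2)"
proof -
  obtain B where B: "0 \<le> B" "\<And>\<delta>. - t \<le> \<delta> \<Longrightarrow> \<delta> \<le> 1 \<Longrightarrow>
      norm (\<psi> (t + \<delta>) - \<psi> t - \<delta> *\<^sub>R \<phi> t) \<le> B * \<delta>\<^sup>2"
    using \<psi>_remainder[OF assms] by blast
  show ?thesis
  proof (rule bigoI[of _ B])
    show "\<forall>\<^sub>F \<delta> in at 0 within {-t..}. norm (norm (\<psi> (t + \<delta>) - \<psi> t - \<delta> *\<^sub>R \<phi> t)) \<le> B * norm (\<delta>\<^sup>2)"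
      unfolding eventually_at using B(2) by (intro exI[of _ 1]) (auto simp: dist_real_def)
  qed
qed

lemma reg_solution_distance:
  assumes "0 < k" "0 \<le> t"
  shows "ennreal ((norm (reg_solution q lam b c k \<psi>0 t - \<psi> t))\<^sup>2)
    \<le> ennreal (12 * \<gamma> / sqrt k) * (moment lam 1 \<psi>0 + ennreal (\<kappa> * (norm \<psi>0)\<^sup>2))"
proof -
  have "(norm (reg_solution q lam b c k \<psi>0 t - \<psi> t))\<^sup>2 \<le> \<eta> k"
  proof (rule norm_ell2_le)
    fix F :: "('n \<Rightarrow> nat) set" assume "finite F"
    then show "wsum F (\<lambda>_. 1) (coef (reg_solution q lam b c k \<psi>0 t - \<psi> t)) \<le> \<eta> k"
      using \<Psi>_distance[OF assms] assms
      by (simp add: coef_diff coef_\<psi> coef_reg_solution[OF lam_pos])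
  qed
  \<comment> \<open>Doubling the constant of the distance estimate is legitimate because \<gamma>
    and \<open>E0\<close> are nonnegative.\<close>
  also have "\<eta> k \<le> 12 * \<gamma> / sqrt k * E0"
    unfolding \<eta>_def using \<gamma>_nonneg E0_nonneg assms(1)
    by (intro mult_right_mono divide_right_mono) auto
  finally have "ennreal ((norm (reg_solution q lam b c k \<psi>0 t - \<psi> t))\<^sup>2) \<le> ennreal (12 * \<gamma> / sqrt k * E0)"
    by (rule ennreal_leI)
  also have "\<dots> = ennreal (12 * \<gamma> / sqrt k) * ennreal E0"
    using \<gamma>_nonneg E0_nonneg assms(1) by (intro ennreal_mult) auto
  also have "ennreal E0 = moment lam 1 \<psi>0 + ennreal (\<kappa> * (norm \<psi>0)\<^sup>2)"
    unfolding E0_def using \<kappa>_nonneg moment1_finite by (subst ennreal_plus) (auto simp: less_top)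
  finally show ?thesis .
qed

end

theorem theorem3:
  fixes q J :: real and s :: nat
    and lam :: "'n::{finite,linorder} \<Rightarrow> real"
    and b :: "'n \<Rightarrow> 'n \<Rightarrow> real" and c :: "'n \<Rightarrow> 'n \<Rightarrow> 'n \<Rightarrow> real"
    and \<psi>0 :: "'n fock"
  defines "lam1 \<equiv> lam (Min UNIV)"
  defines "\<gamma> \<equiv> 2 * sqrt q * real s * J / lam1\<^sup>2 * (1 + sqrt lam1 / sqrt q)"
  defines "\<kappa>1 \<equiv> 2 * J\<^sup>2 * (real s)\<^sup>2 / lam1 * (1 + 16 * q / lam1)"
  assumes "q > 0" and "0 < lam1" and "mono lam"
    and "\<And>i j k. c i j k = c i k j"
    and "\<And>i j. \<bar>b i j\<bar> \<le> J" and "\<And>i j k. \<bar>c i j k\<bar> \<le> J"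
    and "sparse_coeffs s b c" and "divergence_free lam b c"
    and "\<psi>0 \<in> fock0" and "moment lam 8 \<psi>0 < \<infinity>"
  shows "\<exists>\<psi> :: real \<Rightarrow> 'n fock.
    \<psi> 0 = \<psi>0 \<and>
    (\<forall>t\<ge>0. \<psi> t \<in> fock0 \<and> moment lam 3 (\<psi> t) < \<infinity> \<and>
      (\<exists>\<phi>\<in>fock0. coef \<phi> = K_op q lam b c (coef (\<psi> t)) \<and>
        (\<psi> has_vector_derivative \<phi>) (at t within {0..}) \<and>
        (\<lambda>\<delta>. norm (\<psi> (t + \<delta>) - \<psi> t - \<delta> *\<^sub>R \<phi>)) \<in> O[at 0 within {-t..}](\<lambda>\<delta>. \<delta>\<^sup>2))) \<and>
    (\<forall>k>0. \<forall>t\<ge>0.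
      ennreal ((norm (reg_solution q lam b c k \<psi>0 t - \<psi> t))\<^sup>2)
        \<le> ennreal (12 * \<gamma> / sqrt k) * (moment lam 1 \<psi>0 + ennreal (\<kappa>1 * (norm \<psi>0)\<^sup>2)))"
proof -
  interpret F: flow_start lam lam1 q J s b c \<psi>0
  proof
    show "lam1 \<le> lam i" for i
      unfolding lam1_def by (intro monoD[OF \<open>mono lam\<close>] Min_le) auto
  qed (fact assms)+
  have \<gamma>_eq: "F.\<gamma> = \<gamma>" by (simp add: F.\<gamma>_def \<gamma>_def)
  have \<kappa>_eq: "F.\<kappa> = \<kappa>1" by (simp add: F.\<kappa>_def \<kappa>1_def)
  show ?thesis
  proof (intro exI[of _ F.\<psi>] conjI allI impI)
    show "F.\<psi> 0 = \<psi>0" by (rule F.\<psi>_start)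
    fix t :: real assume t: "0 \<le> t"
    show "F.\<psi> t \<in> fock0" using t by (simp add: fock0_def F.coef_\<psi> F.\<Psi>_vacuum)
    show "moment lam 3 (F.\<psi> t) < \<infinity>" using t by (rule F.\<psi>_moment)
    \<comment> \<open>The derivative stays in \<open>fock0\<close> since every term of the generator
      ends with a creation, so its vacuum row vanishes.\<close>
    show "\<exists>\<phi>\<in>fock0. coef \<phi> = K_op q lam b c (coef (F.\<psi> t)) \<and>
        (F.\<psi> has_vector_derivative \<phi>) (at t within {0..}) \<and>
        (\<lambda>\<delta>. norm (F.\<psi> (t + \<delta>) - F.\<psi> t - \<delta> *\<^sub>R \<phi>)) \<in> O[at 0 within {-t..}](\<lambda>\<delta>. \<delta>\<^sup>2)"
      using t F.\<psi>_has_vector_derivative[OF t] F.\<psi>_remainder_bigo[OF t]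
      by (intro bexI[of _ "F.\<phi> t"]) (simp_all add: fock0_def F.coef_\<psi> F.coef_\<phi> F.K_vacuum)
  next
    fix k t :: real assume "0 < k" "0 \<le> t"
    then show "ennreal ((norm (reg_solution q lam b c k \<psi>0 t - F.\<psi> t))\<^sup>2)
        \<le> ennreal (12 * \<gamma> / sqrt k) * (moment lam 1 \<psi>0 + ennreal (\<kappa>1 * (norm \<psi>0)\<^sup>2))"
      unfolding \<gamma>_eq[symmetric] \<kappa>_eq[symmetric] by (rule F.reg_solution_distance)
  qed
qed

end
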